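(* Let $q$ be an odd prime power, and let $\mathcal C, \mathcal D \subset \mathbb P^2$ be two smooth plane conics defined over $\mathbb F_q$ with transversal intersection, represented by symmetric $3\times 3$ matrices $C$ and $D$ over $\mathbb F_q$. Consider the two elliptic curves over $\mathbb F_q$ $$E_1: y^2 = \det(D)\det(xC + D), \qquad E_2: y^2 = \det(C)\det(xD + C),$$ and let $t_1$ and $t_2$ be their respective Frobenius traces. Let $b_1$ be the number of $\mathbb F_q$-rational intersection points of $\mathcal C$ and $\mathcal D$, and let $b_2$ be the number of $\mathbb F_q$-rational intersection points of the dual conics $\mathcal C^*$ and $\mathcal D^*$. Then \begin{align*} N_{\mathrm{ext\text{-}int}}(\mathcal C,\mathcal D) &= \frac14\left(q^2-b_2q-1-t_1+b_1+t_2\right),\\ N_{\mathrm{int\text{-}ext}}(\mathcal C,\mathcal D) &= \frac14\left(q^2-b_2q-1+t_1+b_1-t_2\right),\\ N_{\mathrm{ext\text{-}ext}}(\mathcal C,\mathcal D) &= \frac14\left(q^2+b_2q-1+t_1+b_1+t_2\right),\\ N_{\mathrm{int\text{-}int}}(\mathcal C,\mathcal D) &= \frac14\left(q^2+b_2q-1-t_1+b_1-t_2-4q\right). \end{align*} In particular, for each of the four quantities $N \in \{N_{\mathrm{ext\text{-}int}}(\mathcal C,\mathcal D), N_{\mathrm{int\text{-}ext}}(\mathcal C,\mathcal D), N_{\mathrm{ext\text{-}ext}}(\mathcal C,\mathcal D), N_{\mathrm{int\text{-}int}}(\mathcal C,\mathcal D)\}$ one has $$\left|N - \frac{q^2}{4}\right|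 \le q+\sqrt q+1.$$
   Context: A conic $\mathcal C$ is represented by a symmetric $3\times3$ matrix $C$ over $\mathbb F_q$ if $\mathcal C=\{[v]\in\mathbb P^2 : v^{T}Cv=0\}$; it is smooth iff $\det C\neq 0$. Two conics intersect transversally if they meet transversally over $\overline{\mathbb F_q}$, i.e. in four distinct points of $\mathbb P^2(\overline{\mathbb F_q})$. The dual conic $\mathcal C^*$ of a smooth conic $\mathcal C$ is the smooth conic in the dual projective plane whose points are the tangent lines of $\mathcal C$; it is represented by $C^{-1}$. So $\mathbb F_q$-rational points of $\mathcal C^*\cap\mathcal D^*$ are the lines defined over $\mathbb F_q$ that are tangent to both $\mathcal C$ and $\mathcal D$. Let $P\in\mathbb P^2(\mathbb F_q)\setminus\mathcal C$. Over $\overline{\mathbb F_q}$ there are exactly two distinct tangent lines of $\mathcal C$ through $P$. The point $P$ is called external to $\mathcal C$ if these two tangent lines are defined over $\mathbb F_q$, and internal to $\mathcal C$ if they are Galois-conjugate lines defined over $\mathbb F_{q^2}$ but not over $\mathbb F_q$. (Points lying on $\mathcal C$ are neither.) $N_{\mathrm{ext\text{-}int}}(\mathcal C,\mathcal D)$ denotes the number of points of $\mathbb P^2(\mathbb F_q)$ that are external to $\mathcal C$ and internal to $\mathcal D$. Similarly $N_{\mathrm{int\text{-}ext}}$, $N_{\mathrm{ext\text{-}ext}}$, $N_{\mathrm{int\text{-}int}}$ count the points with the indicated positions, where the first label refers to $\mathcal C$ and the second to $\mathcal D$. The elliptic curve given by an affine equation $y^2=g(x)$ with $g$ a separable cubic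 means the smooth projective model (one point at infinity). The Frobenius trace of an elliptic curve $E$ over $\mathbb F_q$ is $t=q+1-|E(\mathbb F_q)|$. *)

theory Defs
  imports "HOL-Analysis.Analysis" "HOL-Algebra.Algebraic_Closure_Type"
begin

section \<open>The projective plane, conics and dual conics\<close>

text \<open>
  The point with homogeneous coordinates \<open>v \<noteq> 0\<close> is the one-dimensional subspace \<open>vec.span {v}\<close>.
  The dual plane uses the same type: \<open>vec.span {l}\<close> is the line of all points
  \<open>vec.span {v}\<close> with \<open>l \<bullet> v = 0\<close>.
\<close>

type_synonym 'k ppoint = "('k ^ 3) set"
type_synonym 'k pline = "('k ^ 3) set"

definition lies_on :: "'k::field ppoint \<Rightarrow> 'k pline \<Rightarrow> bool" where
  "lies_on P L \<longleftrightarrow> (\<forall>v\<in>P. \<forall>l\<in>L. scalar_product l v = 0)"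

definition plane_conic :: "'k::field ^ 3 ^ 3 \<Rightarrow> 'k ppoint set" where
  "plane_conic A = {vec.span {v} | v. v \<noteq> 0 \<and> scalar_product v (A *v v) = 0}"

text \<open>
  The gradient of \<open>v\<^sup>T A v\<close> at \<open>v\<close> is \<open>2 A v\<close> for symmetric \<open>A\<close>. So, away from characteristic 2,
  the tangent line of the smooth conic \<open>plane_conic A\<close> at the point \<open>[v]\<close> has dual coordinates \<open>[A v]\<close>.
\<close>

definition dual_conic :: "'k::field ^ 3 ^ 3 \<Rightarrow> 'k pline set" where
  "dual_conic A = {vec.span {A *v v} | v. v \<noteq> 0 \<and> scalar_product v (A *v v) = 0}"

lemma dual_conic_eq_conic_inv:
  fixes A :: "'k::field ^ 3 ^ 3"
  assumes "det A \<noteq> 0"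
  shows "dual_conic A = plane_conic (matrix_inv A)"
proof -
  have inv: "invertible A"
    using assms by (simp add: invertible_det_nz)
  have l: "matrix_inv A *v (A *v v) = v" and r: "A *v (matrix_inv A *v v) = v" for v
    using someI_ex[OF inv[unfolded invertible_def]]
    by (simp_all add: matrix_inv_def matrix_vector_mul_assoc)
  have comm: "scalar_product v w = scalar_product w v" for v w :: "'k ^ 3"
    by (simp add: scalar_product_def mult.commute)
  show ?thesis
  proof (intro equalityI subsetI)
    fix L assume "L \<in> dual_conic A"
    then obtain v where v: "v \<noteq> 0" "scalar_product v (A *v v) = 0" "L = vec.span {A *v v}"
      by (auto simp: dual_conic_def)
    have "A *v v \<noteq> 0"
      using l[of v] v(1) by auto
    moreover have "scalar_product (A *v v) (matrix_inv A *v (A *v v)) = 0"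
      using v(2) by (simp add: l comm)
    ultimately show "L \<in> plane_conic (matrix_inv A)"
      unfolding plane_conic_def using v(3) by blast
  next
    fix L assume "L \<in> plane_conic (matrix_inv A)"
    then obtain w where w: "w \<noteq> 0" "scalar_product w (matrix_inv A *v w) = 0" "L = vec.span {w}"
      by (auto simp: plane_conic_def)
    define v where "v = matrix_inv A *v w"
    have Av: "A *v v = w"
      by (simp add: v_def r)
    then have "v \<noteq> 0"
      using w(1) by auto
    moreover have "scalar_product v (A *v v) = 0"
      unfolding Av using w(2) by (simp add: v_def comm)
    ultimately show "L \<in> dual_conic A"
      unfolding dual_conic_def using w(3) Av by blast
  qed
qed


section \<open>Fields of definition\<close>

text \<open>
  A finite field type \<open>'a\<close> plays the role of the field with \<open>q = CARD('a)\<close> elements. All points and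
  lines live over its algebraic closure; \<open>defined_over k\<close> says that a point or line
  has homogeneous coordinates in the subfield \<open>k\<close>.
\<close>

definition defined_over :: "'k::field set \<Rightarrow> ('k ^ 3) set \<Rightarrow> bool" where
  "defined_over k P \<longleftrightarrow> (\<exists>v. v \<noteq> 0 \<and> (\<forall>i. v $ i \<in> k) \<and> P = vec.span {v})"

abbreviation base_field :: "'a::finite_field alg_closure set" where
  "base_field \<equiv> range to_ac"

text \<open>The unique subfield of the algebraic closure that has \<open>q\<^sup>2\<close> elements.\<close>

definition quadratic_ext :: "'a::finite_field alg_closure set" where
  "quadratic_ext = {x. x ^ (CARD('a) ^ 2) = x}"

definition galois_conj :: "('a::finite_field alg_closure ^ 3) set \<Rightarrow> ('a alg_closure ^ 3) set" where
  "galois_conj L = (\<lambda>v. \<chi> i. (v $ i) ^ CARD('a)) ` L"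

abbreviation to_closure :: "'a::finite_field ^ 3 ^ 3 \<Rightarrow> 'a alg_closure ^ 3 ^ 3" where
  "to_closure A \<equiv> map_matrix to_ac A"

definition transversal_conics :: "'a::finite_field ^ 3 ^ 3 \<Rightarrow> 'a ^ 3 ^ 3 \<Rightarrow> bool" where
  "transversal_conics C D \<longleftrightarrow> card (plane_conic (to_closure C) \<inter> plane_conic (to_closure D)) = 4"

definition num_rational :: "('a::finite_field alg_closure ^ 3) set set \<Rightarrow> nat" where
  "num_rational S = card {P \<in> S. defined_over base_field P}"


section \<open>External and internal points\<close>

definition tangents_through ::
    "'a::finite_field ^ 3 ^ 3 \<Rightarrow> 'a alg_closure ppoint \<Rightarrow> 'a alg_closure pline set" where
  "tangents_through C P = {L \<in> dual_conic (to_closure C). lies_on P L}"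

definition external :: "'a::finite_field ^ 3 ^ 3 \<Rightarrow> 'a alg_closure ppoint \<Rightarrow> bool" where
  "external C P \<longleftrightarrow>
     defined_over base_field P \<and> P \<notin> plane_conic (to_closure C) \<and>
     (\<exists>L M. L \<noteq> M \<and> tangents_through C P = {L, M} \<and>
        defined_over base_field L \<and> defined_over base_field M)"

definition internal :: "'a::finite_field ^ 3 ^ 3 \<Rightarrow> 'a alg_closure ppoint \<Rightarrow> bool" where
  "internal C P \<longleftrightarrow>
     defined_over base_field P \<and> P \<notin> plane_conic (to_closure C) \<and>
     (\<exists>L M. L \<noteq> M \<and> tangents_through C P = {L, M} \<and> M = galois_conj L \<and>
        defined_over quadratic_ext L \<and> defined_over quadratic_ext M \<and>
        \<not> defined_over base_field L \<and> \<not> defined_over base_field M)"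

definition N_ext_int :: "'a::finite_field ^ 3 ^ 3 \<Rightarrow> 'a ^ 3 ^ 3 \<Rightarrow> nat" where
  "N_ext_int C D = card {P. external C P \<and> internal D P}"

definition N_int_ext :: "'a::finite_field ^ 3 ^ 3 \<Rightarrow> 'a ^ 3 ^ 3 \<Rightarrow> nat" where
  "N_int_ext C D = card {P. internal C P \<and> external D P}"

definition N_ext_ext :: "'a::finite_field ^ 3 ^ 3 \<Rightarrow> 'a ^ 3 ^ 3 \<Rightarrow> nat" where
  "N_ext_ext C D = card {P. external C P \<and> external D P}"

definition N_int_int :: "'a::finite_field ^ 3 ^ 3 \<Rightarrow> 'a ^ 3 ^ 3 \<Rightarrow> nat" where
  "N_int_int C D = card {P. internal C P \<and> internal D P}"


section \<open>Elliptic curves \<open>y\<^sup>2 = g(x)\<close>\<close>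

definition separable_cubic :: "'a::field poly \<Rightarrow> bool" where
  "separable_cubic g \<longleftrightarrow> Polynomial.degree g = 3 \<and> coprime g (pderiv g)"

text \<open>
  The rational points of the smooth projective model of \<open>y\<^sup>2 = g(x)\<close>, for a separable cubic \<open>g\<close>
  in odd characteristic; \<open>None\<close> is the point at infinity.
\<close>

definition curve_points :: "'a::finite_field poly \<Rightarrow> ('a \<times> 'a) option set" where
  "curve_points g = insert None (Some ` {(x, y). y ^ 2 = poly g x})"

definition frobenius_trace :: "'a::finite_field poly \<Rightarrow> int" where
  "frobenius_trace g = int CARD('a) + 1 - int (card (curve_points g))"

text \<open>The polynomial \<open>det D * det (x C + D)\<close> in \<open>x\<close>; the entries of \<open>x C + D\<close> are \<open>[:D\<^sub>i\<^sub>j, C\<^sub>i\<^sub>j:]\<close>.\<close>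

definition pencil_cubic :: "'a::field ^ 3 ^ 3 \<Rightarrow> 'a ^ 3 ^ 3 \<Rightarrow> 'a poly" where
  "pencil_cubic C D = Polynomial.smult (det D) (det (\<chi> i j. [:D $ i $ j, C $ i $ j:]))"

end

theory Submission
  imports Defs
begin

text \<open>
  Let \<open>c(P)\<close> be \<open>1\<close>, \<open>-1\<close> or \<open>0\<close> when \<open>P\<close> is external to, internal to or on \<open>C\<close>, and define
  \<open>d(P)\<close> likewise for \<open>D\<close>. Then \<open>c(P) = \<chi>(- det C * Q\<^sub>C(P))\<close> for the quadratic character \<open>\<chi>\<close>, and
  \<open>1 + c(P)\<close> rational tangents of \<open>C\<close> pass through \<open>P\<close>. The four counts are combinations of sums of
  products of powers of \<open>c\<close> and \<open>d\<close>. Counting the triples of a point and two tangents through it, one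
  of \<open>C\<close> and one of \<open>D\<close>, expresses the sum of \<open>c d\<close> by \<open>b\<^sub>2\<close>. Summing \<open>\<chi>(Q\<^sub>C(P) + x * Q\<^sub>D(P))\<close> over all
  \<open>P\<close> and \<open>x\<close> in both orders shows that the sum of \<open>c\<close> over \<open>D\<close> is \<open>-t\<^sub>2\<close>; here transversality
  enters, since it keeps the rank of \<open>C + x D\<close> at least 2. The final estimate needs the Hasse bound,
  for which Manin's elementary argument is used.
\<close>

section \<open>The quadratic character of a finite field\<close>

text \<open>Counting takes place on nonzero vectors over the base field, where a rational point
  weighs \<open>q - 1\<close>; the closure serves to translate the definitions and to study the four
  common points. Taking three of these as unit vectors gives every form of the pencil zero diagonal,
  so the pencil determinant splits into three linear factors with distinct roots. This yields both
  that the curves are elliptic and the simple roots that Manin's argument needs. The character sum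
  of a ternary form is a fixed multiple of \<open>qchar (- det M)\<close> only from rank 2 on; a
  nonzero form of rank 1 has determinant 0 but a nonzero sum. The sum of \<open>c\<close> over
  \<open>D\<close> leads to \<open>t2\<close> and not to \<open>t1\<close>, because there
  \<open>D\<close> carries the variable \<open>x\<close> and \<open>det C\<close> is the normalising
  factor. In the estimate \<open>b2\<close> is multiplied by \<open>q\<close>, so
  \<open>b2 <= 4\<close> must be known. This is a five-point argument for the inverse matrices in
  the dual plane. Manin's argument reads the trace off the degree of one numerator. Degrees along
  the sequence form a quadratic polynomial in the index, and their nonnegativity bounds its
  discriminant.\<close>

abbreviation pdeg :: "'r::zero poly \<Rightarrow> nat" where "pdeg \<equiv> Polynomial.degree"

text \<open>Take an additive subgroup whose order is a power of the characteristic \<open>p\<close>,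
  with the exponent as large as possible. If an element \<open>x\<close> were missing, the
  translates of the subgroup by the \<open>p\<close> multiples of \<open>x\<close> would form a
  subgroup \<open>p\<close> times larger.\<close>

lemma card_eq_CHAR_power: "\<exists>n. CARD('a::finite_field) = CHAR('a) ^ n"
proof -
  let ?p = "CHAR('a)"
  have p: "normalization_semidom_class.prime ?p" by simp
  then have p1: "?p > 1" by (rule prime_gt_1_nat)
  define G where "G k H \<longleftrightarrow> (0::'a) \<in> H \<and> (\<forall>x\<in>H. \<forall>y\<in>H. x + y \<in> H) \<and> card H = ?p ^ k"
    for k :: nat and H :: "'a set"
  have bound: "k \<le> CARD('a)" if ex: "\<exists>H. G k H" for k
  proof -
    obtain H where "G k H" using ex by blast
    then have "?p ^ k \<le> CARD('a)" unfolding G_def by (metis card_mono finite_class.finite_UNIV subset_UNIV)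
    moreover have "k < ?p ^ k" using power_gt_expt[of ?p k] p1 by simp
    ultimately show ?thesis by simp
  qed
  have "G 0 {0}" by (simp add: G_def)
  then have "\<exists>k. \<exists>H. G k H" by blast
  then obtain k where k: "\<exists>H. G k H" and k_max: "\<And>l. \<exists>H. G l H \<Longrightarrow> l \<le> k"
    using Nat.ex_has_greatest_nat[of "\<lambda>k. \<exists>H. G k H" _ "CARD('a)"] bound by blast
  then obtain H :: "'a set" where H: "0 \<in> H" "\<And>x y. x \<in> H \<Longrightarrow> y \<in> H \<Longrightarrow> x + y \<in> H" "card H = ?p ^ k"
    unfolding G_def by blast
  have mult: "of_nat n * x \<in> H" if "x \<in> H" for n x
    by (induction n) (use that H in \<open>auto simp: algebra_simps\<close>)
  have neg: "- x \<in> H" if "x \<in> H" for x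
  proof -
    have "of_nat (?p - 1) * x = - x"
      using p1 by (simp add: of_nat_diff less_imp_le)
    with mult[OF that, of "?p - 1"] show ?thesis by simp
  qed
  have "H = UNIV"
  proof (rule ccontr)
    assume "H \<noteq> UNIV"
    then obtain x where x: "x \<notin> H" by blast
    define H' where "H' = (\<lambda>(h, i). h + of_nat i * x) ` (H \<times> {..<?p})"
    \<comment> \<open>Two coinciding translates put \<open>(j - i) * x\<close> into
      \<open>H\<close>; as \<open>j - i\<close> is invertible modulo \<open>p\<close>,
      \<open>x\<close> itself would lie in \<open>H\<close>.\<close>
    have no: False if "i < j" "j < ?p" "h \<in> H" "h' \<in> H" "h + of_nat i * x = h' + of_nat j * x" for h h' i j
    proof -
      have "of_nat (j - i) * x = h + - h'"
        using that by (simp add: of_nat_diff algebra_simps)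
      then have *: "of_nat (j - i) * x \<in> H"
        using H(2)[OF that(3) neg[OF that(4)]] by simp
      have "Rings.algebraic_semidom_class.coprime (j - i) ?p"
        using that p by (metis coprime_commute diff_le_self dvd_imp_le leD le_less_trans prime_imp_coprime_nat zero_less_diff)
      then obtain c e where ce: "(j - i) * c = ?p * e + 1"
        using bezout_nat[of "j - i" ?p] \<open>i < j\<close> by auto
      have "of_nat c * (of_nat (j - i) * x) = of_nat ((j - i) * c) * x"
        by (simp only: of_nat_mult mult_ac)
      then have "x = of_nat c * (of_nat (j - i) * x)"
        unfolding ce by simp
      with mult[OF *, of c] x show False by simp
    qed
    have "inj_on (\<lambda>(h, i). h + of_nat i * x) (H \<times> {..<?p})"
    proof (rule inj_onI, clarify)
      fix h i h' j
      assume *: "h \<in> H" "i < ?p" "h' \<in> H" "j < ?p" "h + of_nat i * x = h' + of_nat j * x"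
      then have "i = j" using no[of i j h h'] no[of j i h' h] by (metis linorder_neqE_nat)
      then show "h = h' \<and> i = j" using * by simp
    qed
    then have "card H' = ?p ^ Suc k"
      by (simp add: H'_def card_image card_cartesian_product H(3))
    moreover have "0 \<in> H'"
      unfolding H'_def using H(1) p1 by (intro image_eqI[of _ _ "(0, 0)"]) auto
    moreover have "u + v \<in> H'" if uv: "u \<in> H'" "v \<in> H'" for u v
    proof -
      obtain h i h' j where *: "h \<in> H" "h' \<in> H" "u = h + of_nat i * x" "v = h' + of_nat j * x"
        using uv by (auto simp: H'_def)
      have "(of_nat (i + j) :: 'a) = of_nat ((i + j) mod ?p)"
        by (subst (1) mult_div_mod_eq[of ?p "i + j", symmetric]) (simp only: of_nat_add of_nat_mult of_nat_CHAR mult_zero_left add_0)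
      then have "u + v = (h + h') + of_nat ((i + j) mod ?p) * x"
        using * by (metis (no_types, lifting) add.assoc add.left_commute distrib_right of_nat_add)
      moreover have "h + h' \<in> H" using * H by blast
      ultimately show ?thesis
        unfolding H'_def using p1 by (intro image_eqI[of _ _ "(h + h', (i + j) mod ?p)"]) auto
    qed
    ultimately have "G (Suc k) H'" by (simp add: G_def)
    then have "Suc k \<le> k" using k_max by blast
    then show False by simp
  qed
  with H(3) show ?thesis by auto
qed

section \<open>Quadratic character and Euler's criterion\<close>

definition qchar :: "'a::finite_field \<Rightarrow> int" where
  "qchar x = (if x = 0 then 0 else if \<exists>y. x = y\<^sup>2 then 1 else -1)"

lemma qchar_0 [simp]: "qchar 0 = 0"
  by (simp add: qchar_def)

lemma qchar_eq_0_iff [simp]: "qchar x = 0 \<longleftrightarrow> x = 0"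
  by (simp add: qchar_def)

lemma qchar_square: "y \<noteq> 0 \<Longrightarrow> qchar (y\<^sup>2) = 1"
  by (auto simp: qchar_def)

lemma qchar_cases: "qchar x = 0 \<or> qchar x = 1 \<or> qchar x = -1"
  by (simp add: qchar_def)

context
  assumes odd_card: "odd CARD('a::finite_field)"
begin

lemma two_neq_zero: "(2 :: 'a) \<noteq> 0"
proof
  assume "(2 :: 'a) = 0"
  then have "CHAR('a) dvd 2" using of_nat_eq_0_iff_char_dvd[of 2, where 'a = 'a] by simp
  then have "CHAR('a) \<le> 2" by (rule dvd_imp_le) simp
  moreover have "CHAR('a) > 1" by (rule prime_gt_1_nat) simp
  ultimately have "CHAR('a) = 2" by simp
  moreover obtain n where n: "CARD('a) = CHAR('a) ^ n" using card_eq_CHAR_power by metis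
  ultimately have "odd ((2::nat) ^ n)" using odd_card by metis
  then have "n = 0" by (metis even_power even_numeral gr0I)
  with n have "CARD('a) = 1" by simp
  moreover have "card {0, 1 :: 'a} \<le> CARD('a)" by (rule card_mono) auto
  ultimately show False by simp
qed

lemma minus_one_neq_one: "(-1 :: 'a) \<noteq> 1"
proof
  assume "(-1 :: 'a) = 1"
  then have "1 + 1 = (0 :: 'a)" by (metis add.right_inverse)
  then show False using two_neq_zero by simp
qed

lemma card_ge_3: "CARD('a) \<ge> 3"
proof -
  have "card {0, 1, -1 :: 'a} = 3" using minus_one_neq_one minus_one_neq_one[symmetric] by (simp add: card_insert_if)
  moreover have "card {0, 1, -1 :: 'a} \<le> CARD('a)" by (rule card_mono) auto
  ultimately show ?thesis by simp
qed

lemma power_card_minus_1: "x \<noteq> 0 \<Longrightarrow> x ^ (CARD('a) - 1) = (1 :: 'a)"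
proof -
  assume "x \<noteq> 0"
  have "x ^ Suc (CARD('a) - 1) = x"
  proof -
    have "Suc (CARD('a) - 1) = CARD('a)" using card_ge_3 by simp
    then show ?thesis using finite_field_power_card_eq_same[of x] by (simp only:)
  qed
  then have "x * x ^ (CARD('a) - 1) = x * 1" by (simp only: power_Suc mult_1_right)
  with \<open>x \<noteq> 0\<close> show ?thesis using mult_left_cancel by blast
qed

lemma square_eq_cases: "{y. y\<^sup>2 = (z::'a)\<^sup>2} = {z, -z}"
  by (auto simp: power2_eq_iff)

text \<open>Euler's criterion by counting: \<open>x ^ h = 1\<close> with
  \<open>h = (q - 1) / 2\<close> has at most \<open>h\<close> roots and every nonzero square is one
  of them, while squaring is at most two-to-one on \<open>q - 1\<close> elements, so there are at
  least \<open>h\<close> squares.\<close>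

lemma squares_eq:
  "{x. x \<noteq> 0 \<and> (\<exists>y. x = y\<^sup>2)} = {x::'a. x ^ ((CARD('a) - 1) div 2) = 1}"
proof -
  let ?h = "(CARD('a) - 1) div 2"
  let ?S = "{x::'a. x \<noteq> 0 \<and> (\<exists>y. x = y\<^sup>2)}"
  have h: "CARD('a) - 1 = 2 * ?h" using odd_card by simp
  have hpos: "?h > 0" using card_ge_3 by simp
  have sub: "?S \<subseteq> {x. x ^ ?h = 1}"
  proof clarify
    fix y :: 'a assume "y\<^sup>2 \<noteq> 0"
    then have "y ^ (2 * ?h) = 1" using power_card_minus_1[of y] h by simp
    then show "(y\<^sup>2) ^ ?h = 1" by (simp only: power_mult)
  qed
  define p :: "'a poly" where "p = Polynomial.monom 1 ?h - 1"
  have "p \<noteq> 0"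
  proof
    assume "p = 0"
    then have "poly p 0 = 0" by simp
    then show False using hpos by (simp add: p_def poly_monom power_0_left del: One_nat_def)
  qed
  have "pdeg p \<le> ?h"
    unfolding p_def by (intro degree_diff_le) (auto simp: degree_monom_le)
  then have "card {x. poly p x = 0} \<le> ?h"
    using card_poly_roots_bound[OF \<open>p \<noteq> 0\<close>] by linarith
  then have le: "card {x::'a. x ^ ?h = 1} \<le> ?h"
    by (simp add: p_def poly_monom)
  have "(UNIV :: 'a set) - {0} = (\<Union>s\<in>?S. {y. y\<^sup>2 = s})" by auto
  then have "card ((UNIV :: 'a set) - {0}) \<le> (\<Sum>s\<in>?S. card {y. y\<^sup>2 = s})"
    using card_UN_le[of ?S "\<lambda>s. {y. y\<^sup>2 = s}"] by simp
  also have "\<dots> \<le> (\<Sum>s\<in>?S. 2)"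
  proof (rule sum_mono)
    fix s assume "s \<in> ?S"
    then obtain z where "s = z\<^sup>2" by blast
    then show "card {y. y\<^sup>2 = s} \<le> 2" by (simp add: square_eq_cases card_insert_if)
  qed
  finally have "?h \<le> card ?S" using h by (simp add: card_Diff_singleton)
  then show ?thesis using sub le
    by (meson card_seteq finite_subset finite_class.finite_UNIV subset_UNIV order_trans)
qed

text \<open>An identity in the field, so that multiplicativity becomes that of powers and the
  polynomial \<open>mu\<close> of Manin's argument can be evaluated at base field points.\<close>

lemma of_int_qchar: "of_int (qchar x) = x ^ ((CARD('a) - 1) div 2)" for x :: 'a
proof (cases "x = 0")
  case True
  then show ?thesis using card_ge_3 by (simp add: power_0_left)
next
  case False
  let ?h = "(CARD('a) - 1) div 2"
  have "(x ^ ?h)\<^sup>2 = 1"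
    using power_card_minus_1[OF False] odd_card by (simp flip: power_mult)
  then have "x ^ ?h = 1 \<or> x ^ ?h = -1" by (simp add: power2_eq_1_iff)
  moreover have "x ^ ?h = 1 \<longleftrightarrow> (\<exists>y. x = y\<^sup>2)"
    using squares_eq False by blast
  ultimately show ?thesis using False by (auto simp: qchar_def)
qed

lemma qchar_mult: "qchar (x * y) = qchar x * qchar y" for x y :: 'a
proof -
  have eq: "(of_int (qchar (x * y)) :: 'a) = of_int (qchar x * qchar y)"
    by (simp add: of_int_qchar power_mult_distrib)
  \<comment> \<open>The values -1, 0, 1 stay distinct in odd characteristic, so an identity in the
    field lifts to the integers.\<close>
  have inj: "m = n" if "of_int m = (of_int n :: 'a)" "m \<in> {-1, 0, 1}" "n \<in> {-1, 0, 1}" for m n :: int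
    using that minus_one_neq_one minus_one_neq_one[symmetric] by (elim insertE emptyE) simp_all
  have qc: "qchar z \<in> {-1, 0, 1}" for z :: 'a
    using qchar_cases by blast
  have prod: "m * n \<in> {-1, 0, 1}" if "m \<in> {-1, 0, 1}" "n \<in> {-1, 0, 1}" for m n :: int
    using that by auto
  show ?thesis by (rule inj[OF eq qc prod[OF qc qc]])
qed

lemma qchar_mult_square: "z \<noteq> 0 \<Longrightarrow> qchar (z\<^sup>2 * x) = qchar x" for x z :: 'a
  by (simp add: qchar_mult qchar_square)

lemma qchar_mult_self: "x \<noteq> 0 \<Longrightarrow> qchar x * qchar x = 1" for x :: 'a
  using qchar_cases[of x] by auto

lemma card_roots_square: "int (card {y. y\<^sup>2 = x}) = 1 + qchar x" for x :: 'a
proof (cases "\<exists>z. x = z\<^sup>2")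
  case True
  then obtain z where z: "x = z\<^sup>2" by blast
  show ?thesis
  proof (cases "z = 0")
    case False
    then have "z \<noteq> - z"
      using two_neq_zero by (metis add_eq_0_iff mult_2 mult_eq_0_iff)
    then show ?thesis using z False by (simp add: square_eq_cases qchar_square)
  qed (simp add: z)
next
  case False
  then have "{y. y\<^sup>2 = x} = {}" by auto
  moreover have "x \<noteq> 0" using False by (metis zero_power2)
  ultimately show ?thesis using False by (simp add: qchar_def)
qed

section \<open>Character sums and zeros of binary quadratic forms\<close>

lemma sum_qchar: "(\<Sum>x\<in>(UNIV::'a set). qchar x) = 0"
proof -
  have "card (\<Union>x. {y::'a. y\<^sup>2 = x}) = (\<Sum>x\<in>UNIV. card {y::'a. y\<^sup>2 = x})"
    by (rule card_UN_disjoint) auto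
  moreover have "(\<Union>x. {y::'a. y\<^sup>2 = x}) = UNIV" by auto
  ultimately have "int CARD('a) = (\<Sum>x\<in>UNIV. int (card {y::'a. y\<^sup>2 = x}))"
    by simp
  also have "\<dots> = (\<Sum>x\<in>(UNIV::'a set). 1 + qchar x)"
    by (simp only: card_roots_square)
  finally have "int CARD('a) = (\<Sum>x\<in>(UNIV::'a set). 1 + qchar x)" .
  then show ?thesis by (simp add: sum.distrib)
qed

lemma sum_qchar_linear: "a \<noteq> 0 \<Longrightarrow> (\<Sum>x\<in>(UNIV::'a set). qchar (a * x + b)) = 0"
proof -
  assume "a \<noteq> 0"
  then have "(\<Sum>x\<in>(UNIV::'a set). qchar (a * x + b)) = (\<Sum>x\<in>(UNIV::'a set). qchar x)"
    by (intro sum.reindex_bij_witness[of _ "\<lambda>x. (x - b) / a" "\<lambda>x. a * x + b"]) auto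
  then show ?thesis by (simp add: sum_qchar)
qed

text \<open>For \<open>d \<noteq> 0\<close> the hyperbola \<open>(x + y) * (x - y) = d\<close> is
  parametrised by \<open>u = x + y\<close>, hence has \<open>q - 1\<close> points; above each
  \<open>x\<close> lie \<open>1 + qchar (x\<^sup>2 - d)\<close> of them.\<close>

lemma sum_qchar_square_minus:
  "(\<Sum>x\<in>(UNIV::'a set). qchar (x\<^sup>2 - d)) = (if d = 0 then int CARD('a) - 1 else -1)"
proof (cases "d = 0")
  case True
  have "(\<Sum>x\<in>(UNIV::'a set). qchar (x\<^sup>2)) = (\<Sum>x\<in>UNIV-{0::'a}. qchar (x\<^sup>2))"
    by (intro sum.mono_neutral_right) auto
  also have "\<dots> = (\<Sum>x\<in>UNIV-{0::'a}. 1)"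
    by (intro sum.cong) (auto simp: qchar_square)
  also have "\<dots> = int CARD('a) - 1"
    using card_ge_3 by (simp add: card_Diff_singleton of_nat_diff)
  finally show ?thesis using True by simp
next
  case False
  let ?S = "SIGMA x:UNIV::'a set. {y. y\<^sup>2 = x\<^sup>2 - d}"
  have "(\<Sum>x\<in>(UNIV::'a set). 1 + qchar (x\<^sup>2 - d)) = int (card ?S)"
    by (subst card_SigmaI) (auto simp: card_roots_square)
  also have "card ?S = card (UNIV - {0::'a})"
  proof (rule bij_betw_same_card)
    have nz: "x + y \<noteq> 0" if "y\<^sup>2 = x\<^sup>2 - d" for x y
    proof
      assume "x + y = 0"
      moreover have "d = (x + y) * (x - y)" using that by (simp add: algebra_simps power2_eq_square)
      ultimately show False using False by simp
    qed
    have key: "(x + y + d / (x + y)) / 2 = x \<and> (x + y - d / (x + y)) / 2 = y" if "y\<^sup>2 = x\<^sup>2 - d" for x y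
    proof -
      have "d = (x + y) * (x - y)" using that by (simp add: algebra_simps power2_eq_square)
      then have "d / (x + y) = x - y" using nz[OF that] by (metis nonzero_mult_div_cancel_left)
      moreover have "x + y + (x - y) = 2 * x" "x + y - (x - y) = 2 * y" by simp_all
      ultimately show ?thesis using two_neq_zero by (simp only: nonzero_mult_div_cancel_left simp_thms)
    qed
    have key': "(u + d / u) / 2 + (u - d / u) / 2 = u" for u
      using two_neq_zero by (metis add_diff_cancel_left' add_divide_distrib diff_add_cancel mult_2 nonzero_mult_div_cancel_left add.assoc add.commute)
    have sq: "((u - d / u) / 2)\<^sup>2 = ((u + d / u) / 2)\<^sup>2 - d" if "u \<noteq> 0" for u
    proof -
      have "(u + d / u)\<^sup>2 - (u - d / u)\<^sup>2 = 2\<^sup>2 * d"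
        using that by (simp add: power2_eq_square algebra_simps)
      then have "(u - d / u)\<^sup>2 / 2\<^sup>2 = (u + d / u)\<^sup>2 / 2\<^sup>2 - d"
        using two_neq_zero by (metis add_diff_cancel_left' diff_add_cancel diff_divide_distrib nonzero_mult_div_cancel_left power_not_zero)
      then show ?thesis by (simp only: power_divide)
    qed
    show "bij_betw (\<lambda>(x, y). x + y) ?S (UNIV - {0})"
    proof (rule bij_betw_byWitness[where f' = "\<lambda>u. ((u + d / u) / 2, (u - d / u) / 2)"])
      show "\<forall>a\<in>?S. (\<lambda>u. ((u + d / u) / 2, (u - d / u) / 2)) ((\<lambda>(x, y). x + y) a) = a"
        using key by auto
      show "\<forall>u\<in>UNIV - {0}. (\<lambda>(x, y). x + y) ((u + d / u) / 2, (u - d / u) / 2) = u"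
        using key' by auto
      show "(\<lambda>(x, y). x + y) ` ?S \<subseteq> UNIV - {0}"
        using nz by auto
      show "(\<lambda>u. ((u + d / u) / 2, (u - d / u) / 2)) ` (UNIV - {0}) \<subseteq> ?S"
        using sq by auto
    qed
  qed
  also have "int (card (UNIV - {0::'a})) = int CARD('a) - 1"
    using card_ge_3 by (simp add: card_Diff_singleton of_nat_diff)
  finally show ?thesis using False by (simp add: sum.distrib)
qed

lemma sum_qchar_quadratic:
  fixes a b c :: 'a
  assumes "a \<noteq> 0"
  shows "(\<Sum>x\<in>UNIV. qchar (a * x\<^sup>2 + 2 * b * x + c)) =
    qchar a * (if b\<^sup>2 = a * c then int CARD('a) - 1 else -1)"
proof -
  have "qchar (a * x\<^sup>2 + 2 * b * x + c) = qchar a * qchar ((a * x + b)\<^sup>2 - (b\<^sup>2 - a * c))" for x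
  proof -
    have "a\<^sup>2 * (a * x\<^sup>2 + 2 * b * x + c) = a * ((a * x + b)\<^sup>2 - (b\<^sup>2 - a * c))"
      by (simp add: power2_eq_square algebra_simps)
    then show ?thesis using qchar_mult_square[OF assms] by (metis qchar_mult)
  qed
  then have "(\<Sum>x\<in>UNIV. qchar (a * x\<^sup>2 + 2 * b * x + c)) =
      qchar a * (\<Sum>x\<in>UNIV. qchar ((a * x + b)\<^sup>2 - (b\<^sup>2 - a * c)))"
    by (simp add: sum_distrib_left)
  also have "(\<Sum>x\<in>UNIV. qchar ((a * x + b)\<^sup>2 - (b\<^sup>2 - a * c))) = (\<Sum>y\<in>UNIV. qchar (y\<^sup>2 - (b\<^sup>2 - a * c)))"
    by (rule sum.reindex_bij_witness[of _ "\<lambda>x. (x - b) / a" "\<lambda>x. a * x + b"]) (use assms in auto)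
  finally show ?thesis by (simp add: sum_qchar_square_minus)
qed

lemma card_quadratic_roots:
  fixes a b c :: 'a
  assumes "a \<noteq> 0"
  shows "int (card {x. a * x\<^sup>2 + 2 * b * x + c = 0}) = 1 + qchar (b\<^sup>2 - a * c)"
proof -
  have eq: "a * x\<^sup>2 + 2 * b * x + c = 0 \<longleftrightarrow> (a * x + b)\<^sup>2 = b\<^sup>2 - a * c" for x
  proof -
    have "a * (a * x\<^sup>2 + 2 * b * x + c) = (a * x + b)\<^sup>2 - (b\<^sup>2 - a * c)"
      by (simp add: power2_eq_square algebra_simps)
    then show ?thesis using assms by (metis mult_eq_0_iff right_minus_eq)
  qed
  have "bij_betw (\<lambda>x. a * x + b) {x. a * x\<^sup>2 + 2 * b * x + c = 0} {y. y\<^sup>2 = b\<^sup>2 - a * c}"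
    unfolding eq by (rule bij_betw_byWitness[where f' = "\<lambda>y. (y - b) / a"]) (use assms in auto)
  then have "card {x. a * x\<^sup>2 + 2 * b * x + c = 0} = card {y. y\<^sup>2 = b\<^sup>2 - a * c}"
    by (rule bij_betw_same_card)
  then show ?thesis by (simp only: card_roots_square)
qed

text \<open>Each nonzero \<open>r\<close> allows \<open>1 + qchar (b\<^sup>2 - a * c)\<close> values
  of \<open>s\<close>, since the discriminant changes only by the square \<open>r\<^sup>2\<close>;
  \<open>r = 0\<close> allows one.\<close>

lemma card_binary_form_zeros_aux:
  fixes a b c :: 'a
  assumes "a \<noteq> 0"
  shows "int (card {(s, r). a * s\<^sup>2 + 2 * b * s * r + c * r\<^sup>2 = 0}) =
    int CARD('a) + (int CARD('a) - 1) * qchar (b\<^sup>2 - a * c)"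
proof -
  have eq: "2 * (b * r) * s = 2 * b * s * r" for r s by (simp only: ac_simps)
  have "{(s, r). a * s\<^sup>2 + 2 * b * s * r + c * r\<^sup>2 = 0} =
      prod.swap ` (SIGMA r:UNIV. {s. a * s\<^sup>2 + 2 * (b * r) * s + c * r\<^sup>2 = 0})"
    by (auto simp: image_iff eq)
  then have "int (card {(s, r). a * s\<^sup>2 + 2 * b * s * r + c * r\<^sup>2 = 0}) =
      (\<Sum>r\<in>UNIV. int (card {s. a * s\<^sup>2 + 2 * (b * r) * s + c * r\<^sup>2 = 0}))"
    by (simp add: card_image card_SigmaI)
  also have "\<dots> = (\<Sum>r\<in>UNIV. 1 + qchar (r\<^sup>2 * (b\<^sup>2 - a * c)))"
  proof (intro sum.cong refl)
    fix r :: 'a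
    have "(b * r)\<^sup>2 - a * (c * r\<^sup>2) = r\<^sup>2 * (b\<^sup>2 - a * c)"
      by (simp add: power2_eq_square algebra_simps)
    then show "int (card {s. a * s\<^sup>2 + 2 * (b * r) * s + c * r\<^sup>2 = 0}) = 1 + qchar (r\<^sup>2 * (b\<^sup>2 - a * c))"
      by (simp add: card_quadratic_roots[OF assms])
  qed
  also have "\<dots> = int CARD('a) + (\<Sum>r\<in>UNIV. qchar (r\<^sup>2 * (b\<^sup>2 - a * c)))"
    by (simp add: sum.distrib)
  also have "(\<Sum>r\<in>UNIV. qchar (r\<^sup>2 * (b\<^sup>2 - a * c))) = (\<Sum>r\<in>UNIV-{0}. qchar (r\<^sup>2 * (b\<^sup>2 - a * c)))"
    by (rule sum.mono_neutral_right) auto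
  also have "\<dots> = (\<Sum>r\<in>UNIV-{0::'a}. qchar (b\<^sup>2 - a * c))"
    by (intro sum.cong) (auto simp: qchar_mult_square)
  also have "\<dots> = (int CARD('a) - 1) * qchar (b\<^sup>2 - a * c)"
    using card_ge_3 by (simp add: card_Diff_singleton of_nat_diff)
  finally show ?thesis .
qed

lemma card_binary_form_zeros:
  fixes a b c :: 'a
  assumes "a \<noteq> 0 \<or> b \<noteq> 0 \<or> c \<noteq> 0"
  shows "int (card {(s, r). a * s\<^sup>2 + 2 * b * s * r + c * r\<^sup>2 = 0}) =
    int CARD('a) + (int CARD('a) - 1) * qchar (b\<^sup>2 - a * c)"
proof -
  consider "a \<noteq> 0" | "c \<noteq> 0" | "a = 0" "c = 0" "b \<noteq> 0" using assms by blast
  then show ?thesis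
  proof cases
    case 1
    then show ?thesis by (rule card_binary_form_zeros_aux)
  next
    case 2
    have eq: "c * r\<^sup>2 + 2 * b * r * s + a * s\<^sup>2 = a * s\<^sup>2 + 2 * b * s * r + c * r\<^sup>2" for r s
      by (simp only: ac_simps)
    have "bij_betw prod.swap {(s, r). c * s\<^sup>2 + 2 * b * s * r + a * r\<^sup>2 = 0}
        {(s, r). a * s\<^sup>2 + 2 * b * s * r + c * r\<^sup>2 = 0}"
      by (rule bij_betw_byWitness[where f' = prod.swap]) (auto simp: eq)
    then have "card {(s, r). a * s\<^sup>2 + 2 * b * s * r + c * r\<^sup>2 = 0} =
        card {(s, r). c * s\<^sup>2 + 2 * b * s * r + a * r\<^sup>2 = 0}"
      by (rule bij_betw_same_card[symmetric])
    then show ?thesis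
      using card_binary_form_zeros_aux[OF 2, of b a] by (simp only: mult.commute[of c a])
  next
    \<comment> \<open>The form is \<open>2 * b * s * r\<close>, so its zeros are the two axes,
      \<open>2 * q - 1\<close> pairs.\<close>
    case 3
    have zero_iff: "a * s\<^sup>2 + 2 * b * s * r + c * r\<^sup>2 = 0 \<longleftrightarrow> s = 0 \<or> r = 0" for s r
      unfolding 3(1,2) using 3(3) two_neq_zero by simp
    have eq: "{(s, r). a * s\<^sup>2 + 2 * b * s * r + c * r\<^sup>2 = 0} = {0} \<times> UNIV \<union> (UNIV - {0}) \<times> {0}"
      unfolding zero_iff by auto
    have "card ({0::'a} \<times> UNIV \<union> (UNIV - {0::'a}) \<times> {0::'a}) = card ({0::'a} \<times> (UNIV::'a set)) + card ((UNIV - {0::'a}) \<times> {0::'a})"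
      by (rule card_Un_disjoint) auto
    also have "\<dots> = CARD('a) + (CARD('a) - 1)"
      by (simp add: card_cartesian_product card_Diff_singleton)
    finally have "int (card {(s, r). a * s\<^sup>2 + 2 * b * s * r + c * r\<^sup>2 = 0}) = int CARD('a) + (int CARD('a) - 1)"
      unfolding eq using card_ge_3 by linarith
    moreover have "qchar (b\<^sup>2 - a * c) = 1"
      unfolding 3(1) using 3(3) by (simp add: qchar_square)
    ultimately show ?thesis by (simp only: mult_1_right)
  qed
qed

end

section \<open>The Hasse bound for \<open>y\<^sup>2 = f(x)\<close>\<close>

definition cubic :: "'r::comm_ring_1 \<Rightarrow> 'r \<Rightarrow> 'r \<Rightarrow> 'r \<Rightarrow> 'r \<Rightarrow> 'r" where
  "cubic k a b c x = k * x ^ 3 + a * x\<^sup>2 + b * x + c"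

text \<open>With \<open>x(R) = A / B\<close>, the chord formulas give the sum and the product of
  \<open>x(R + (t, 1))\<close> and \<open>x(R - (t, 1))\<close> as \<open>add_sum / add_den\<close>
  and \<open>add_prod / add_den\<close>. The y-coordinates enter these symmetric functions only
  through squares, which the curve equation eliminates.\<close>

definition add_den :: "'r::comm_ring_1 \<Rightarrow> 'r \<Rightarrow> 'r \<Rightarrow> 'r \<Rightarrow> 'r" where
  "add_den k t A B = k\<^sup>2 * (A - t * B)\<^sup>2"

definition add_sum :: "'r::comm_ring_1 \<Rightarrow> 'r \<Rightarrow> 'r \<Rightarrow> 'r \<Rightarrow> 'r \<Rightarrow> 'r \<Rightarrow> 'r \<Rightarrow> 'r" where
  "add_sum k a b c t A B =
    2 * k * (k * (A + t * B) * (t * A) + 2 * a * (t * A * B) + b * ((A + t * B) * B) + 2 * c * B\<^sup>2)"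

definition add_prod :: "'r::comm_ring_1 \<Rightarrow> 'r \<Rightarrow> 'r \<Rightarrow> 'r \<Rightarrow> 'r \<Rightarrow> 'r \<Rightarrow> 'r \<Rightarrow> 'r" where
  "add_prod k a b c t A B =
    (k * (t * A) - b * B)\<^sup>2 - 4 * c * (B * (k * A + k * (t * B) + a * B))"

definition add_rel :: "'r::comm_ring_1 \<Rightarrow> 'r \<Rightarrow> 'r \<Rightarrow> 'r \<Rightarrow> 'r \<Rightarrow> 'r \<Rightarrow> 'r \<Rightarrow> 'r \<Rightarrow> 'r \<Rightarrow> 'r" where
  "add_rel k a b c t A B A' B' =
    add_den k t A B * A'\<^sup>2 - add_sum k a b c t A B * A' * B' + add_prod k a b c t A B * B'\<^sup>2"

text \<open>Reflects that \<open>R' = R + P\<close> is the same as \<open>R = R' - P\<close>; it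
  allows the sequence to be walked in both directions.\<close>

lemma add_rel_commute:
  "add_rel k a b c t A B A' B' = add_rel k a b c t A' B' A B" for A :: "'r::idom"
  unfolding add_rel_def add_den_def add_sum_def add_prod_def by Groebner_Basis.algebra

lemma add_rel_homogeneous:
  "add_rel k a b c t A B (s * A') (s * B') = s\<^sup>2 * add_rel k a b c t A B A' B'" for A :: "'r::idom"
  unfolding add_rel_def by Groebner_Basis.algebra

text \<open>A vanishing denominator means \<open>A = t * B\<close>. There the sum is a nonzero
  multiple of \<open>f(t)\<close> and the product, modulo \<open>f(t)\<close>, one of the squared
  derivative. So the three quantities vanish together only at a double root.\<close>

lemma add_triple_common_zero:
  fixes k a b c t A B :: "'r::idom"
  assumes "k \<noteq> 0" "(2 :: 'r) \<noteq> 0" "A \<noteq> 0 \<or> B \<noteq> 0"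
    and "add_den k t A B = 0" "add_sum k a b c t A B = 0" "add_prod k a b c t A B = 0"
  shows "cubic k a b c t = 0" "3 * k * t\<^sup>2 + 2 * a * t + b = 0"
proof -
  have A: "A = t * B" using assms(1,4) by (simp add: add_den_def)
  then have B: "B \<noteq> 0" using assms(3) by auto
  have "add_sum k a b c t A B = 2 * 2 * k * B\<^sup>2 * cubic k a b c t"
    unfolding A add_sum_def cubic_def by Groebner_Basis.algebra
  then show f: "cubic k a b c t = 0" using assms(1,2,5) B by (metis mult_eq_0_iff power_not_zero)
  have "add_prod k a b c t A B = B\<^sup>2 * ((3 * k * t\<^sup>2 + 2 * a * t + b)\<^sup>2 - 4 * (2 * k * t + a) * cubic k a b c t)"
    unfolding A add_prod_def cubic_def by Groebner_Basis.algebra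
  then show "3 * k * t\<^sup>2 + 2 * a * t + b = 0" using assms B f by simp
qed

text \<open>Over an algebraically closed field this is coprimality, in a form that is checked by
  evaluation.\<close>

definition no_common_root :: "'k::field poly \<Rightarrow> 'k poly \<Rightarrow> bool" where
  "no_common_root p r \<longleftrightarrow> (\<forall>x. poly p x \<noteq> 0 \<or> poly r x \<noteq> 0)"

lemma no_root_imp_degree_0: "(\<And>x. poly p x \<noteq> 0) \<Longrightarrow> pdeg p = 0"
  for p :: "'k::alg_closed_field poly"
  using alg_closed_imp_poly_has_root[of p] by auto

text \<open>Euclid's lemma, removing one linear factor of \<open>p\<close> at a time: a root of
  \<open>p\<close> is not one of \<open>r\<close>, hence it is one of \<open>s\<close>.\<close>

lemma no_common_root_dvd_mult:
  fixes p r s :: "'k::alg_closed_field poly"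
  assumes "no_common_root p r" "p \<noteq> 0" "p dvd r * s"
  shows "p dvd s"
  using assms
proof (induction "pdeg p" arbitrary: p s)
  case 0
  then have "is_unit p" by (simp add: is_unit_iff_degree)
  then show ?case by (rule unit_imp_dvd)
next
  case (Suc n)
  then obtain x where x: "poly p x = 0" using alg_closed_imp_poly_has_root[of p] by auto
  then obtain p' where p': "p = [:-x, 1:] * p'" by (auto simp: poly_eq_0_iff_dvd)
  have "poly r x \<noteq> 0" using x Suc.prems(1) by (auto simp: no_common_root_def)
  moreover have "poly (r * s) x = 0" using x Suc.prems(3) by (metis dvd_trans poly_eq_0_iff_dvd)
  ultimately have "poly s x = 0" by simp
  then obtain s' where s': "s = [:-x, 1:] * s'" by (auto simp: poly_eq_0_iff_dvd)
  have "[:-x, 1:] * p' dvd [:-x, 1:] * (r * s')"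
    using Suc.prems(3) unfolding p' s' by (simp only: mult.left_commute)
  then have "p' dvd r * s'" by (subst (asm) dvd_mult_cancel_left) simp
  moreover have "p' \<noteq> 0" using Suc.prems(2) p' by auto
  moreover have "no_common_root p' r" using Suc.prems(1) unfolding p' no_common_root_def by auto
  moreover have "n = pdeg p'"
    using Suc.hyps(2) \<open>p' \<noteq> 0\<close> unfolding p' by (subst (asm) degree_mult_eq) auto
  ultimately have "p' dvd s'" using Suc.hyps(1) by blast
  then show ?case unfolding p' s' by (rule mult_dvd_mono[OF dvd_refl])
qed

text \<open>Gauss's lemma: a primitive linear factor over the function field splits off over the
  polynomial ring.\<close>

lemma quadratic_form_splits:
  fixes h g f A B :: "'k::alg_closed_field poly"
  assumes AB: "no_common_root A B" and f: "f \<noteq> 0"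
    and zero: "h * A\<^sup>2 - g * A * B + f * B\<^sup>2 = 0"
  obtains A' B' where "h = B * B'" "f = A * A'" "g = A * B' + B * A'"
proof -
  have A: "A \<noteq> 0"
  proof
    assume "A = 0"
    then have "B = 0" using zero f by simp
    with \<open>A = 0\<close> AB show False by (simp add: no_common_root_def)
  qed
  have BA: "no_common_root B A" using AB by (auto simp: no_common_root_def)
  have "(B * B) * f = A * (g * B - h * A)"
    using zero by Groebner_Basis.algebra
  then have "A dvd B * (B * f)" by (metis dvd_triv_left mult.assoc)
  then have "A dvd f" by (intro no_common_root_dvd_mult[OF AB A, of f] no_common_root_dvd_mult[OF AB A, of "B * f"])
  then obtain A' where A': "f = A * A'" by (auto elim: dvdE)
  have "A * (A * h) = A * (B * (g - A' * B))"
    using zero unfolding A' by Groebner_Basis.algebra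
  then have h: "A * h = B * (g - A' * B)" using A by simp
  show ?thesis
  proof (cases "B = 0")
    \<comment> \<open>Here \<open>(A, B)\<close> is the point at infinity: \<open>A\<close> is a
      nonzero constant, and the other factor is obtained by dividing by it.\<close>
    case True
    then have "\<And>x. poly A x \<noteq> 0" using AB by (simp add: no_common_root_def)
    then have "is_unit A" using A no_root_imp_degree_0 is_unit_iff_degree by blast
    then have "A dvd g" by (rule unit_imp_dvd)
    then obtain B' where "g = A * B'" by (auto elim: dvdE)
    moreover have "h = 0" using h A True by simp
    ultimately show ?thesis using that[of B' A'] A' True by simp
  next
    case False
    have "B dvd A * h" unfolding h by simp
    then have "B dvd h" by (rule no_common_root_dvd_mult[OF BA False])
    then obtain B' where B': "h = B * B'" by (auto elim: dvdE)
    have "B * (A * B') = B * (g - A' * B)" using h unfolding B' by (simp only: mult.left_commute)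
    then have "A * B' = g - A' * B" using False by simp
    then have "g = A * B' + B * A'" by (simp add: algebra_simps)
    with A' B' show ?thesis using that by blast
  qed
qed

text \<open>
  The point \<open>(t, 1)\<close> lies on the curve \<open>f(t) y\<^sup>2 = f(x)\<close> over the function field in \<open>t\<close>. If \<open>R\<close> is a point on
  this curve with \<open>x(R) = A / B\<close>, then \<open>x(R + (t, 1))\<close> and \<open>x(R - (t, 1))\<close> are the roots \<open>A' / B'\<close>
  of \<open>add_rel\<close>. This symmetric relation between \<open>x\<close>-coordinates replaces the group law: a sequence
  of pairs \<open>(A\<^sub>n, B\<^sub>n)\<close> whose neighbours are related this way is the sequence \<open>x(R + n (t, 1))\<close>.
  The pair \<open>(1, 0)\<close> stands for the point at infinity.
\<close>

locale manin =
  fixes k a b c :: "'k::alg_closed_field"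
  assumes k: "k \<noteq> 0" and two: "(2 :: 'k) \<noteq> 0"
    and separable: "\<And>x. cubic k a b c x = 0 \<Longrightarrow> 3 * k * x\<^sup>2 + 2 * a * x + b \<noteq> 0"
begin

abbreviation t where "t \<equiv> [:0, 1 :: 'k:]"
abbreviation dn where "dn A B \<equiv> add_den [:k:] t A B"
abbreviation sm where "sm A B \<equiv> add_sum [:k:] [:a:] [:b:] [:c:] t A B"
abbreviation pr where "pr A B \<equiv> add_prod [:k:] [:a:] [:b:] [:c:] t A B"
abbreviation rel where "rel A B A' B' \<equiv> add_rel [:k:] [:a:] [:b:] [:c:] t A B A' B'"

text \<open>The x-coordinate \<open>A / B\<close> has a pole at infinity. The case
  \<open>B = 0\<close> is listed separately because the zero polynomial has degree 0, which would
  exclude the pair \<open>(1, 0)\<close>.\<close>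

definition large :: "'k poly \<Rightarrow> 'k poly \<Rightarrow> bool" where
  "large A B \<longleftrightarrow> A \<noteq> 0 \<and> (B = 0 \<or> pdeg B < pdeg A)"

lemma degree_mult_le_add:
  "pdeg p \<le> m \<Longrightarrow> pdeg r \<le> n \<Longrightarrow> pdeg (p * r) \<le> m + n"
  for p r :: "'k poly"
  using degree_mult_le[of p r] by simp

text \<open>The product is dominated by \<open>(k * t * A)\<^sup>2\<close>, since
  \<open>t * A\<close> has larger degree than every term containing \<open>B\<close>; the bounds for
  sum and denominator stay strictly below.\<close>

lemma triple_degrees:
  assumes "large A B"
  shows "pr A B \<noteq> 0" "pdeg (pr A B) = 2 * pdeg A + 2"
    "pdeg (sm A B) \<le> 2 * pdeg A + 1"
    "pdeg (dn A B) \<le> 2 * pdeg A"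
proof -
  let ?n = "pdeg A"
  have A: "A \<noteq> 0" using assms by (simp add: large_def)
  have B: "pdeg B \<le> ?n" using assms by (auto simp: large_def)
  have tB: "pdeg (t * B) \<le> ?n"
    using assms by (cases "B = 0") (auto simp: large_def degree_mult_eq)
  have tA: "pdeg (t * A) = ?n + 1"
    using A by (simp add: degree_mult_eq)
  have const: "pdeg ([:x:] * p) \<le> m" if "pdeg p \<le> m" for x :: 'k and p m
    using degree_mult_le_add[of "[:x:]" 0 p m] that by simp
  have num: "pdeg (numeral w * p) \<le> m" if "pdeg p \<le> m" for w and p :: "'k poly" and m
    using degree_mult_le_add[of "numeral w" 0 p m] that by simp
  have AtB: "pdeg (A + t * B) \<le> ?n" "pdeg (A - t * B) \<le> ?n"
    using tB by (auto intro: degree_add_le degree_diff_le)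
  show "pdeg (dn A B) \<le> 2 * ?n"
  proof -
    have "pdeg ((A - t * B) * (A - t * B)) \<le> ?n + ?n"
      by (intro degree_mult_le_add AtB)
    then have "pdeg ([:k:] * ([:k:] * ((A - t * B) * (A - t * B)))) \<le> ?n + ?n"
      by (intro const)
    then show ?thesis unfolding add_den_def by (simp only: power2_eq_square mult.assoc mult_2)
  qed
  show "pdeg (sm A B) \<le> 2 * ?n + 1"
  proof -
    have "pdeg ((A + t * B) * (t * A)) \<le> ?n + (?n + 1)"
      by (rule degree_mult_le_add[OF AtB(1) eq_refl[OF tA]])
    moreover have "pdeg (t * A * B) \<le> (?n + 1) + ?n"
      by (rule degree_mult_le_add[OF eq_refl[OF tA] B])
    moreover have "pdeg ((A + t * B) * B) \<le> ?n + ?n"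
      using B by (intro degree_mult_le_add AtB)
    moreover have "pdeg (B\<^sup>2) \<le> ?n + ?n"
      unfolding power2_eq_square using B by (intro degree_mult_le_add)
    ultimately show ?thesis
      unfolding add_sum_def mult.assoc by (intro num const degree_add_le; linarith)
  qed
  have main: "pdeg ([:k:] * (t * A) - [:b:] * B) = ?n + 1"
  proof -
    have ktA: "pdeg ([:k:] * (t * A)) = ?n + 1"
      using A k by (simp add: degree_mult_eq)
    have "pdeg (- ([:b:] * B)) < pdeg ([:k:] * (t * A))"
      unfolding ktA degree_minus using const[OF B, of b] by linarith
    from degree_add_eq_left[OF this] show ?thesis unfolding ktA by (simp only: diff_conv_add_uminus)
  qed
  then have nz: "[:k:] * (t * A) - [:b:] * B \<noteq> 0" by force
  have sq: "pdeg (([:k:] * (t * A) - [:b:] * B)\<^sup>2) = 2 * ?n + 2"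
    by (simp only: degree_power_eq[OF nz] main) simp
  have "pdeg (4 * [:c:] * (B * ([:k:] * A + [:k:] * (t * B) + [:a:] * B))) \<le> ?n + ?n"
    unfolding mult.assoc using B tB by (intro num const degree_mult_le_add degree_add_le) simp_all
  then have "pdeg (- (4 * [:c:] * (B * ([:k:] * A + [:k:] * (t * B) + [:a:] * B))))
      < pdeg (([:k:] * (t * A) - [:b:] * B)\<^sup>2)"
    unfolding sq degree_minus by linarith
  from degree_add_eq_left[OF this] show "pdeg (pr A B) = 2 * ?n + 2"
    unfolding add_prod_def sq by (simp only: diff_conv_add_uminus)
  then show "pr A B \<noteq> 0" by force
qed

lemma triple_no_common_root:
  assumes "no_common_root A B" "poly (dn A B) x = 0" "poly (sm A B) x = 0"
  shows "poly (pr A B) x \<noteq> 0"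
proof
  assume *: "poly (pr A B) x = 0"
  have 1: "add_den k x (poly A x) (poly B x) = 0"
    using assms(2) by (simp add: add_den_def power2_eq_square)
  have 2: "add_sum k a b c x (poly A x) (poly B x) = 0"
    using assms(3) by (simp add: add_sum_def power2_eq_square algebra_simps)
  have 3: "add_prod k a b c x (poly A x) (poly B x) = 0"
    using * by (simp add: add_prod_def power2_eq_square algebra_simps)
  have 4: "poly A x \<noteq> 0 \<or> poly B x \<noteq> 0" using assms(1) by (simp add: no_common_root_def)
  note zero = add_triple_common_zero[OF k two 4 1 2 3]
  show False using separable[OF zero(1)] zero(2) by simp
qed

text \<open>A common root of \<open>A1\<close> and \<open>B1\<close> would kill denominator, sum and
  product at once. If the degree of \<open>B1\<close> were at least that of \<open>A1\<close>, then
  \<open>B1 * A2\<close> would have degree at least \<open>2 * pdeg A + 2\<close>, and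
  \<open>A1 * B2\<close> is too small to cancel it down to the degree allowed for the sum.\<close>

lemma neighbour_large:
  assumes AB: "no_common_root A B" and large: "large A B"
    and split: "dn A B = B1 * B2" "pr A B = A1 * A2" "sm A B = A1 * B2 + B1 * A2"
  shows "no_common_root A1 B1" "large A1 B1"
proof -
  note deg = triple_degrees[OF large]
  have "poly A1 x \<noteq> 0 \<or> poly B1 x \<noteq> 0" "poly A2 x \<noteq> 0 \<or> poly B2 x \<noteq> 0" for x
    using triple_no_common_root[OF AB, of x] by (auto simp: split)
  then have 2: "no_common_root A2 B2" and "no_common_root A1 B1"
    unfolding no_common_root_def by simp_all
  then show "no_common_root A1 B1" 
    unfolding no_common_root_def by simp_all
  have A: "A1 \<noteq> 0" "A2 \<noteq> 0" using deg(1) split(2) by auto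
  have sumA: "pdeg A1 + pdeg A2 = 2 * pdeg A + 2" using deg(2) A by (simp add: split degree_mult_eq)
  have "pdeg B1 < pdeg A1" if B1: "B1 \<noteq> 0"
  proof (rule ccontr)
    assume le: "\<not> pdeg B1 < pdeg A1"
    show False
    proof (cases "B2 = 0")
      case True
      then have "pdeg A2 = 0" using 2 by (intro no_root_imp_degree_0) (simp add: no_common_root_def)
      moreover have "pdeg B1 + pdeg A2 \<le> 2 * pdeg A + 1"
        using deg(3) True A B1 by (simp add: split degree_mult_eq)
      ultimately show False using sumA le by simp
    next
      case False
      have B: "pdeg B1 + pdeg B2 \<le> 2 * pdeg A" using deg(4) False B1 by (simp add: split degree_mult_eq)
      have 3: "pdeg (A1 * B2) \<le> 2 * pdeg A" "pdeg (B1 * A2) \<ge> 2 * pdeg A + 2"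
        using B le sumA False B1 A by (auto simp: degree_mult_eq)
      then have "pdeg (A1 * B2 + B1 * A2) = pdeg (B1 * A2)" by (intro degree_add_eq_right) simp
      with 3 deg(3) show False by (simp add: split)
    qed
  qed
  then show "large A1 B1" using A by (auto simp: large_def)
qed

definition linked :: "'k poly \<Rightarrow> 'k poly \<Rightarrow> 'k poly \<Rightarrow> 'k poly \<Rightarrow> bool" where
  "linked A B A' B' \<longleftrightarrow> no_common_root A B \<and> no_common_root A' B' \<and> large A B \<and> large A' B' \<and> rel A B A' B' = 0"

text \<open>One neighbour determines the other, because the quadratic splits over the polynomial
  ring. The numerators of both neighbours multiply to \<open>pr A B\<close>, so the degrees along
  the sequence have second difference 2; this is the heart of Manin's argument.\<close>

lemma linked_step:
  assumes AB: "no_common_root A B" "large A B" and AB': "no_common_root A' B'" and rel: "rel A B A' B' = 0"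
  obtains A'' B'' where "linked A' B' A B" "linked A B A'' B''"
    "pdeg A' + pdeg A'' = 2 * pdeg A + 2"
proof -
  note deg = triple_degrees[OF AB(2)]
  obtain A'' B'' where split: "dn A B = B' * B''" "pr A B = A' * A''" "sm A B = A' * B'' + B' * A''"
    using quadratic_form_splits[OF AB' deg(1)] rel unfolding add_rel_def by blast
  then have split': "dn A B = B'' * B'" "pr A B = A'' * A'" "sm A B = A'' * B' + B'' * A'"
    by (simp_all add: mult.commute add.commute)
  have "A' \<noteq> 0" "A'' \<noteq> 0" using deg(1) split(2) by auto
  then have "pdeg A' + pdeg A'' = 2 * pdeg A + 2"
    using deg(2) by (simp add: split degree_mult_eq)
  moreover have l2: "linked A B A'' B''"
  proof -
    have "rel A B A'' B'' = 0" unfolding add_rel_def split by Groebner_Basis.algebra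
    then show ?thesis
      unfolding linked_def by (intro conjI AB neighbour_large[OF AB split'])
  qed
  moreover have l1: "linked A' B' A B"
  proof -
    have "rel A' B' A B = 0" using rel by (simp only: add_rel_commute)
    then show ?thesis
      unfolding linked_def by (intro conjI AB neighbour_large[OF AB split])
  qed
  ultimately show ?thesis by (intro that[OF l1 l2])
qed

text \<open>Constant second difference makes the degree of the \<open>n\<close>-th numerator a
  quadratic polynomial in \<open>n\<close> with leading coefficient 1. The right-hand side is that
  degree.\<close>

lemma linked_degree_nonneg:
  assumes "linked A B A' B'"
  shows "0 \<le> int (pdeg A) + int n * (int (pdeg A') - int (pdeg A)) + int n * (int n - 1)"
proof -
  define d where "d n = int (pdeg A) + int n * (int (pdeg A') - int (pdeg A)) + int n * (int n - 1)" for n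
  have "\<exists>P R P' R'. linked P R P' R' \<and> int (pdeg P) = d n \<and> int (pdeg P') = d (Suc n)"
  proof (induction n)
    case 0
    have "linked A B A' B' \<and> int (pdeg A) = d 0 \<and> int (pdeg A') = d (Suc 0)"
      using assms by (simp add: d_def)
    then show ?case by (intro exI)
  next
    case (Suc n)
    then obtain P R P' R' where *: "linked P R P' R'" "int (pdeg P) = d n" "int (pdeg P') = d (Suc n)"
      by blast
    have 0: "rel P' R' P R = 0" using *(1) by (simp add: linked_def add_rel_commute)
    have 1: "no_common_root P' R'" "large P' R'" "no_common_root P R"
      using *(1) unfolding linked_def by simp_all
    obtain P'' R'' where **: "linked P' R' P'' R''"
      "pdeg P + pdeg P'' = 2 * pdeg P' + 2"
      by (rule linked_step[OF 1 0])
    have "d n + int (pdeg P'') = 2 * d (Suc n) + 2"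
      using **(2) *(2,3) by linarith
    then have "int (pdeg P'') = d (Suc (Suc n))"
      by (simp add: d_def algebra_simps)
    with *(3) **(1) have "linked P' R' P'' R'' \<and> int (pdeg P') = d (Suc n) \<and> int (pdeg P'') = d (Suc (Suc n))"
      by (intro conjI)
    then show ?case by (intro exI)
  qed
  then show ?thesis unfolding d_def by (metis of_nat_0_le_iff)
qed

end

text \<open>Evaluates at an integer nearest to the vertex \<open>t / 2\<close>. For odd
  \<open>t\<close> this alone would admit \<open>t\<^sup>2 = 4 * q + 1\<close>, which parity
  excludes: \<open>q = n * n + n\<close> would be even. As \<open>n\<close> is natural, only
  positive \<open>t\<close> is bounded; the two signs are treated separately later.\<close>

lemma hasse_discriminant:
  fixes t q :: int
  assumes nonneg: "\<And>n :: nat. 0 \<le> int n * int n - t * int n + q" and "odd q"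
  shows "t \<le> 0 \<or> t\<^sup>2 \<le> 4 * q"
proof (cases "t \<le> 0")
  case False
  show ?thesis
  proof (cases "even t")
    case True
    then obtain n where n: "t = 2 * n" by blast
    then have "int (nat n) = n" using False by simp
    then show ?thesis using nonneg[of "nat n"] n by (simp add: power2_eq_square)
  next
    case odd: False
    then obtain n where n: "t = 2 * n + 1" by (rule oddE)
    then have "int (nat n) = n" using False by simp
    then have "n * n + n \<le> q" using nonneg[of "nat n"] n by (simp add: algebra_simps)
    moreover have "even (n * n + n)" by simp
    then have "q \<noteq> n * n + n" using \<open>odd q\<close> by blast
    ultimately have "n * n + n + 1 \<le> q" by linarith
    then show ?thesis using n by (simp add: power2_eq_square algebra_simps)
  qed
qed simp

section \<open>Linear factors and the q-th power map\<close>

lemma linear_prod_dvd: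
  fixes p :: "'k::field poly"
  assumes "finite S" "\<And>x. x \<in> S \<Longrightarrow> poly p x = 0"
  shows "(\<Prod>x\<in>S. [:-x, 1:]) dvd p"
  using assms
proof (induction S)
  case (insert x S)
  then obtain r where r: "p = (\<Prod>x\<in>S. [:-x, 1:]) * r" by (auto elim: dvdE)
  have "poly (\<Prod>x\<in>S. [:-x, 1:]) x \<noteq> 0"
    using insert.hyps by (auto simp: poly_prod)
  moreover have "poly p x = 0" using insert.prems by simp
  ultimately have "poly r x = 0" unfolding r by simp
  then obtain s where "r = [:-x, 1:] * s" by (auto simp: poly_eq_0_iff_dvd)
  then have "p = (\<Prod>x\<in>insert x S. [:-x, 1:]) * s"
    unfolding r prod.insert[OF insert.hyps] by (simp only: mult_ac)
  then show ?case by simp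
qed simp

lemma poly_linear_prod_eq_0_iff:
  "finite S \<Longrightarrow> poly (\<Prod>x\<in>S. [:-x, 1:]) y = 0 \<longleftrightarrow> y \<in> S" for y :: "'k::field"
  by (auto simp: poly_prod)

lemma linear_prod_nonzero: "finite S \<Longrightarrow> (\<Prod>x\<in>S. [:-x, 1:]) \<noteq> (0 :: 'k::field poly)"
  by simp

lemma degree_linear_prod: "finite S \<Longrightarrow> pdeg (\<Prod>x\<in>S. [:-x, 1 :: 'k::field:]) = card S"
proof (induction S rule: finite_induct)
  case (insert x S)
  then show ?case
    using degree_mult_eq[of "[:-x, 1:]" "\<Prod>x\<in>S. [:-x, 1:]"] linear_prod_nonzero[OF insert.hyps(1)] by simp
qed simp

text \<open>The polynomial \<open>x ^ q - x\<close> has at most \<open>q\<close> roots, and the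
  \<open>q\<close> elements of the base field already are roots.\<close>

lemma power_card_eq_self_iff:
  "x ^ CARD('a::finite_field) = x \<longleftrightarrow> x \<in> range (to_ac :: 'a \<Rightarrow> 'a alg_closure)"
proof -
  let ?q = "CARD('a)"
  let ?p = "Polynomial.monom 1 ?q - [:0, 1 :: 'a alg_closure:]"
  have "card {0, 1 :: 'a} \<le> ?q" by (rule card_mono) auto
  then have q: "?q \<ge> 2" by simp
  have roots: "{x. poly ?p x = 0} = {x. x ^ ?q = x}" by (simp add: poly_monom)
  have "Polynomial.coeff ?p ?q = 1" using q by (auto simp: coeff_pCons split: nat.splits)
  then have p: "?p \<noteq> 0" by force
  have "pdeg ?p \<le> ?q"
    using q by (intro degree_diff_le degree_monom_le) simp
  then have "card {x. poly ?p x = 0} \<le> ?q"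
    using card_poly_roots_bound[OF p] by linarith
  moreover have "finite {x. poly ?p x = 0}" using p by (rule poly_roots_finite)
  moreover have "card (range (to_ac :: 'a \<Rightarrow> 'a alg_closure)) = ?q"
    by (rule card_image) (simp add: inj_on_def)
  moreover have sub: "range to_ac \<subseteq> {x :: 'a alg_closure. x ^ ?q = x}"
  proof clarify
    fix x :: 'a
    show "to_ac x ^ ?q = to_ac x"
      unfolding to_ac_power[symmetric] by (simp only: finite_field_power_card_eq_same)
  qed
  ultimately have "range to_ac = {x :: 'a alg_closure. x ^ ?q = x}"
    unfolding roots by (intro card_seteq[OF _ sub]) linarith+
  then show ?thesis by auto
qed

lemma power_card_add:
  fixes x y :: "'a::finite_field alg_closure"
  shows "(x + y) ^ CARD('a) = x ^ CARD('a) + y ^ CARD('a)"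
proof -
  obtain n where n: "CARD('a) = CHAR('a) ^ n" using card_eq_CHAR_power by blast
  have "normalization_semidom_class.prime CHAR('a)" by simp
  then show ?thesis by (intro freshmans_dream') (simp_all add: n)
qed

lemma poly_power_card_add:
  fixes x y :: "'a::finite_field alg_closure poly"
  shows "(x + y) ^ CARD('a) = x ^ CARD('a) + y ^ CARD('a)"
proof -
  obtain n where n: "CARD('a) = CHAR('a) ^ n" using card_eq_CHAR_power by blast
  have "normalization_semidom_class.prime CHAR('a)" by simp
  then show ?thesis by (intro freshmans_dream') (simp_all add: n)
qed

lemma cubic_at_power_card:
  fixes k a b c :: "'a::finite_field"
  defines "f \<equiv> cubic [:to_ac k:] [:to_ac a:] [:to_ac b:] [:to_ac c:]"
  shows "f (x ^ CARD('a)) = f x ^ CARD('a)"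
proof -
  have const: "[:to_ac y:] ^ CARD('a) = [:to_ac y:]" for y :: 'a
    by (simp add: poly_const_pow finite_field_power_card_eq_same flip: to_ac_power)
  show ?thesis
    unfolding f_def cubic_def poly_power_card_add power_mult_distrib const
    by (simp add: mult.commute flip: power_mult)
qed

text \<open>On the curve \<open>lam * y\<^sup>2 = f(x)\<close> with \<open>lam = f(t)\<close>, the
  chord through \<open>(T, mu)\<close> and \<open>(t, -1)\<close> has slope
  \<open>(mu + 1) / (T - t)\<close>. Hence \<open>m / (k * (T - t)\<^sup>2)\<close> is the
  x-coordinate of \<open>(T, mu) - (t, 1)\<close>, and \<open>m'\<close> belongs in the same way to
  \<open>(T, mu) + (t, 1)\<close>. Later \<open>T = t ^ q\<close> and
  \<open>mu = lam ^ ((q - 1) / 2)\<close>, which is the Frobenius point.\<close>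

context
  fixes k a b c t T mu lam e m m' :: "'r::idom"
  assumes mu: "cubic k a b c t * mu\<^sup>2 = cubic k a b c T"
  defines "lam \<equiv> cubic k a b c t"
    and "e \<equiv> a + k * T + k * t"
  defines "m \<equiv> lam * (mu + 1)\<^sup>2 - e * (T - t)\<^sup>2"
    and "m' \<equiv> lam * (mu - 1)\<^sup>2 - e * (T - t)\<^sup>2"
begin

lemma start_numerator:
  "m = k * (T + t) * T * t + 2 * a * T * t + b * (T + t) + 2 * c + 2 * lam * mu"
proof -
  have "m = cubic k a b c T + lam - e * (T - t)\<^sup>2 + 2 * lam * mu"
    unfolding mu[symmetric] m_def lam_def by Groebner_Basis.algebra
  also have "cubic k a b c T + lam - e * (T - t)\<^sup>2 = k * (T + t) * T * t + 2 * a * T * t + b * (T + t) + 2 * c"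
    unfolding e_def cubic_def lam_def by Groebner_Basis.algebra
  finally show ?thesis .
qed

text \<open>\<open>m\<close> and \<open>m'\<close> differ only in the sign of
  \<open>lam * mu\<close>, so their sum and product are free of \<open>mu\<close> up to its square.
  These match \<open>add_sum\<close> and \<open>add_prod\<close>, and \<open>m\<close> therefore
  gives a root of the quadratic.\<close>

lemma start_related: "add_rel k a b c t T 1 m (k * (T - t)\<^sup>2) = 0"
proof -
  define g where "g = k * (T + t) * T * t + 2 * a * T * t + b * (T + t) + 2 * c"
  have m: "m = g + 2 * lam * mu" unfolding start_numerator g_def ..
  have m': "m' = g - 2 * lam * mu"
    using m unfolding m_def m'_def by Groebner_Basis.algebra
  have sum: "add_sum k a b c t T 1 = k * (m + m')"
  proof -
    have "add_sum k a b c t T 1 = 2 * k * (k * (T + t) * (t * T) + 2 * a * (t * T) + b * (T + t) + 2 * c)"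
      by (simp add: add_sum_def)
    then show ?thesis unfolding m m' g_def by Groebner_Basis.algebra
  qed
  have "m * m' = g\<^sup>2 - 4 * lam * cubic k a b c T"
    unfolding m m' mu[symmetric] lam_def by Groebner_Basis.algebra
  also have "\<dots> = add_prod k a b c t T 1 * (T - t)\<^sup>2"
  proof -
    have "add_prod k a b c t T 1 = (k * (t * T) - b)\<^sup>2 - 4 * c * (k * T + k * t + a)"
      by (simp add: add_prod_def)
    then show ?thesis unfolding g_def lam_def cubic_def by Groebner_Basis.algebra
  qed
  finally have prod: "add_prod k a b c t T 1 * (T - t)\<^sup>2 = m * m'" ..
  have "add_den k t T 1 = k\<^sup>2 * (T - t)\<^sup>2" by (simp add: add_den_def)
  then show ?thesis
    unfolding add_rel_def sum using prod by Groebner_Basis.algebra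
qed

end

lemma sum_qchar_eq_card_diff:
  fixes f :: "'a::finite_field \<Rightarrow> 'a"
  shows "(\<Sum>x\<in>UNIV. qchar (f x)) = int CARD('a) - 2 * int (card {x. qchar (f x) = -1}) - int (card {x. f x = 0})"
proof -
  have *: "qchar (f x) = 1 - 2 * of_bool (qchar (f x) = -1) - of_bool (f x = 0)" for x
    by (simp add: qchar_def)
  then have "(\<Sum>x\<in>UNIV. qchar (f x)) = (\<Sum>x\<in>UNIV. 1 - 2 * of_bool (qchar (f x) = -1) - of_bool (f x = 0))"
    by (intro sum.cong refl *)
  also have "\<dots> = int CARD('a) - 2 * int (card {x. qchar (f x) = -1}) - int (card {x. f x = 0})"
    by (simp add: sum_subtractf sum_of_bool_eq flip: sum_distrib_left)
  finally show ?thesis .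
qed

text \<open>The fraction \<open>m / (k * (T - t)\<^sup>2)\<close> has a numerator of degree
  \<open>2 * q + 1\<close>. Reducing it removes a double factor at each base field element where
  \<open>f\<close> is a nonsquare and a simple one at each root of \<open>f\<close>, so the degree
  that is left records the character sum.\<close>

lemma manin_start:
  fixes k a b c :: "'a::finite_field"
  defines "f \<equiv> cubic k a b c"
  assumes odd_card: "odd CARD('a)" and manin: "manin (to_ac k) (to_ac a) (to_ac b) (to_ac c)"
  obtains A B where "no_common_root A B"
    "add_rel [:to_ac k:] [:to_ac a:] [:to_ac b:] [:to_ac c:] [:0, 1:] ([:0, 1:] ^ CARD('a)) 1 A B = 0"
    "int (pdeg A) = int CARD('a) + 1 + (\<Sum>x\<in>UNIV. qchar (f x))"
proof -
  interpret manin "to_ac k" "to_ac a" "to_ac b" "to_ac c" by (rule manin)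
  let ?q = "CARD('a)"
  let ?k = "[:to_ac k:]" and ?a = "[:to_ac a:]" and ?b = "[:to_ac b:]" and ?c = "[:to_ac c:]"
  define h where "h = (?q - 1) div 2"
  have q: "?q = 2 * h + 1" using odd_card by (simp add: h_def)
  have h: "h \<ge> 1" using card_ge_3[OF odd_card] q by simp
  define T where "T = t ^ ?q"
  define lam where "lam = cubic ?k ?a ?b ?c t"
  define mu where "mu = lam ^ h"
  define e where "e = ?a + ?k * T + ?k * t"
  define m where "m = lam * (mu + 1)\<^sup>2 - e * (T - t)\<^sup>2"
  have "lam * mu\<^sup>2 = lam ^ ?q" unfolding mu_def q by (simp add: power_add power_mult[symmetric] mult.commute)
  also have "\<dots> = cubic ?k ?a ?b ?c T" unfolding T_def lam_def by (rule cubic_at_power_card[symmetric])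
  finally have mu: "cubic ?k ?a ?b ?c t * mu\<^sup>2 = cubic ?k ?a ?b ?c T" by (simp only: lam_def)
  note m_eq = start_numerator[OF mu, folded lam_def e_def, folded m_def]
  note m_rel = start_related[OF mu, folded lam_def e_def, folded m_def]
  have lam_poly: "lam = [:to_ac c, to_ac b, to_ac a, to_ac k:]"
    by (simp add: lam_def cubic_def power2_eq_square power3_eq_cube)
  have eval: "poly lam (to_ac x) = to_ac (f x)" for x
    by (simp add: lam_def f_def cubic_def)
  have eval_mu: "poly mu (to_ac x) = to_ac (of_int (qchar (f x)))" for x
    unfolding of_int_qchar[OF odd_card] by (simp add: mu_def eval h_def)
  have degT: "pdeg T = ?q" unfolding T_def by (simp add: degree_power_eq)
  have deglam: "pdeg lam = 3" using k unfolding lam_poly by simp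

  have degm: "pdeg m = 2 * ?q + 1"
  proof -
    define r where "r = ?k * (t * (T * t)) + (2 * (?a * (T * t)) + (?b * (T + t) + (2 * ?c + 2 * (lam * mu))))"
    \<comment> \<open>The leading term is \<open>k * T\<^sup>2 * t\<close>. The critical remainder
      is \<open>lam * mu\<close>, of degree at most \<open>3 + 3 * h\<close>, which is at most
      \<open>2 * q = 4 * h + 2\<close> since \<open>h \<ge> 1\<close>.\<close>
    have m: "m = ?k * (T * (T * t)) + r" unfolding m_eq r_def by Groebner_Basis.algebra
    have const: "pdeg ([:x:] * p) \<le> n" if "pdeg p \<le> n" for x :: "'a alg_closure" and p n
      using degree_mult_le_add[of "[:x:]" 0 p n] that by simp
    have num: "pdeg (numeral w * p) \<le> n" if "pdeg p \<le> n" for w and p :: "'a alg_closure poly" and n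
      using degree_mult_le_add[of "numeral w" 0 p n] that by simp
    have Tt: "pdeg (T * t) \<le> ?q + 1"
      using degree_mult_le_add[of T ?q t 1] degT by simp
    have tTt: "pdeg (t * (T * t)) \<le> ?q + 2"
      using degree_mult_le_add[OF _ Tt, of t 1] by simp
    have TTt: "pdeg (T * (T * t)) = 2 * ?q + 1"
    proof -
      have "T * (T * t) = t ^ (2 * ?q + 1)" unfolding T_def by (simp add: power_add mult_2)
      then show ?thesis by (simp only: degree_power_eq) (simp add: degree_power_eq)
    qed
    have "pdeg mu \<le> h * 3" unfolding mu_def using degree_power_le[of lam h] deglam by (simp add: mult.commute)
    then have lammu: "pdeg (lam * mu) \<le> 3 + h * 3" using degree_mult_le_add[of lam 3 mu] deglam by simp
    have dt: "pdeg t = 1" "pdeg [:to_ac c:] = 0" by simp_all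
    have "pdeg r \<le> 2 * ?q"
      unfolding r_def by (intro degree_add_le const num) (use dt degT tTt Tt lammu q h in linarith)+
    moreover have "pdeg (?k * (T * (T * t))) = 2 * ?q + 1"
    proof -
      have 1: "T * (T * t) \<noteq> 0" using TTt by force
      have 2: "?k \<noteq> 0" using k by simp
      show ?thesis unfolding degree_mult_eq[OF 2 1] TTt by simp
    qed
    ultimately have "pdeg r < pdeg (?k * (T * (T * t)))" and "pdeg (?k * (T * (T * t))) = 2 * ?q + 1"
      by linarith+
    then show ?thesis unfolding m using degree_add_eq_left by metis
  qed

  define S where "S i = to_ac ` {x. qchar (f x) = i}" for i
  define lp where "lp i = (\<Prod>x\<in>S i. [:-x, 1:])" for i
  have fin: "finite (S i)" for i by (simp add: S_def)
  have range: "range to_ac = S (-1) \<union> (S 0 \<union> S 1)" using qchar_cases by (auto simp: S_def)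
  have "(\<Prod>x\<in>range to_ac. [:-x, 1:]) = lp (-1) * (lp 0 * lp 1)"
  proof -
    have "(\<Prod>x\<in>range to_ac. [:-x, 1:]) = lp (-1) * (\<Prod>x\<in>S 0 \<union> S 1. [:-x, 1:])"
      unfolding range lp_def by (rule prod.union_disjoint) (auto simp: S_def)
    also have "(\<Prod>x\<in>S 0 \<union> S 1. [:-x, 1:]) = lp 0 * lp 1"
      unfolding lp_def by (rule prod.union_disjoint) (auto simp: S_def)
    finally show ?thesis .
  qed
  moreover have "(\<Prod>x\<in>range to_ac. [:-x, 1:]) dvd T - t"
  proof (rule linear_prod_dvd)
    fix x :: "'a alg_closure" assume "x \<in> range to_ac"
    then have "x ^ ?q = x" by (simp only: power_card_eq_self_iff)
    then show "poly (T - t) x = 0" by (simp add: T_def)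
  qed simp
  ultimately obtain w where w: "T - t = lp (-1) * (lp 0 * lp 1) * w" by (auto elim: dvdE)
  have "pdeg (- t) < pdeg T" using q h degT by simp
  then have degTt: "pdeg (T - t) = ?q" using degree_add_eq_left[of "- t" T] degT by (simp only: diff_conv_add_uminus)
  have wnz: "w \<noteq> 0" using degTt q w by auto
  have nz: "lp i \<noteq> 0" for i unfolding lp_def by (rule linear_prod_nonzero[OF fin])
  have deglp: "pdeg (lp i) = card {x. qchar (f x) = i}" for i
    unfolding lp_def degree_linear_prod[OF fin] by (simp add: S_def card_image inj_on_def)
  have "card {x. qchar (f x) = -1} + (card {x. qchar (f x) = 0} + card {x. qchar (f x) = 1}) = ?q"
  proof -
    have "(UNIV :: 'a set) = {x. qchar (f x) = -1} \<union> ({x. qchar (f x) = 0} \<union> {x. qchar (f x) = 1})"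
      using qchar_cases by auto
    then have "?q = card ({x. qchar (f x) = -1} \<union> ({x. qchar (f x) = 0} \<union> {x. qchar (f x) = 1}))" by simp
    also have "\<dots> = card {x. qchar (f x) = -1} + card ({x. qchar (f x) = 0} \<union> {x. qchar (f x) = 1})"
      by (rule card_Un_disjoint) auto
    also have "card ({x. qchar (f x) = 0} \<union> {x. qchar (f x) = 1}) = card {x. qchar (f x) = 0} + card {x. qchar (f x) = 1}"
      by (rule card_Un_disjoint) auto
    finally show ?thesis ..
  qed
  \<comment> \<open>\<open>T - t\<close> and the product of all linear factors over the base field
    both have degree \<open>q\<close>, so the cofactor \<open>w\<close> is constant.\<close>
  then have "pdeg w = 0"
    using degTt w wnz nz by (simp add: degree_mult_eq deglp)
  then obtain u where u: "w = [:u:]" by (rule degree_eq_zeroE)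
  then have w_root: "poly w x \<noteq> 0" for x using wnz by simp

  \<comment> \<open>By Euler's criterion \<open>mu\<close> takes the value -1 at base field elements
    where \<open>f\<close> is a nonsquare.\<close>
  have "lp (-1) dvd mu + 1"
    unfolding lp_def by (rule linear_prod_dvd[OF fin]) (auto simp: S_def eval_mu)
  then obtain mu' where mu': "mu + 1 = lp (-1) * mu'" by (auto elim: dvdE)
  have "lp 0 dvd lam"
    unfolding lp_def by (rule linear_prod_dvd[OF fin]) (auto simp: S_def eval)
  then obtain lam' where lam': "lam = lp 0 * lam'" by (auto elim: dvdE)
  define z where "z = (lp (-1))\<^sup>2 * lp 0"
  define A where "A = lam' * mu'\<^sup>2 - e * lp 0 * (lp 1 * w)\<^sup>2"
  define B where "B = ?k * lp 0 * (lp 1 * w)\<^sup>2"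
  have zA: "m = z * A" unfolding m_def mu' w lam' z_def A_def by Groebner_Basis.algebra
  have zB: "?k * (T - t)\<^sup>2 = z * B" unfolding w z_def B_def by Groebner_Basis.algebra
  have z: "z \<noteq> 0" using nz by (simp add: z_def)
  have rel: "add_rel ?k ?a ?b ?c t T 1 A B = 0"
    using m_rel z unfolding zA zB add_rel_homogeneous by simp
  \<comment> \<open>A zero of \<open>B\<close> is a base field element at which \<open>f\<close> is
    zero or a nonzero square. In the first case \<open>mu + 1\<close> is 1 and \<open>lam'\<close>
    survives because the root is simple; in the second \<open>mu + 1\<close> is 2 and
    \<open>lam\<close> is nonzero.\<close>
  have coprime: "no_common_root A B"
    unfolding no_common_root_def
  proof (intro allI)
    fix x
    have "poly A x \<noteq> 0" if "poly B x = 0"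
    proof -
      have root: "poly (lp i) x = 0 \<longleftrightarrow> x \<in> S i" for i
        unfolding lp_def by (rule poly_linear_prod_eq_0_iff[OF fin])
      have "poly (lp 0) x = 0 \<or> poly (lp 1) x = 0" using that k w_root by (simp add: B_def)
      then have A: "poly A x = poly lam' x * (poly mu' x)\<^sup>2"
        and "x \<in> S 0 \<or> x \<in> S 1" by (auto simp: A_def root)
      then consider y where "x = to_ac y" "f y = 0" | y where "x = to_ac y" "qchar (f y) = 1"
        by (auto simp: S_def)
      then show ?thesis
      proof cases
        case 1
        have "poly (lp (-1)) x * poly mu' x = poly (mu + 1) x" by (simp add: mu')
        also have "\<dots> = 1" by (simp add: 1 eval_mu)
        finally have "poly mu' x \<noteq> 0" by auto
        moreover have "poly lam' x \<noteq> 0"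
        proof
          assume "poly lam' x = 0"
          moreover have "poly (lp 0) x = 0" unfolding root S_def using 1 by auto
          ultimately have "poly (pderiv lam) x = 0" unfolding lam' pderiv_mult by simp
          moreover have "poly (pderiv lam) x = 3 * to_ac k * x\<^sup>2 + 2 * to_ac a * x + to_ac b"
            unfolding lam_poly by (simp add: pderiv_pCons power2_eq_square algebra_simps)
          moreover have "cubic (to_ac k) (to_ac a) (to_ac b) (to_ac c) x = 0"
          proof -
            have "cubic (to_ac k) (to_ac a) (to_ac b) (to_ac c) x = to_ac (f y)"
              unfolding 1(1) by (simp add: f_def cubic_def)
            then show ?thesis unfolding 1(2) by simp
          qed
          ultimately show False using separable[of x] by simp
        qed
        ultimately show ?thesis unfolding A by simp
      next
        case 2
        have "poly (lp (-1)) x * poly mu' x = poly (mu + 1) x" by (simp add: mu')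
        also have "\<dots> = 2" by (simp add: 2 eval_mu)
        finally have "poly mu' x \<noteq> 0" using two by auto
        moreover have "poly lam x \<noteq> 0" using 2 eval[of y] by auto
        then have "poly lam' x \<noteq> 0" unfolding lam' by simp
        ultimately show ?thesis unfolding A by simp
      qed
    qed
    then show "poly A x \<noteq> 0 \<or> poly B x \<noteq> 0" by blast
  qed
  have "A \<noteq> 0" using degm zA by auto
  then have "2 * card {x. qchar (f x) = -1} + card {x. qchar (f x) = 0} + pdeg A = 2 * ?q + 1"
    using degm nz unfolding zA z_def by (simp add: degree_mult_eq degree_power_eq deglp)
  then have "int (pdeg A) = int ?q + 1 + (\<Sum>x\<in>UNIV. qchar (f x))"
    unfolding sum_qchar_eq_card_diff by simp
  with coprime rel show ?thesis unfolding T_def by (intro that)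
qed

theorem hasse_bound:
  fixes k a b c :: "'a::finite_field"
  assumes odd_card: "odd CARD('a)" and manin: "manin (to_ac k) (to_ac a) (to_ac b) (to_ac c)"
  shows "(\<Sum>x\<in>UNIV. qchar (cubic k a b c x))\<^sup>2 \<le> 4 * int CARD('a)"
proof -
  interpret manin "to_ac k" "to_ac a" "to_ac b" "to_ac c" by (rule manin)
  let ?s = "\<Sum>x\<in>UNIV. qchar (cubic k a b c x)"
  let ?q = "CARD('a)"
  obtain A B where AB: "no_common_root A B" "rel (t ^ ?q) 1 A B = 0"
    "int (pdeg A) = int ?q + 1 + ?s"
    using manin_start[OF odd_card manin] .
  have deg: "pdeg (t ^ ?q) = ?q" by (simp add: degree_power_eq)
  have start: "no_common_root (t ^ ?q) 1" "large (t ^ ?q) 1"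
    unfolding no_common_root_def large_def deg by auto
  obtain A'' B'' where linked: "linked A B (t ^ ?q) 1" "linked (t ^ ?q) 1 A'' B''"
    "pdeg A + pdeg A'' = 2 * pdeg (t ^ ?q) + 2"
    by (rule linked_step[OF start AB(1,2)])
  have linked': "linked (t ^ ?q) 1 A B"
    using linked(1) AB(2) unfolding linked_def by simp
  have "0 \<le> int n * int n - (- ?s) * int n + int ?q" for n :: nat
    using linked_degree_nonneg[OF linked', of n] unfolding deg AB(3) by (simp add: algebra_simps)
  then have 1: "- ?s \<le> 0 \<or> (- ?s)\<^sup>2 \<le> 4 * int ?q"
    by (rule hasse_discriminant) (use odd_card in simp)
  \<comment> \<open>The same sequence walked the other way treats the opposite sign; it starts at
    \<open>A\<close>, whence the shift to \<open>Suc n\<close>.\<close>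
  have "0 \<le> int n * int n - ?s * int n + int ?q" for n :: nat
    using linked_degree_nonneg[OF linked(1), of "Suc n"] unfolding deg AB(3) by (simp add: algebra_simps)
  then have 2: "?s \<le> 0 \<or> ?s\<^sup>2 \<le> 4 * int ?q"
    by (rule hasse_discriminant) (use odd_card in simp)
  show ?thesis using 1 2 by (cases "?s = 0") auto
qed

(* The symbol $ would otherwise also stand for coefficients of power series. *)
no_notation fps_nth (infixl \<open>$\<close> 75)

section \<open>Quadratic forms in three variables\<close>

definition qf :: "'k::field ^ 3 ^ 3 \<Rightarrow> 'k ^ 3 \<Rightarrow> 'k" where
  "qf M v = scalar_product v (M *v v)"

lemma scalar_product_3: "scalar_product v w = v $ 1 * w $ 1 + v $ 2 * w $ 2 + v $ 3 * w $ (3::3)"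
  for v w :: "'k::field ^ 3"
  by (simp add: scalar_product_def sum_3)

lemma matrix_vector_mult_3:
  "(M *v v) $ i = M $ i $ 1 * v $ 1 + M $ i $ 2 * v $ 2 + M $ i $ 3 * v $ (3::3)"
  for M :: "'k::field ^ 3 ^ 3"
  by (simp add: matrix_vector_mult_def sum_3)

lemma scalar_product_commute: "scalar_product v w = scalar_product w v" for v w :: "'k::field ^ 3"
  by (simp add: scalar_product_3 mult.commute)

lemma scalar_product_linear [simp]:
  fixes u v w :: "'k::field ^ 3"
  shows "scalar_product u (v + w) = scalar_product u v + scalar_product u w"
    "scalar_product (v + w) u = scalar_product v u + scalar_product w u"
    "scalar_product u (c *s v) = c * scalar_product u v"
    "scalar_product (c *s v) u = c * scalar_product v u"
    "scalar_product u 0 = 0" "scalar_product 0 u = 0"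
  by (simp_all add: scalar_product_3 algebra_simps)

lemma scalar_product_matrix: "scalar_product v (M *v w) = scalar_product (transpose M *v v) w"
  for v w :: "'k::field ^ 3"
  by (simp add: scalar_product_3 matrix_vector_mult_3 transpose_def algebra_simps)

lemma qf_0 [simp]: "qf M 0 = 0"
  by (simp add: qf_def)

lemma qf_scale: "qf M (c *s v) = c\<^sup>2 * qf M v"
  by (simp add: qf_def matrix_vector_mult_scaleR vector_scalar_commute power2_eq_square mult.assoc)

lemma transpose_eqD: "transpose M = M \<Longrightarrow> M $ i $ j = M $ j $ i"
proof -
  assume "transpose M = M"
  then have "M $ i $ j = transpose M $ i $ j" by simp
  then show "M $ i $ j = M $ j $ i" by (simp only: transpose_def vec_lambda_beta)
qed

lemma qf_3:
  assumes "transpose M = M"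
  shows "qf M v = M $ 1 $ 1 * (v $ 1)\<^sup>2 + M $ 2 $ 2 * (v $ 2)\<^sup>2 + M $ 3 $ 3 * (v $ 3)\<^sup>2
    + 2 * M $ 1 $ 2 * v $ 1 * v $ 2 + 2 * M $ 1 $ 3 * v $ 1 * v $ 3 + 2 * M $ 2 $ 3 * v $ 2 * v $ 3"
  unfolding qf_def scalar_product_3 matrix_vector_mult_3
    transpose_eqD[OF assms, of 2 1] transpose_eqD[OF assms, of 3 1] transpose_eqD[OF assms, of 3 2]
  by Groebner_Basis.algebra

lemma matrix_vector_mult_eq_0_iff:
  fixes M :: "'k::field ^ 3 ^ 3"
  assumes "det M \<noteq> 0"
  shows "M *v v = 0 \<longleftrightarrow> v = 0"
proof
  assume "M *v v = 0"
  obtain N where "N ** M = mat 1" using assms invertible_det_nz[of M] unfolding invertible_def by blast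
  then have "v = N *v (M *v v)" by (simp add: matrix_vector_mul_assoc)
  then show "v = 0" using \<open>M *v v = 0\<close> by simp
qed simp

lemma matrix_vector_mult_inj:
  fixes M :: "'k::field ^ 3 ^ 3"
  assumes "det M \<noteq> 0" "M *v v = M *v w"
  shows "v = w"
  using matrix_vector_mult_eq_0_iff[OF assms(1), of "v - w"] assms(2) by (simp add: matrix_vector_mult_diff_distrib)

lemma matrix_vector_mult_surj:
  fixes M :: "'k::field ^ 3 ^ 3"
  assumes "det M \<noteq> 0"
  obtains w where "M *v w = v"
proof -
  obtain N where "M ** N = mat 1" using assms invertible_det_nz[of M] unfolding invertible_def by blast
  then have "M *v (N *v v) = v" by (simp add: matrix_vector_mul_assoc)
  then show ?thesis by (rule that)
qed

section \<open>Cross products and planes through the origin\<close>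

definition crs :: "'k::field ^ 3 \<Rightarrow> 'k ^ 3 \<Rightarrow> 'k ^ 3" where
  "crs a b = vector [a $ 2 * b $ 3 - a $ 3 * b $ 2, a $ 3 * b $ 1 - a $ 1 * b $ 3, a $ 1 * b $ 2 - a $ 2 * b $ 1]"

lemma crs_nth [simp]:
  "crs a b $ 1 = a $ 2 * b $ 3 - a $ 3 * b $ 2"
  "crs a b $ 2 = a $ 3 * b $ 1 - a $ 1 * b $ 3"
  "crs a b $ 3 = a $ 1 * b $ 2 - a $ 2 * b $ 1"
  by (simp_all add: crs_def vector_3)

lemma vec3_eq_iff: "v = w \<longleftrightarrow> v $ 1 = w $ 1 \<and> v $ 2 = w $ 2 \<and> v $ 3 = w $ (3::3)"
  by (simp add: vec_eq_iff forall_3)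

lemma crs_perp [simp]: "scalar_product (crs a b) a = 0" "scalar_product (crs a b) b = 0"
  by (simp_all add: scalar_product_3 algebra_simps)

lemma crs_self [simp]: "crs a a = 0" "crs (c *s a) a = 0" "crs a (c *s a) = 0"
  by (simp_all add: vec3_eq_iff algebra_simps)

lemma crs_combination: "crs (s *s a + r *s b) (s' *s a + r' *s b) = (s * r' - r * s') *s crs a b"
  by (simp add: vec3_eq_iff) (simp add: algebra_simps)

lemma proportional_if_minors_zero:
  fixes x n :: "'k::field ^ 3"
  assumes "n \<noteq> 0" "\<And>i j. x $ i * n $ j = x $ j * n $ i"
  obtains c where "x = c *s n"
proof -
  obtain i where i: "n $ i \<noteq> 0" using assms(1) by (auto simp: vec_eq_iff)
  have "x = (x $ i / n $ i) *s n"
    using i assms(2)[of i] by (simp add: vec_eq_iff field_simps)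
  then show ?thesis by (rule that)
qed

lemma proportional_if_crs_0:
  assumes "n \<noteq> 0" "crs x n = 0"
  obtains c where "x = c *s n"
proof (rule proportional_if_minors_zero[OF assms(1)])
  have "x $ 2 * n $ 3 = x $ 3 * n $ 2" "x $ 3 * n $ 1 = x $ 1 * n $ 3" "x $ 1 * n $ 2 = x $ 2 * n $ 1"
    using assms(2) by (simp_all add: vec3_eq_iff)
  then have "\<forall>i j. x $ i * n $ j = x $ j * n $ i" by (simp add: forall_3)
  then show "x $ i * n $ j = x $ j * n $ i" for i j by blast
qed

lemma perp_plane:
  assumes "crs a b \<noteq> 0" "scalar_product x a = 0" "scalar_product x b = 0"
  obtains c where "x = c *s crs a b"
proof (rule proportional_if_crs_0[OF assms(1)])
  have a: "x $ 1 * a $ 1 + x $ 2 * a $ 2 + x $ 3 * a $ 3 = 0"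
    and b: "x $ 1 * b $ 1 + x $ 2 * b $ 2 + x $ 3 * b $ 3 = 0"
    using assms(2,3) by (simp_all add: scalar_product_3)
  show "crs x (crs a b) = 0"
    unfolding vec3_eq_iff crs_nth zero_index using a b by (intro conjI) Groebner_Basis.algebra+
qed

text \<open>Cramer's rule in the first two coordinates. The hypothesis \<open>w\<close> says that a
  3 by 3 determinant vanishes, and it makes the third coordinate follow.\<close>

lemma cramer_plane:
  fixes a1 a2 a3 b1 b2 b3 w1 w2 w3 :: "'k::field"
  assumes m: "a1 * b2 - a2 * b1 \<noteq> 0"
    and w: "(a2 * b3 - a3 * b2) * w1 + (a3 * b1 - a1 * b3) * w2 + (a1 * b2 - a2 * b1) * w3 = 0"
  shows "\<exists>s r. w1 = s * a1 + r * b1 \<and> w2 = s * a2 + r * b2 \<and> w3 = s * a3 + r * b3"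
proof -
  define m where "m = a1 * b2 - a2 * b1"
  have m0: "m \<noteq> 0" using m by (simp add: m_def)
  have "m * w1 = (w1 * b2 - w2 * b1) * a1 + (a1 * w2 - a2 * w1) * b1"
    "m * w2 = (w1 * b2 - w2 * b1) * a2 + (a1 * w2 - a2 * w1) * b2"
    unfolding m_def by Groebner_Basis.algebra+
  moreover have "m * w3 = (w1 * b2 - w2 * b1) * a3 + (a1 * w2 - a2 * w1) * b3"
    unfolding m_def using w by Groebner_Basis.algebra
  ultimately have "w1 = (w1 * b2 - w2 * b1) / m * a1 + (a1 * w2 - a2 * w1) / m * b1 \<and>
      w2 = (w1 * b2 - w2 * b1) / m * a2 + (a1 * w2 - a2 * w1) / m * b2 \<and>
      w3 = (w1 * b2 - w2 * b1) / m * a3 + (a1 * w2 - a2 * w1) / m * b3"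
    using m0 by (simp add: eq_divide_eq add_divide_distrib[symmetric] mult.commute)
  then show ?thesis by blast
qed

lemma in_plane:
  assumes "crs a b \<noteq> 0" "scalar_product (crs a b) w = 0"
  obtains s r where "w = s *s a + r *s b"
proof -
  have w: "(a $ 2 * b $ 3 - a $ 3 * b $ 2) * w $ 1 + (a $ 3 * b $ 1 - a $ 1 * b $ 3) * w $ 2
      + (a $ 1 * b $ 2 - a $ 2 * b $ 1) * w $ 3 = 0"
    using assms(2) by (simp add: scalar_product_3)
  have "\<exists>s r. w $ 1 = s * a $ 1 + r * b $ 1 \<and> w $ 2 = s * a $ 2 + r * b $ 2 \<and> w $ 3 = s * a $ 3 + r * b $ 3"
  proof -
    consider "a $ 1 * b $ 2 - a $ 2 * b $ 1 \<noteq> 0" | "a $ 2 * b $ 3 - a $ 3 * b $ 2 \<noteq> 0"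
      | "a $ 3 * b $ 1 - a $ 1 * b $ 3 \<noteq> 0"
      using assms(1) by (auto simp: vec3_eq_iff)
    then show ?thesis
    proof cases
      case 1
      then show ?thesis using w by (rule cramer_plane)
    next
      case 2
      have "(a $ 3 * b $ 1 - a $ 1 * b $ 3) * w $ 2 + (a $ 1 * b $ 2 - a $ 2 * b $ 1) * w $ 3
          + (a $ 2 * b $ 3 - a $ 3 * b $ 2) * w $ 1 = 0"
        using w by (simp only: ac_simps)
      from cramer_plane[OF 2 this] show ?thesis by auto
    next
      case 3
      have "(a $ 1 * b $ 2 - a $ 2 * b $ 1) * w $ 3 + (a $ 2 * b $ 3 - a $ 3 * b $ 2) * w $ 1
          + (a $ 3 * b $ 1 - a $ 1 * b $ 3) * w $ 2 = 0"
        using w by (simp only: ac_simps)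
      from cramer_plane[OF 3 this] show ?thesis by auto
    qed
  qed
  then obtain s r where "w = s *s a + r *s b" by (auto simp: vec3_eq_iff)
  then show ?thesis by (rule that)
qed

lemma plane_coordinates_unique:
  assumes "crs a b \<noteq> 0" "s *s a + r *s b = s' *s a + r' *s b"
  shows "s = s' \<and> r = r'"
proof -
  have "(s - s') *s a + (r - r') *s b = 0"
    using assms(2) by (simp add: algebra_simps vector_ssub_ldistrib vector_sub_rdistrib)
  then have 0: "crs ((s - s') *s a + (r - r') *s b) x = 0" for x
    by (simp add: vec3_eq_iff)
  \<comment> \<open>Crossing the vanishing combination with \<open>b\<close> and with
    \<open>- a\<close> isolates one coefficient at a time.\<close>
  have "(s - s') *s crs a b = 0" "(r - r') *s crs a b = 0"
    using 0[of "0 *s a + 1 *s b"] 0[of "(-1) *s a + 0 *s b"] unfolding crs_combination by simp_all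
  then show ?thesis using assms(1) by simp
qed

lemma ex_plane_basis:
  fixes u :: "'k::field ^ 3"
  assumes "u \<noteq> 0"
  obtains a b k where "k \<noteq> 0" "crs a b = k *s u"
proof -
  consider "u $ 1 \<noteq> 0" | "u $ 2 \<noteq> 0" | "u $ 3 \<noteq> 0" using assms by (auto simp: vec3_eq_iff)
  then show ?thesis
  proof cases
    case 1
    then show ?thesis
      by (rule that[of _ "vector [- u $ 2, u $ 1, 0]" "vector [- u $ 3, 0, u $ 1]"]) (simp add: vec3_eq_iff vector_3)
  next
    case 2
    then show ?thesis
      by (rule that[of _ "vector [0, - u $ 3, u $ 2]" "vector [u $ 2, - u $ 1, 0]"]) (simp add: vec3_eq_iff vector_3)
  next
    case 3
    then show ?thesis
      by (rule that[of _ "vector [u $ 3, 0, - u $ 1]" "vector [0, u $ 3, - u $ 2]"]) (simp add: vec3_eq_iff vector_3)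
  qed
qed

section \<open>Restriction of forms to planes, congruence and rank\<close>

lemma qf_combination:
  assumes "transpose M = M"
  shows "qf M (s *s a + r *s b) = qf M a * s\<^sup>2 + 2 * scalar_product a (M *v b) * s * r + qf M b * r\<^sup>2"
proof -
  have "scalar_product b (M *v a) = scalar_product a (M *v b)"
    using scalar_product_matrix[of b M a] assms by (simp only: scalar_product_commute[of a])
  then show ?thesis
    by (simp add: qf_def matrix_vector_right_distrib vector_scalar_commute power2_eq_square algebra_simps)
qed

lemma det_sym_3:
  fixes M :: "'k::field ^ 3 ^ 3"
  assumes "transpose M = M"
  shows "det M = M $ 1 $ 1 * M $ 2 $ 2 * M $ 3 $ 3 + 2 * M $ 1 $ 2 * M $ 1 $ 3 * M $ 2 $ 3
    - M $ 1 $ 1 * (M $ 2 $ 3)\<^sup>2 - M $ 2 $ 2 * (M $ 1 $ 3)\<^sup>2 - M $ 3 $ 3 * (M $ 1 $ 2)\<^sup>2"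
  unfolding det_3 transpose_eqD[OF assms, of 2 1] transpose_eqD[OF assms, of 3 1] transpose_eqD[OF assms, of 3 2]
  by Groebner_Basis.algebra

text \<open>The quadratic form of the adjugate of a symmetric \<open>M\<close>, that is, of the
  inverse up to the factor \<open>det M\<close>.\<close>

definition adjugate_qf :: "'k::field ^ 3 ^ 3 \<Rightarrow> 'k ^ 3 \<Rightarrow> 'k" where
  "adjugate_qf M u =
    (M $ 2 $ 2 * M $ 3 $ 3 - (M $ 2 $ 3)\<^sup>2) * (u $ 1)\<^sup>2 + (M $ 1 $ 1 * M $ 3 $ 3 - (M $ 1 $ 3)\<^sup>2) * (u $ 2)\<^sup>2
    + (M $ 1 $ 1 * M $ 2 $ 2 - (M $ 1 $ 2)\<^sup>2) * (u $ 3)\<^sup>2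
    + 2 * (M $ 1 $ 3 * M $ 2 $ 3 - M $ 1 $ 2 * M $ 3 $ 3) * u $ 1 * u $ 2
    + 2 * (M $ 1 $ 2 * M $ 2 $ 3 - M $ 1 $ 3 * M $ 2 $ 2) * u $ 1 * u $ 3
    + 2 * (M $ 1 $ 2 * M $ 1 $ 3 - M $ 1 $ 1 * M $ 2 $ 3) * u $ 2 * u $ 3"

lemma adjugate_qf_image:
  assumes "transpose M = M"
  shows "adjugate_qf M (M *v v) = det M * qf M v"
  unfolding adjugate_qf_def matrix_vector_mult_3 det_sym_3[OF assms] qf_3[OF assms]
    transpose_eqD[OF assms, of 2 1] transpose_eqD[OF assms, of 3 1] transpose_eqD[OF assms, of 3 2]
  by Groebner_Basis.algebra

text \<open>On the left is the quarter discriminant of the form on the plane spanned by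
  \<open>a\<close> and \<open>b\<close>. For the polar plane of \<open>v\<close>, whose normal is
  \<open>M *v v\<close>, \<open>adjugate_qf_image\<close> turns it into
  \<open>- det M * qf M v\<close> up to a square. This is where the sign and the determinant in
  \<open>position\<close> come from.\<close>

lemma plane_discriminant:
  assumes "transpose M = M"
  shows "(scalar_product a (M *v b))\<^sup>2 - qf M a * qf M b = - adjugate_qf M (crs a b)"
  unfolding adjugate_qf_def matrix_vector_mult_3 scalar_product_3 qf_3[OF assms] crs_nth
    transpose_eqD[OF assms, of 2 1] transpose_eqD[OF assms, of 3 1] transpose_eqD[OF assms, of 3 2]
  by Groebner_Basis.algebra

lemma adjugate_qf_scale: "adjugate_qf M (c *s u) = c\<^sup>2 * adjugate_qf M u"
  unfolding adjugate_qf_def vector_smult_component by Groebner_Basis.algebra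

text \<open>Both \<open>M *v a\<close> and \<open>M *v b\<close> would be normal to the plane, hence
  multiples of one vector, and injectivity of \<open>M\<close> would make \<open>a\<close> and
  \<open>b\<close> dependent.\<close>

lemma no_isotropic_plane:
  assumes sym: "transpose M = M" and det: "det M \<noteq> 0" and ab: "crs a b \<noteq> 0"
    and zero: "qf M a = 0" "scalar_product a (M *v b) = 0" "qf M b = 0"
  shows False
proof -
  have ba: "scalar_product b (M *v a) = 0"
    using scalar_product_matrix[of b M a] sym zero(2) by (simp only: scalar_product_commute[of a])
  obtain c where c: "M *v a = c *s crs a b"
    using perp_plane[OF ab, of "M *v a"] zero(1) ba by (auto simp: qf_def scalar_product_commute)
  obtain d where d: "M *v b = d *s crs a b"
    using perp_plane[OF ab, of "M *v b"] zero(2,3) by (auto simp: qf_def scalar_product_commute)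
  have "M *v (d *s a) = M *v (c *s b)"
    by (simp add: vector_scalar_commute c d vector_smult_assoc mult.commute)
  then have dc: "d *s a = c *s b" by (rule matrix_vector_mult_inj[OF det])
  have "c *s crs a b = crs a (c *s b)"
    by (simp add: vec3_eq_iff algebra_simps)
  then have "c *s crs a b = 0" unfolding dc[symmetric] by simp
  then have "M *v a = 0" using c by simp
  then have "a = 0" using matrix_vector_mult_eq_0_iff[OF det] by simp
  then show False using ab by (simp add: vec3_eq_iff)
qed

lemma qf_congruence: "qf (transpose S ** M ** S) x = qf M (S *v x)" for M :: "'k::field ^ 3 ^ 3"
proof -
  have "scalar_product x (transpose S *v y) = scalar_product (S *v x) y" for y
    using scalar_product_matrix[of x "transpose S" y] by (simp add: transpose_transpose)
  then show ?thesis by (simp add: qf_def matrix_vector_mul_assoc[symmetric])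
qed

lemma transpose_congruence:
  fixes M :: "'k::field ^ 3 ^ 3"
  assumes "transpose M = M"
  shows "transpose (transpose S ** M ** S) = transpose S ** M ** S"
  using assms by (simp add: matrix_transpose_mul transpose_transpose matrix_mul_assoc)

lemma scalar_product_axis [simp]: "scalar_product (axis i 1) w = w $ i" for w :: "'k::field ^ 3"
  by (simp add: scalar_product_def axis_def if_distrib if_distribR cong: if_cong)

lemma matrix_axis_nth [simp]: "(M *v axis j 1) $ i = M $ i $ j" for M :: "'k::field ^ 3 ^ 3"
  by (simp add: matrix_vector_mult_def axis_def if_distrib cong: if_cong)

lemma qf_axis [simp]: "qf M (axis i 1) = M $ i $ i"
  by (simp add: qf_def)

lemma qf_eq_0_imp_zero:
  fixes M :: "'k::field ^ 3 ^ 3"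
  assumes sym: "transpose M = M" and two: "(2 :: 'k) \<noteq> 0" and zero: "\<And>v. qf M v = 0"
  shows "M = 0"
proof -
  have "M $ i $ j = 0" for i j
  proof -
    have "qf M (1 *s axis i 1 + 1 *s axis j 1) = 0" by (rule zero)
    then have "2 * (M $ i $ j) = 0"
      using zero[of "axis i 1"] zero[of "axis j 1"] unfolding qf_combination[OF sym] by simp
    then show ?thesis using two by simp
  qed
  then show ?thesis by (simp add: vec_eq_iff)
qed

definition rank_le_1 :: "'k::field ^ 3 ^ 3 \<Rightarrow> bool" where
  "rank_le_1 M \<longleftrightarrow> (\<exists>u c. \<forall>v. qf M v = c * (scalar_product u v)\<^sup>2)"

text \<open>The quadratic form would vanish on the plane where the linear form does, which
  \<open>no_isotropic_plane\<close> forbids.\<close>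

lemma not_rank_le_1_if_det:
  fixes M :: "'k::field ^ 3 ^ 3"
  assumes sym: "transpose M = M" and two: "(2 :: 'k) \<noteq> 0" and det: "det M \<noteq> 0"
  shows "\<not> rank_le_1 M"
proof
  assume "rank_le_1 M"
  then obtain u c where u: "\<And>v. qf M v = c * (scalar_product u v)\<^sup>2" unfolding rank_le_1_def by blast
  \<comment> \<open>For \<open>u = 0\<close> any plane will do; \<open>axis 1 1\<close> is an
    arbitrary normal.\<close>
  define u' where "u' = (if u = 0 then axis 1 1 else u)"
  have u': "u' \<noteq> 0" by (simp add: u'_def axis_eq_0_iff)
  have zero: "qf M w = 0" if "scalar_product u' w = 0" for w
    using that by (cases "u = 0") (simp_all add: u u'_def)
  obtain a b k where k: "k \<noteq> 0" "crs a b = k *s u'" using ex_plane_basis[OF u'] .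
  have "k * scalar_product u' a = 0" "k * scalar_product u' b = 0"
    using crs_perp[of a b] unfolding k(2) by simp_all
  then have perp: "scalar_product u' a = 0" "scalar_product u' b = 0" using k(1) by simp_all
  have "qf M (1 *s a + 1 *s b) = 0" by (rule zero) (simp add: perp)
  then have "2 * scalar_product a (M *v b) = 0"
    unfolding qf_combination[OF sym] using zero[OF perp(1)] zero[OF perp(2)] by simp
  then have "scalar_product a (M *v b) = 0" using two by simp
  moreover have "crs a b \<noteq> 0" using k u' by simp
  ultimately show False using no_isotropic_plane[OF sym det] zero perp by blast
qed

lemma ex_matrix_first_column:
  fixes e :: "'k::field ^ 3"
  assumes "e \<noteq> 0"
  obtains S where "det S \<noteq> 0" "S *v axis 1 1 = e"
proof -
  define S :: "'k ^ 3 \<Rightarrow> 'k ^ 3 \<Rightarrow> 'k ^ 3 ^ 3" where "S f g = (\<chi> i j. if j = 1 then e $ i else if j = 2 then f $ i else g $ i)" for f g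
  have "S f g *v axis 1 1 = e" for f g by (simp add: S_def vec_eq_iff)
  moreover have "\<exists>f g. det (S f g) \<noteq> 0"
  proof -
    consider "e $ 1 \<noteq> 0" | "e $ 2 \<noteq> 0" | "e $ 3 \<noteq> 0" using assms by (auto simp: vec3_eq_iff)
    then show ?thesis
    proof cases
      case 1
      then have "det (S (vector [0, 1, 0]) (vector [0, 0, 1])) \<noteq> 0" by (simp add: det_3 S_def vector_3)
      then show ?thesis by blast
    next
      case 2
      then have "det (S (vector [1, 0, 0]) (vector [0, 0, 1])) \<noteq> 0" by (simp add: det_3 S_def vector_3)
      then show ?thesis by blast
    next
      case 3
      then have "det (S (vector [1, 0, 0]) (vector [0, 1, 0])) \<noteq> 0" by (simp add: det_3 S_def vector_3)
      then show ?thesis by blast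
    qed
  qed
  ultimately show ?thesis using that by blast
qed

lemma vector_eta: "vector [v $ 1, v $ 2, v $ 3] = v" for v :: "'a::zero ^ 3"
  by (simp add: vec3_eq_iff vector_3)

lemma sum_vec3: "(\<Sum>v\<in>UNIV. f v) = (\<Sum>y\<in>UNIV. \<Sum>z\<in>UNIV. \<Sum>x\<in>UNIV. f (vector [x, y, z]))"
  for f :: "'a::{finite,zero} ^ 3 \<Rightarrow> 'b::comm_monoid_add"
proof -
  have "(\<Sum>v\<in>UNIV. f v) = (\<Sum>(y, z, x)\<in>UNIV \<times> UNIV \<times> UNIV. f (vector [x, y, z]))"
    by (rule sum.reindex_bij_witness[of _ "\<lambda>(y, z, x). vector [x, y, z]" "\<lambda>v. (v $ 2, v $ 3, v $ 1)"])
      (auto simp: vector_3 vector_eta)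
  then show ?thesis by (simp add: sum.cartesian_product)
qed

lemma sum_card_swap:
  assumes "finite A" "finite B"
  shows "(\<Sum>x\<in>A. int (card {y \<in> B. R x y})) = (\<Sum>y\<in>B. int (card {x \<in> A. R x y}))"
proof -
  have "(\<Sum>x\<in>A. int (card {y \<in> B. R x y})) = (\<Sum>x\<in>A. \<Sum>y\<in>{y \<in> B. R x y}. 1)"
    by simp
  also have "\<dots> = (\<Sum>y\<in>B. \<Sum>x\<in>{x \<in> A. R x y}. 1)"
    by (rule sum.swap_restrict[OF assms])
  finally show ?thesis by simp
qed

section \<open>Cones over the conic and its dual, and their sizes\<close>

definition zeros :: "'k::field ^ 3 ^ 3 \<Rightarrow> ('k ^ 3) set" where
  "zeros M = {v. v \<noteq> 0 \<and> qf M v = 0}"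

definition tangents :: "'k::field ^ 3 ^ 3 \<Rightarrow> ('k ^ 3) set" where
  "tangents M = (\<lambda>w. M *v w) ` zeros M"

text \<open>1, -1 or 0 according to whether \<open>v\<close> is external, internal or on the conic.\<close>

definition position :: "'a::finite_field ^ 3 ^ 3 \<Rightarrow> 'a ^ 3 \<Rightarrow> int" where
  "position M v = qchar (- det M * qf M v)"

lemma position_0 [simp]: "position M 0 = 0"
  by (simp add: position_def)

lemma tangents_nonzero: "det M \<noteq> 0 \<Longrightarrow> l \<in> tangents M \<Longrightarrow> l \<noteq> 0"
  by (auto simp: tangents_def zeros_def matrix_vector_mult_eq_0_iff)

lemma tangents_scale: "c \<noteq> 0 \<Longrightarrow> l \<in> tangents M \<Longrightarrow> c *s l \<in> tangents M"
  unfolding tangents_def zeros_def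
  by (auto simp: qf_scale vector_scalar_commute[symmetric] intro!: imageI)

lemma card_plane_minus_0:
  fixes u :: "'a::finite_field ^ 3"
  assumes "u \<noteq> 0"
  shows "int (card {v. v \<noteq> 0 \<and> scalar_product v u = 0}) = (int CARD('a))\<^sup>2 - 1"
proof -
  obtain a b k where k: "k \<noteq> 0" "crs a b = k *s u" using ex_plane_basis[OF assms] .
  have ab: "crs a b \<noteq> 0" using k assms by simp
  have "(\<lambda>(s, r). s *s a + r *s b) ` UNIV = {v. scalar_product v u = 0}"
  proof (intro equalityI subsetI)
    fix v assume "v \<in> (\<lambda>(s, r). s *s a + r *s b) ` UNIV"
    then obtain s r where v: "v = s *s a + r *s b" by auto
    have "scalar_product (crs a b) v = 0" unfolding v by simp
    then have "k * scalar_product v u = 0" unfolding k(2) by (simp add: scalar_product_commute)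
    then show "v \<in> {v. scalar_product v u = 0}" using k(1) by simp
  next
    fix v assume "v \<in> {v. scalar_product v u = 0}"
    then have "scalar_product (crs a b) v = 0" unfolding k(2) by (simp add: scalar_product_commute)
    then obtain s r where "v = s *s a + r *s b" using in_plane[OF ab] by blast
    then show "v \<in> (\<lambda>(s, r). s *s a + r *s b) ` UNIV" by (intro image_eqI[of _ _ "(s, r)"]) simp_all
  qed
  moreover have "inj (\<lambda>(s, r). s *s a + r *s b)"
    by (rule injI) (auto dest: plane_coordinates_unique[OF ab])
  ultimately have "card {v. scalar_product v u = 0} = CARD('a \<times> 'a)"
    using card_image[of "\<lambda>(s, r). s *s a + r *s b" UNIV] by simp
  then have "int (card {v. scalar_product v u = 0}) = (int CARD('a))\<^sup>2"
    by (simp add: power2_eq_square)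
  moreover have "{v. scalar_product v u = 0} = insert 0 {v. v \<noteq> 0 \<and> scalar_product v u = 0}"
    by (auto simp: scalar_product_commute)
  then have "card {v. scalar_product v u = 0} = Suc (card {v. v \<noteq> 0 \<and> scalar_product v u = 0})"
    by simp
  ultimately show ?thesis by simp
qed

lemma card_common_perp:
  fixes u w :: "'a::finite_field ^ 3"
  assumes "crs u w \<noteq> 0"
  shows "int (card {v. v \<noteq> 0 \<and> scalar_product v u = 0 \<and> scalar_product v w = 0}) = int CARD('a) - 1"
proof -
  have "{v. v \<noteq> 0 \<and> scalar_product v u = 0 \<and> scalar_product v w = 0} = (\<lambda>c. c *s crs u w) ` (UNIV - {0})"
  proof (intro equalityI subsetI)
    fix v assume "v \<in> {v. v \<noteq> 0 \<and> scalar_product v u = 0 \<and> scalar_product v w = 0}"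
    then have v: "v \<noteq> 0" "scalar_product v u = 0" "scalar_product v w = 0" by simp_all
    obtain c where c: "v = c *s crs u w" using perp_plane[OF assms v(2,3)] .
    moreover have "c \<noteq> 0" using c v(1) by auto
    ultimately show "v \<in> (\<lambda>c. c *s crs u w) ` (UNIV - {0})" by (intro image_eqI[of _ _ c]) simp_all
  next
    fix v assume "v \<in> (\<lambda>c. c *s crs u w) ` (UNIV - {0})"
    then show "v \<in> {v. v \<noteq> 0 \<and> scalar_product v u = 0 \<and> scalar_product v w = 0}"
      using assms by auto
  qed
  moreover have "inj_on (\<lambda>c. c *s crs u w) (UNIV - {0})"
    using assms by (auto intro!: inj_onI)
  ultimately have "card {v. v \<noteq> 0 \<and> scalar_product v u = 0 \<and> scalar_product v w = 0} = card (UNIV - {0 :: 'a})"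
    by (simp add: card_image)
  moreover have "CARD('a) \<ge> 1" using finite_UNIV_card_ge_0[where 'a = 'a] by simp
  ultimately show ?thesis by (simp add: card_Diff_singleton of_nat_diff)
qed

context
  assumes odd_card: "odd CARD('a::finite_field)"
begin

text \<open>In the first coordinate the form is a quadratic polynomial with leading coefficient
  \<open>a\<close>. Its discriminant is a binary form in the other two coordinates, not identically
  zero because the rank exceeds 1, and the number of zeros of that form brings in
  \<open>det N\<close>.\<close>

lemma sum_qchar_qf_aux:
  fixes N :: "'a ^ 3 ^ 3"
  assumes sym: "transpose N = N" and a: "N $ 1 $ 1 \<noteq> 0" and rank: "\<not> rank_le_1 N"
  shows "(\<Sum>v\<in>UNIV. qchar (qf N v)) = int CARD('a) * (int CARD('a) - 1) * qchar (- det N)"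
proof -
  let ?q = "int CARD('a)"
  define a where "a = N $ 1 $ 1"
  define \<alpha> \<beta> \<gamma> where "\<alpha> = a * N $ 2 $ 2 - (N $ 1 $ 2)\<^sup>2" and "\<beta> = a * N $ 2 $ 3 - N $ 1 $ 2 * N $ 1 $ 3"
    and "\<gamma> = a * N $ 3 $ 3 - (N $ 1 $ 3)\<^sup>2"
  define F where "F = {(y, z). \<alpha> * y\<^sup>2 + 2 * \<beta> * y * z + \<gamma> * z\<^sup>2 = 0}"
  have a0: "a \<noteq> 0" using a by (simp add: a_def)
  have nz: "\<alpha> \<noteq> 0 \<or> \<beta> \<noteq> 0 \<or> \<gamma> \<noteq> 0"
  proof (rule ccontr)
    assume "\<not> (\<alpha> \<noteq> 0 \<or> \<beta> \<noteq> 0 \<or> \<gamma> \<noteq> 0)"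
    then have *: "a * N $ 2 $ 2 = (N $ 1 $ 2)\<^sup>2" "a * N $ 2 $ 3 = N $ 1 $ 2 * N $ 1 $ 3" "a * N $ 3 $ 3 = (N $ 1 $ 3)\<^sup>2"
      by (simp_all add: \<alpha>_def \<beta>_def \<gamma>_def)
    have "a * qf N v = (scalar_product (N $ 1) v)\<^sup>2" for v
      unfolding qf_3[OF sym] scalar_product_3 a_def[symmetric] using * by Groebner_Basis.algebra
    then have "qf N v = (1 / a) * (scalar_product (N $ 1) v)\<^sup>2" for v
      using a0 by (simp add: eq_divide_eq mult.commute)
    then show False using rank unfolding rank_le_1_def by blast
  qed
  have inner: "(\<Sum>x\<in>UNIV. qchar (qf N (vector [x, y, z]))) = qchar a * (?q * of_bool ((y, z) \<in> F) - 1)" for y z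
  proof -
    define b c where "b = N $ 1 $ 2 * y + N $ 1 $ 3 * z"
      and "c = N $ 2 $ 2 * y\<^sup>2 + N $ 3 $ 3 * z\<^sup>2 + 2 * N $ 2 $ 3 * y * z"
    have "qf N (vector [x, y, z]) = a * x\<^sup>2 + 2 * b * x + c" for x
      unfolding qf_3[OF sym] vector_3 b_def c_def a_def by Groebner_Basis.algebra
    then have sum: "(\<Sum>x\<in>UNIV. qchar (qf N (vector [x, y, z]))) = qchar a * (if b\<^sup>2 = a * c then ?q - 1 else -1)"
      using sum_qchar_quadratic[OF odd_card a0, of b c] by simp
    have form: "a * c - b\<^sup>2 = \<alpha> * y\<^sup>2 + 2 * \<beta> * y * z + \<gamma> * z\<^sup>2"
      unfolding b_def c_def \<alpha>_def \<beta>_def \<gamma>_def by Groebner_Basis.algebra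
    have "(y, z) \<in> F \<longleftrightarrow> a * c - b\<^sup>2 = 0" unfolding form F_def by simp
    then have iff: "b\<^sup>2 = a * c \<longleftrightarrow> (y, z) \<in> F" by auto
    show ?thesis using sum unfolding iff by simp
  qed
  have card: "int (card F) = ?q + (?q - 1) * qchar (\<beta>\<^sup>2 - \<alpha> * \<gamma>)"
    unfolding F_def by (rule card_binary_form_zeros[OF odd_card nz])
  have disc: "\<beta>\<^sup>2 - \<alpha> * \<gamma> = a * (- det N)"
    unfolding det_sym_3[OF sym] \<alpha>_def \<beta>_def \<gamma>_def a_def by Groebner_Basis.algebra
  have "(\<Sum>v\<in>UNIV. qchar (qf N v)) = (\<Sum>y\<in>UNIV. \<Sum>z\<in>UNIV. qchar a * (?q * of_bool ((y, z) \<in> F) - 1))"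
    unfolding sum_vec3 inner ..
  also have "\<dots> = (\<Sum>p\<in>UNIV. qchar a * (?q * of_bool (p \<in> F) - 1))"
    by (simp add: sum.cartesian_product)
  also have "\<dots> = qchar a * (?q * int (card F) - ?q\<^sup>2)"
    by (simp add: sum_distrib_left[symmetric] sum_subtractf sum_of_bool_eq power2_eq_square)
  also have "\<dots> = ?q * (?q - 1) * (qchar a * qchar (a * (- det N)))"
    unfolding card disc by (simp add: power2_eq_square algebra_simps)
  also have "qchar a * qchar (a * (- det N)) = qchar (- det N)"
    using qchar_mult_square[OF odd_card a0, of "- det N"]
    by (simp only: qchar_mult[OF odd_card, symmetric] power2_eq_square mult.assoc)
  finally show ?thesis .
qed

text \<open>A vector with nonzero value is made the first basis vector; this change of coordinates
  multiplies the determinant by a square.\<close>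

lemma sum_qchar_qf:
  fixes M :: "'a ^ 3 ^ 3"
  assumes sym: "transpose M = M" and rank: "\<not> rank_le_1 M"
  shows "(\<Sum>v\<in>UNIV. qchar (qf M v)) = int CARD('a) * (int CARD('a) - 1) * qchar (- det M)"
proof -
  obtain e where e: "qf M e \<noteq> 0"
  proof (rule ccontr)
    assume "\<not> thesis"
    then have "\<forall>v. qf M v = 0 * (scalar_product 0 v)\<^sup>2" using that by auto
    then show False using rank unfolding rank_le_1_def by blast
  qed
  then have "e \<noteq> 0" by auto
  then obtain S where S: "det S \<noteq> 0" "S *v axis 1 1 = e" by (rule ex_matrix_first_column)
  define N where "N = transpose S ** M ** S"
  have qfN: "qf N x = qf M (S *v x)" for x unfolding N_def by (rule qf_congruence)
  have symN: "transpose N = N" unfolding N_def by (rule transpose_congruence[OF sym])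
  have N11: "N $ 1 $ 1 \<noteq> 0" using e by (simp add: qf_axis[symmetric] qfN S(2) del: qf_axis)
  have rankN: "\<not> rank_le_1 N"
  proof
    assume "rank_le_1 N"
    then obtain u c where u: "\<And>v. qf N v = c * (scalar_product u v)\<^sup>2" unfolding rank_le_1_def by blast
    obtain R where R: "S ** R = mat 1"
      using S(1) invertible_det_nz[of S] unfolding invertible_def by blast
    have "qf M v = c * (scalar_product (transpose R *v u) v)\<^sup>2" for v
    proof -
      have "qf M v = qf N (R *v v)" unfolding qfN by (simp add: matrix_vector_mul_assoc R)
      then show ?thesis unfolding u scalar_product_matrix .
    qed
    then show False using rank unfolding rank_le_1_def by blast
  qed
  have detN: "qchar (- det N) = qchar (- det M)"
  proof -
    have "- det N = (det S)\<^sup>2 * (- det M)"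
      by (simp add: N_def det_mul det_transpose power2_eq_square)
    then show ?thesis by (simp only: qchar_mult_square[OF odd_card S(1)])
  qed
  have inj: "inj (\<lambda>x. S *v x)"
    by (rule injI) (rule matrix_vector_mult_inj[OF S(1)])
  have "bij (\<lambda>x. S *v x)"
    using inj finite_UNIV_inj_surj[OF _ inj] by (simp add: bij_def)
  then have "(\<Sum>v\<in>UNIV. qchar (qf M v)) = (\<Sum>x\<in>UNIV. qchar (qf M (S *v x)))"
    by (rule sum.reindex_bij_betw[symmetric])
  also have "\<dots> = int CARD('a) * (int CARD('a) - 1) * qchar (- det M)"
    using sum_qchar_qf_aux[OF symN N11 rankN] unfolding qfN detN .
  finally show ?thesis .
qed

lemma sum_position:
  fixes M :: "'a ^ 3 ^ 3"
  assumes sym: "transpose M = M" and det: "det M \<noteq> 0"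
  shows "(\<Sum>v\<in>UNIV. position M v) = int CARD('a) * (int CARD('a) - 1)"
proof -
  have "(\<Sum>v\<in>UNIV. position M v) = qchar (- det M) * (\<Sum>v\<in>UNIV. qchar (qf M v))"
    unfolding position_def qchar_mult[OF odd_card] by (simp add: sum_distrib_left)
  also have "\<dots> = int CARD('a) * (int CARD('a) - 1) * (qchar (- det M) * qchar (- det M))"
    using sum_qchar_qf[OF sym not_rank_le_1_if_det[OF sym two_neq_zero[OF odd_card] det]] by simp
  finally show ?thesis using qchar_mult_self[OF odd_card, of "- det M"] det by simp
qed

text \<open>The tangent at \<open>w\<close> passes through \<open>v\<close> iff \<open>w\<close>
  lies on the polar plane of \<open>v\<close>. On that plane the form is binary and its discriminant
  has the character \<open>position M v\<close>.\<close>

lemma card_tangents_through: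
  fixes M :: "'a ^ 3 ^ 3"
  assumes sym: "transpose M = M" and det: "det M \<noteq> 0" and v: "v \<noteq> 0"
  shows "int (card {l \<in> tangents M. scalar_product v l = 0}) = (int CARD('a) - 1) * (1 + position M v)"
proof -
  have u: "M *v v \<noteq> 0" using matrix_vector_mult_eq_0_iff[OF det] v by simp
  obtain a b k where k: "k \<noteq> 0" "crs a b = k *s (M *v v)" using ex_plane_basis[OF u] .
  have ab: "crs a b \<noteq> 0" using k u by simp
  define \<alpha> \<beta> \<gamma> where "\<alpha> = qf M a" and "\<beta> = scalar_product a (M *v b)" and "\<gamma> = qf M b"
  have nz: "\<alpha> \<noteq> 0 \<or> \<beta> \<noteq> 0 \<or> \<gamma> \<noteq> 0"
    using no_isotropic_plane[OF sym det ab] unfolding \<alpha>_def \<beta>_def \<gamma>_def by blast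
  define F where "F = {(s, r). \<alpha> * s\<^sup>2 + 2 * \<beta> * s * r + \<gamma> * r\<^sup>2 = 0}"
  define g where "g = (\<lambda>(s, r). M *v (s *s a + r *s b))"
  have perp: "scalar_product v (M *v w) = 0 \<longleftrightarrow> scalar_product (crs a b) w = 0" for w
    unfolding scalar_product_matrix[of v] sym k(2) using k(1) by simp
  have inj: "inj g"
    unfolding g_def by (rule injI) (auto dest!: matrix_vector_mult_inj[OF det] plane_coordinates_unique[OF ab])
  have "{l \<in> tangents M. scalar_product v l = 0} = g ` (F - {(0, 0)})"
  proof (intro equalityI subsetI)
    fix l assume "l \<in> {l \<in> tangents M. scalar_product v l = 0}"
    then obtain w where w: "l = M *v w" "w \<noteq> 0" "qf M w = 0" "scalar_product v (M *v w) = 0"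
      by (auto simp: tangents_def zeros_def)
    obtain s r where sr: "w = s *s a + r *s b"
      using in_plane[OF ab] w(4) unfolding perp by blast
    have "(s, r) \<in> F - {(0, 0)}"
      using w(2,3) unfolding sr qf_combination[OF sym] F_def \<alpha>_def \<beta>_def \<gamma>_def by auto
    moreover have "l = g (s, r)" by (simp add: g_def w(1) sr)
    ultimately show "l \<in> g ` (F - {(0, 0)})" by (rule rev_image_eqI)
  next
    fix l assume "l \<in> g ` (F - {(0, 0)})"
    then obtain s r where sr: "l = g (s, r)" "(s, r) \<in> F" "(s, r) \<noteq> (0, 0)" by auto
    define w where "w = s *s a + r *s b"
    have "w \<noteq> 0" using plane_coordinates_unique[OF ab, of s r 0 0] sr(3) by (auto simp: w_def)
    moreover have "qf M w = 0"
      using sr(2) unfolding w_def qf_combination[OF sym] F_def \<alpha>_def \<beta>_def \<gamma>_def by simp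
    moreover have "scalar_product v (M *v w) = 0" unfolding perp w_def by simp
    moreover have "l = M *v w" using sr(1) by (simp add: g_def w_def)
    ultimately show "l \<in> {l \<in> tangents M. scalar_product v l = 0}"
      by (auto simp: tangents_def zeros_def)
  qed
  then have "card {l \<in> tangents M. scalar_product v l = 0} = card (F - {(0, 0)})"
    using inj by (simp add: card_image inj_on_subset)
  moreover have "(0, 0) \<in> F" by (simp add: F_def)
  then have "card F = Suc (card (F - {(0, 0)}))" using card.remove[of F "(0, 0)"] by simp
  moreover have "int (card F) = int CARD('a) + (int CARD('a) - 1) * qchar (\<beta>\<^sup>2 - \<alpha> * \<gamma>)"
    unfolding F_def by (rule card_binary_form_zeros[OF odd_card nz])
  moreover have "qchar (\<beta>\<^sup>2 - \<alpha> * \<gamma>) = position M v"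
  proof -
    have "\<beta>\<^sup>2 - \<alpha> * \<gamma> = k\<^sup>2 * (- det M * qf M v)"
      unfolding \<alpha>_def \<beta>_def \<gamma>_def plane_discriminant[OF sym] k(2) adjugate_qf_scale adjugate_qf_image[OF sym] by simp
    then show ?thesis unfolding position_def by (simp only: qchar_mult_square[OF odd_card k(1)])
  qed
  ultimately show ?thesis by (simp add: algebra_simps)
qed

lemma card_nonzero_vectors: "int (card (UNIV - {0 :: 'a ^ 3})) = int CARD('a) ^ 3 - 1"
proof -
  have "int (card (UNIV - {0 :: 'a ^ 3})) = int CARD('a ^ 3) - 1"
    using finite_UNIV_card_ge_0[where 'a = "'a ^ 3"] by (simp add: card_Diff_singleton of_nat_diff)
  then show ?thesis by simp
qed

lemma sum_position_nonzero:
  fixes M :: "'a ^ 3 ^ 3"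
  assumes sym: "transpose M = M" and det: "det M \<noteq> 0"
  shows "(\<Sum>v\<in>UNIV - {0}. position M v) = int CARD('a) * (int CARD('a) - 1)"
  using sum_position[OF assms] by (subst sum.mono_neutral_left[of UNIV]) auto

text \<open>Double counting of incident pairs: every tangent vector is orthogonal to
  \<open>q\<^sup>2 - 1\<close> nonzero vectors, and the count from the side of the points is
  known.\<close>

lemma card_tangents:
  fixes M :: "'a ^ 3 ^ 3"
  assumes sym: "transpose M = M" and det: "det M \<noteq> 0"
  shows "int (card (tangents M)) = (int CARD('a))\<^sup>2 - 1"
proof -
  let ?q = "int CARD('a)"
  have q: "?q > 1" using card_ge_3[OF odd_card] by simp
  have "(\<Sum>v\<in>UNIV - {0}. int (card {l \<in> tangents M. scalar_product v l = 0}))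
      = (\<Sum>l\<in>tangents M. int (card {v \<in> UNIV - {0}. scalar_product v l = 0}))"
    by (rule sum_card_swap) auto
  also have "\<dots> = (\<Sum>l\<in>tangents M. ?q\<^sup>2 - 1)"
  proof (rule sum.cong[OF refl])
    fix l assume "l \<in> tangents M"
    then have "l \<noteq> 0" by (rule tangents_nonzero[OF det])
    then show "int (card {v \<in> UNIV - {0}. scalar_product v l = 0}) = ?q\<^sup>2 - 1"
      using card_plane_minus_0[of l] by simp
  qed
  finally have "(\<Sum>v\<in>UNIV - {0}. int (card {l \<in> tangents M. scalar_product v l = 0})) = int (card (tangents M)) * (?q\<^sup>2 - 1)"
    by simp
  moreover have "(\<Sum>v\<in>UNIV - {0}. int (card {l \<in> tangents M. scalar_product v l = 0}))
      = (\<Sum>v\<in>UNIV - {0}. (?q - 1) * (1 + position M v))"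
    by (intro sum.cong refl card_tangents_through[OF assms]) simp
  moreover have "\<dots> = (?q - 1) * (?q ^ 3 - 1 + ?q * (?q - 1))"
    using card_nonzero_vectors sum_position_nonzero[OF assms] by (simp add: sum_distrib_left[symmetric] sum.distrib)
  moreover have "\<dots> = (?q\<^sup>2 - 1) * (?q\<^sup>2 - 1)"
    by (simp add: power2_eq_square power3_eq_cube algebra_simps)
  moreover have "?q\<^sup>2 - 1 \<noteq> 0" using q by (simp add: power2_eq_1_iff)
  ultimately show ?thesis by simp
qed

lemma card_zeros:
  fixes M :: "'a ^ 3 ^ 3"
  assumes "transpose M = M" "det M \<noteq> 0"
  shows "int (card (zeros M)) = (int CARD('a))\<^sup>2 - 1"
proof -
  have "card (tangents M) = card (zeros M)"
    unfolding tangents_def by (rule card_image) (auto intro!: inj_onI dest: matrix_vector_mult_inj[OF assms(2)])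
  then show ?thesis using card_tangents[OF assms] by simp
qed

lemma sum_position_product:
  fixes C D :: "'a ^ 3 ^ 3"
  assumes C: "transpose C = C" "det C \<noteq> 0" and D: "transpose D = D" "det D \<noteq> 0"
    and b: "int (card (tangents C \<inter> tangents D)) = (int CARD('a) - 1) * b"
  shows "(\<Sum>v\<in>UNIV - {0}. position C v * position D v) = (int CARD('a) - 1) * (int CARD('a) * (b - 1))"
proof -
  let ?q = "int CARD('a)"
  let ?Z = "tangents C \<times> tangents D"
  let ?P = "{(l, m) \<in> ?Z. crs l m = 0}"
  let ?R = "\<lambda>v (l, m). scalar_product v l = 0 \<and> scalar_product v m = 0"
  have q: "?q > 1" using card_ge_3[OF odd_card] by simp
  have "(\<Sum>v\<in>UNIV - {0}. int (card {p \<in> ?Z. ?R v p})) = (\<Sum>p\<in>?Z. int (card {v \<in> UNIV - {0}. ?R v p}))"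
    by (rule sum_card_swap) auto
  \<comment> \<open>Two different lines share one point, which is \<open>q - 1\<close> vectors; two
    vectors of the same line share \<open>q\<^sup>2 - 1\<close>. The indicator of \<open>?P\<close>
    carries the difference.\<close>
  also have "\<dots> = (\<Sum>p\<in>?Z. ?q - 1 + (?q\<^sup>2 - ?q) * of_bool (p \<in> ?P))"
  proof (rule sum.cong[OF refl])
    fix p assume "p \<in> ?Z"
    then obtain l m where p: "p = (l, m)" "l \<in> tangents C" "m \<in> tangents D" by auto
    then have nz: "l \<noteq> 0" "m \<noteq> 0" using tangents_nonzero C(2) D(2) by blast+
    show "int (card {v \<in> UNIV - {0}. ?R v p}) = ?q - 1 + (?q\<^sup>2 - ?q) * of_bool (p \<in> ?P)"
    proof (cases "crs l m = 0")
      case True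
      then obtain c where c: "l = c *s m" by (rule proportional_if_crs_0[OF nz(2)])
      then have "{v \<in> UNIV - {0}. ?R v p} = {v. v \<noteq> 0 \<and> scalar_product v m = 0}" by (auto simp: p)
      then show ?thesis using card_plane_minus_0[OF nz(2)] True p by simp
    next
      case False
      have "{v \<in> UNIV - {0}. ?R v p} = {v. v \<noteq> 0 \<and> scalar_product v l = 0 \<and> scalar_product v m = 0}" by (auto simp: p)
      then show ?thesis using card_common_perp[OF False] False p by simp
    qed
  qed
  also have "\<dots> = (?q - 1) * int (card ?Z) + (?q\<^sup>2 - ?q) * int (card ?P)"
  proof -
    have "?Z \<inter> {p. p \<in> ?P} = ?P" by auto
    then show ?thesis by (simp add: sum.distrib sum_distrib_left[symmetric] sum_of_bool_eq mult.commute)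
  qed
  also have "int (card ?Z) = (?q\<^sup>2 - 1)\<^sup>2"
    by (simp add: card_cartesian_product card_tangents[OF C] card_tangents[OF D] power2_eq_square)
  \<comment> \<open>A proportional pair is a common tangent together with a nonzero factor.\<close>
  also have "int (card ?P) = (?q - 1) * ((?q - 1) * b)"
  proof -
    have "?P = (\<lambda>(c, l). (l, c *s l)) ` ((UNIV - {0}) \<times> (tangents C \<inter> tangents D))"
    proof (intro equalityI subsetI)
      fix p assume "p \<in> ?P"
      then obtain l m where p: "p = (l, m)" "l \<in> tangents C" "m \<in> tangents D" "crs l m = 0" by auto
      have nz: "l \<noteq> 0" "m \<noteq> 0" using tangents_nonzero C(2) D(2) p(2,3) by blast+
      obtain c where c: "l = c *s m" using proportional_if_crs_0[OF nz(2) p(4)] .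
      have c0: "c \<noteq> 0" using c nz(1) by auto
      have "l \<in> tangents D" unfolding c by (rule tangents_scale[OF c0 p(3)])
      moreover have "m = (1 / c) *s l" using c0 by (simp add: c vector_smult_assoc)
      ultimately show "p \<in> (\<lambda>(c, l). (l, c *s l)) ` ((UNIV - {0}) \<times> (tangents C \<inter> tangents D))"
        using p c0 by (intro image_eqI[of _ _ "(1 / c, l)"]) simp_all
    next
      fix p assume "p \<in> (\<lambda>(c, l). (l, c *s l)) ` ((UNIV - {0}) \<times> (tangents C \<inter> tangents D))"
      then show "p \<in> ?P" by (auto intro: tangents_scale)
    qed
    moreover have "inj_on (\<lambda>(c, l). (l, c *s l)) ((UNIV - {0}) \<times> (tangents C \<inter> tangents D))"
      by (rule inj_onI) (use tangents_nonzero[OF C(2)] in auto)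
    ultimately have "card ?P = card (UNIV - {0 :: 'a}) * card (tangents C \<inter> tangents D)"
      by (simp add: card_image card_cartesian_product)
    moreover have "int (card (UNIV - {0 :: 'a})) = ?q - 1"
      using q by (simp add: card_Diff_singleton of_nat_diff)
    ultimately show ?thesis using b by simp
  qed
  finally have 1: "(\<Sum>v\<in>UNIV - {0}. int (card {p \<in> ?Z. ?R v p}))
      = (?q - 1) * (?q\<^sup>2 - 1)\<^sup>2 + (?q\<^sup>2 - ?q) * ((?q - 1) * ((?q - 1) * b))" .
  \<comment> \<open>The tangents of \<open>C\<close> and of \<open>D\<close> through
    \<open>v\<close> are chosen independently, which gives \<open>(1 + c) * (1 + d)\<close> up to
    the weight of the vectors.\<close>
  have 2: "int (card {p \<in> ?Z. ?R v p}) = (?q - 1)\<^sup>2 * (1 + position C v + position D v + position C v * position D v)"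
    if "v \<in> UNIV - {0}" for v
  proof -
    have v: "v \<noteq> 0" using that by simp
    have "{p \<in> ?Z. ?R v p} = {l \<in> tangents C. scalar_product v l = 0} \<times> {l \<in> tangents D. scalar_product v l = 0}"
      by auto
    then show ?thesis
      by (simp add: card_cartesian_product card_tangents_through[OF C v] card_tangents_through[OF D v] power2_eq_square algebra_simps)
  qed
  define \<sigma> where "\<sigma> = (\<Sum>v\<in>UNIV - {0}. position C v * position D v)"
  have "(\<Sum>v\<in>UNIV - {0}. int (card {p \<in> ?Z. ?R v p}))
      = (\<Sum>v\<in>UNIV - {0}. (?q - 1)\<^sup>2 * (1 + position C v + position D v + position C v * position D v))"
    by (rule sum.cong[OF refl 2])
  also have "\<dots> = (?q - 1)\<^sup>2 * (?q ^ 3 - 1 + ?q * (?q - 1) + ?q * (?q - 1) + \<sigma>)"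
    using card_nonzero_vectors sum_position_nonzero[OF C] sum_position_nonzero[OF D]
    by (simp only: sum_distrib_left[symmetric] sum.distrib \<sigma>_def[symmetric] sum_constant mult_1_right)
  finally have "(?q - 1)\<^sup>2 * (?q ^ 3 - 1 + ?q * (?q - 1) + ?q * (?q - 1) + \<sigma>)
      = (?q - 1) * (?q\<^sup>2 - 1)\<^sup>2 + (?q\<^sup>2 - ?q) * ((?q - 1) * ((?q - 1) * b))"
    unfolding 1 ..
  also have "\<dots> = (?q - 1)\<^sup>2 * (?q ^ 3 - 1 + ?q * (?q - 1) + ?q * (?q - 1) + (?q - 1) * (?q * (b - 1)))"
    by Groebner_Basis.algebra
  finally show ?thesis using q by (simp add: \<sigma>_def)
qed

text \<open>
  For a fixed vector \<open>v\<close> the sum of \<open>qchar (qf C v + x * qf D v)\<close> over all \<open>x\<close> vanishes unless \<open>v\<close> lies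
  on the conic of \<open>D\<close>; for fixed \<open>x\<close> the sum over all \<open>v\<close> is known.
\<close>

lemma sum_position_on_conic:
  fixes C D :: "'a ^ 3 ^ 3"
  assumes C: "transpose C = C" and D: "transpose D = D"
    and rank: "\<And>x. \<not> rank_le_1 (C + mat x ** D)"
  shows "(\<Sum>v\<in>zeros D. position C v) = (int CARD('a) - 1) * (\<Sum>x\<in>UNIV. qchar (det C * det (C + mat x ** D)))"
proof -
  let ?q = "int CARD('a)"
  have q: "?q > 1" using card_ge_3[OF odd_card] by simp
  have entry: "(mat x ** D) $ i $ j = x * D $ i $ j" for x i j
    by (simp add: matrix_matrix_mult_def mat_def if_distrib if_distribR cong: if_cong)
  have sym: "transpose (C + mat x ** D) = C + mat x ** D" for x
    using transpose_eqD[OF C] transpose_eqD[OF D] by (simp add: vec_eq_iff transpose_def entry)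
  have qf: "qf (C + mat x ** D) v = qf D v * x + qf C v" for x v
    unfolding qf_def scalar_product_3 matrix_vector_mult_3 vector_add_component entry by Groebner_Basis.algebra
  have "(\<Sum>v\<in>UNIV. \<Sum>x\<in>UNIV. qchar (qf D v * x + qf C v)) = (\<Sum>v\<in>UNIV. if qf D v = 0 then ?q * qchar (qf C v) else 0)"
    by (intro sum.cong refl) (auto simp: sum_qchar_linear[OF odd_card])
  also have "\<dots> = (\<Sum>v\<in>zeros D. ?q * qchar (qf C v))"
    by (rule sum.mono_neutral_cong_right) (auto simp: zeros_def)
  finally have "?q * (\<Sum>v\<in>zeros D. qchar (qf C v)) = (\<Sum>v\<in>UNIV. \<Sum>x\<in>UNIV. qchar (qf D v * x + qf C v))"
    by (simp add: sum_distrib_left)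
  also have "\<dots> = (\<Sum>x\<in>UNIV. \<Sum>v\<in>UNIV. qchar (qf D v * x + qf C v))" by (rule sum.swap)
  also have "\<dots> = (\<Sum>x\<in>UNIV. ?q * (?q - 1) * qchar (- det (C + mat x ** D)))"
    using sum_qchar_qf[OF sym rank] unfolding qf by simp
  finally have "?q * (\<Sum>v\<in>zeros D. qchar (qf C v)) = ?q * ((?q - 1) * (\<Sum>x\<in>UNIV. qchar (- det (C + mat x ** D))))"
    by (simp add: sum_distrib_left mult.assoc)
  then have *: "(\<Sum>v\<in>zeros D. qchar (qf C v)) = (?q - 1) * (\<Sum>x\<in>UNIV. qchar (- det (C + mat x ** D)))"
    using q by simp
  have "(\<Sum>v\<in>zeros D. position C v) = qchar (- det C) * (\<Sum>v\<in>zeros D. qchar (qf C v))"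
    unfolding position_def qchar_mult[OF odd_card] by (simp add: sum_distrib_left)
  also have "\<dots> = (?q - 1) * (\<Sum>x\<in>UNIV. qchar (- det C) * qchar (- det (C + mat x ** D)))"
    unfolding * by (simp add: sum_distrib_left mult.left_commute)
  finally show ?thesis by (simp add: qchar_mult[OF odd_card, symmetric])
qed

end

section \<open>Rational points and lines\<close>

lemma span_singleton_eqD:
  fixes v w :: "'k::field ^ 3"
  assumes "vec.span {v} = vec.span {w}" "v \<noteq> 0"
  obtains c where "c \<noteq> 0" "v = c *s w"
proof -
  have "v \<in> vec.span {w}" unfolding assms(1)[symmetric] by (simp add: vec.span_base)
  then obtain c where c: "v = c *s w" by (auto simp: vec.span_singleton)
  moreover have "c \<noteq> 0" using c assms(2) by auto
  ultimately show ?thesis using that by blast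
qed

lemma span_singleton_scale:
  fixes v :: "'k::field ^ 3"
  assumes "c \<noteq> 0"
  shows "vec.span {c *s v} = vec.span {v}"
  unfolding vec.span_singleton
proof (intro equalityI subsetI)
  fix x assume "x \<in> range (\<lambda>k. k *s (c *s v))"
  then obtain k where "x = (k * c) *s v" by (auto simp: vector_smult_assoc)
  then show "x \<in> range (\<lambda>k. k *s v)" by (rule range_eqI)
next
  fix x assume "x \<in> range (\<lambda>k. k *s v)"
  then obtain k where "x = k *s v" by auto
  then have "x = (k / c) *s (c *s v)" using assms by (simp add: vector_smult_assoc)
  then show "x \<in> range (\<lambda>k. k *s (c *s v))" by (rule range_eqI)
qed

lemma zeros_scale: "c \<noteq> 0 \<Longrightarrow> v \<in> zeros M \<Longrightarrow> c *s v \<in> zeros M"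
  by (simp add: zeros_def qf_scale)

lemma plane_conic_eq: "plane_conic M = (\<lambda>v. vec.span {v}) ` zeros M"
  by (auto simp: plane_conic_def zeros_def qf_def)

lemma dual_conic_eq: "dual_conic M = (\<lambda>l. vec.span {l}) ` tangents M"
  by (auto simp: dual_conic_def tangents_def zeros_def qf_def)

lemma span_in_plane_conic_iff:
  assumes "v \<noteq> 0"
  shows "vec.span {v} \<in> plane_conic M \<longleftrightarrow> v \<in> zeros M"
proof
  assume "vec.span {v} \<in> plane_conic M"
  then obtain w where w: "vec.span {v} = vec.span {w}" "w \<in> zeros M" by (auto simp: plane_conic_eq)
  obtain c where "c \<noteq> 0" "v = c *s w" using span_singleton_eqD[OF w(1) assms] .
  then show "v \<in> zeros M" using zeros_scale w(2) by simp
qed (simp add: plane_conic_eq)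

lemma span_in_dual_conic_iff:
  assumes "l \<noteq> 0"
  shows "vec.span {l} \<in> dual_conic M \<longleftrightarrow> l \<in> tangents M"
proof
  assume "vec.span {l} \<in> dual_conic M"
  then obtain w where w: "vec.span {l} = vec.span {w}" "w \<in> tangents M" by (auto simp: dual_conic_eq)
  obtain c where "c \<noteq> 0" "l = c *s w" using span_singleton_eqD[OF w(1) assms] .
  then show "l \<in> tangents M" using tangents_scale w(2) by simp
qed (simp add: dual_conic_eq)

lemma lies_on_span_iff: "lies_on (vec.span {v}) (vec.span {l}) \<longleftrightarrow> scalar_product v l = 0"
proof
  assume "lies_on (vec.span {v}) (vec.span {l})"
  then have "scalar_product l v = 0" unfolding lies_on_def by (simp add: vec.span_base)
  then show "scalar_product v l = 0" by (simp only: scalar_product_commute)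
next
  assume "scalar_product v l = 0"
  then have "scalar_product l v = 0" by (simp only: scalar_product_commute)
  then show "lies_on (vec.span {v}) (vec.span {l})" by (auto simp: lies_on_def vec.span_singleton)
qed

section \<open>Base change to the algebraic closure\<close>

definition acv :: "'a::field ^ 3 \<Rightarrow> 'a alg_closure ^ 3" where
  "acv v = (\<chi> i. to_ac (v $ i))"

lemma acv_nth [simp]: "acv v $ i = to_ac (v $ i)"
  by (simp add: acv_def)

lemma acv_eq_iff [simp]: "acv v = acv w \<longleftrightarrow> v = w"
  by (simp add: vec_eq_iff)

lemma acv_eq_0_iff [simp]: "acv v = 0 \<longleftrightarrow> v = 0"
  by (simp add: vec_eq_iff)

lemma acv_scale: "acv (c *s v) = to_ac c *s acv v"
  by (simp add: vec_eq_iff)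

lemma scalar_product_acv: "scalar_product (acv v) (acv w) = to_ac (scalar_product v w)"
  by (simp add: scalar_product_3)

lemma to_closure_mult_acv: "map_matrix to_ac M *v acv v = acv (M *v v)" for M :: "'a::field ^ 3 ^ 3"
  by (simp add: vec_eq_iff matrix_vector_mult_3 map_matrix_def)

lemma qf_acv: "qf (map_matrix to_ac M) (acv v) = to_ac (qf M v)" for M :: "'a::field ^ 3 ^ 3"
  by (simp add: qf_def to_closure_mult_acv scalar_product_acv)

lemma det_to_closure: "det (map_matrix to_ac M) = to_ac (det M)" for M :: "'a::field ^ 3 ^ 3"
  by (simp add: det_3 map_matrix_def)

lemma transpose_to_closure:
  fixes M :: "'a::field ^ 3 ^ 3"
  assumes "transpose M = M"
  shows "transpose (map_matrix to_ac M) = map_matrix to_ac M"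
  unfolding vec_eq_iff transpose_def vec_lambda_beta nth_map_matrix
proof (intro allI)
  show "to_ac (M $ j $ i) = to_ac (M $ i $ j)" for i j
    using transpose_eqD[OF assms, of j i] by (rule arg_cong)
qed

lemma zeros_acv_iff: "acv v \<in> zeros (map_matrix to_ac M) \<longleftrightarrow> v \<in> zeros M" for M :: "'a::field ^ 3 ^ 3"
  by (simp add: zeros_def qf_acv)

text \<open>A rational tangent has a rational point of contact, because the inverse of
  \<open>M\<close> maps the line to it.\<close>

lemma tangents_acv_iff:
  fixes M :: "'a::field ^ 3 ^ 3"
  assumes "det M \<noteq> 0"
  shows "acv l \<in> tangents (map_matrix to_ac M) \<longleftrightarrow> l \<in> tangents M"
proof
  assume "acv l \<in> tangents (map_matrix to_ac M)"
  then obtain w where w: "w \<in> zeros (map_matrix to_ac M)" "acv l = map_matrix to_ac M *v w"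
    by (auto simp: tangents_def)
  obtain w' where w': "M *v w' = l" using matrix_vector_mult_surj[OF assms] .
  have "map_matrix to_ac M *v w = map_matrix to_ac M *v acv w'"
    unfolding w(2)[symmetric] to_closure_mult_acv w' ..
  then have "w = acv w'" using matrix_vector_mult_inj[of "map_matrix to_ac M"] assms by (simp add: det_to_closure)
  then have "w' \<in> zeros M" using w(1) by (simp add: zeros_acv_iff)
  then show "l \<in> tangents M" unfolding tangents_def using w' by blast
next
  assume "l \<in> tangents M"
  then obtain w where "w \<in> zeros M" "l = M *v w" by (auto simp: tangents_def)
  then have "acv w \<in> zeros (map_matrix to_ac M)" "acv l = map_matrix to_ac M *v acv w"
    by (simp_all add: zeros_acv_iff to_closure_mult_acv)
  then show "acv l \<in> tangents (map_matrix to_ac M)" unfolding tangents_def by blast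
qed

lemma defined_over_base_iff: "defined_over base_field P \<longleftrightarrow> (\<exists>v. v \<noteq> 0 \<and> P = vec.span {acv v})"
proof
  assume "defined_over base_field P"
  then obtain w where w: "w \<noteq> 0" "\<And>i. w $ i \<in> base_field" "P = vec.span {w}" by (auto simp: defined_over_def)
  define v where "v = (\<chi> i. of_ac (w $ i))"
  have "w = acv v" using w(2) by (simp add: v_def vec_eq_iff to_ac_of_ac)
  then show "\<exists>v. v \<noteq> 0 \<and> P = vec.span {acv v}" using w(1,3) by auto
next
  assume "\<exists>v. v \<noteq> 0 \<and> P = vec.span {acv v}"
  then obtain v where "v \<noteq> 0" "P = vec.span {acv v}" by blast
  then show "defined_over base_field P" unfolding defined_over_def by (intro exI[of _ "acv v"]) simp
qed

text \<open>A rational point has exactly \<open>q - 1\<close> rational representatives: comparing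
  one nonzero coordinate shows that the ratio of two of them lies in the base field.\<close>

lemma card_rational:
  fixes S :: "('a::finite_field alg_closure ^ 3) set set"
  shows "(int CARD('a) - 1) * int (card {P \<in> S. defined_over base_field P})
    = int (card {v :: 'a ^ 3. v \<noteq> 0 \<and> vec.span {acv v} \<in> S})"
proof -
  let ?V = "{v :: 'a ^ 3. v \<noteq> 0 \<and> vec.span {acv v} \<in> S}"
  let ?f = "\<lambda>v :: 'a ^ 3. vec.span {acv v}"
  have image: "{P \<in> S. defined_over base_field P} = ?f ` ?V"
    by (auto simp: defined_over_base_iff)
  have fiber: "card {w \<in> ?V. ?f w = ?f v} = card (UNIV - {0 :: 'a})" if v: "v \<in> ?V" for v
  proof -
    have "{w \<in> ?V. ?f w = ?f v} = (\<lambda>c. c *s v) ` (UNIV - {0})"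
    proof (intro equalityI subsetI)
      fix w assume "w \<in> {w \<in> ?V. ?f w = ?f v}"
      then have w: "w \<noteq> 0" "vec.span {acv w} = vec.span {acv v}" by simp_all
      then obtain c where c: "acv w = c *s acv v" using span_singleton_eqD[OF w(2)] by auto
      obtain i where i: "v $ i \<noteq> 0" using v by (auto simp: vec_eq_iff)
      have "to_ac (w $ i) = c * to_ac (v $ i)" using arg_cong[OF c, of "\<lambda>x. x $ i"] by simp
      then have "c = to_ac (w $ i / v $ i)" using i by (simp add: eq_divide_eq)
      then have "acv w = acv ((w $ i / v $ i) *s v)" using c by (simp only: acv_scale)
      then have "w = (w $ i / v $ i) *s v" by (simp only: acv_eq_iff)
      moreover have "w $ i / v $ i \<noteq> 0" using calculation w(1) by auto
      ultimately show "w \<in> (\<lambda>c. c *s v) ` (UNIV - {0})" by (intro image_eqI[of _ _ "w $ i / v $ i"]) simp_all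
    next
      fix w assume "w \<in> (\<lambda>c. c *s v) ` (UNIV - {0})"
      then obtain c where "c \<noteq> 0" "w = c *s v" by auto
      then show "w \<in> {w \<in> ?V. ?f w = ?f v}" using v by (simp add: acv_scale span_singleton_scale)
    qed
    moreover have "inj_on (\<lambda>c. c *s v) (UNIV - {0})" using v by (auto intro!: inj_onI)
    ultimately show ?thesis by (simp add: card_image)
  qed
  have "card ?V = (\<Sum>v\<in>?V. 1)" by simp
  also have "\<dots> = (\<Sum>P\<in>?f ` ?V. \<Sum>v\<in>{v \<in> ?V. ?f v = P}. 1)"
    by (rule sum.image_gen) simp
  also have "\<dots> = (\<Sum>P\<in>?f ` ?V. card (UNIV - {0 :: 'a}))"
    by (rule sum.cong[OF refl]) (use fiber in auto)
  also have "\<dots> = card (UNIV - {0 :: 'a}) * card (?f ` ?V)" by (simp add: mult.commute)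
  finally have "int (card ?V) = int (card (UNIV - {0 :: 'a})) * int (card (?f ` ?V))" by simp
  moreover have "int (card (UNIV - {0 :: 'a})) = int CARD('a) - 1"
    using finite_UNIV_card_ge_0[where 'a = 'a] by (simp add: card_Diff_singleton of_nat_diff)
  ultimately show ?thesis unfolding image by simp
qed

section \<open>The two tangents through a point\<close>

lemma scalar_product_diff [simp]:
  fixes u v w :: "'k::field ^ 3"
  shows "scalar_product u (v - w) = scalar_product u v - scalar_product u w"
    "scalar_product u (- w) = - scalar_product u w"
  by (simp_all add: scalar_product_3 algebra_simps)

text \<open>A square root \<open>e\<close> of the quarter discriminant splits the form, and
  \<open>e \<noteq> 0\<close> keeps the two linear factors independent.\<close>

lemma binary_form_factors:
  fixes \<alpha> \<beta> \<gamma> :: "'k::alg_closed_field"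
  assumes two: "(2 :: 'k) \<noteq> 0" and disc: "\<beta>\<^sup>2 - \<alpha> * \<gamma> \<noteq> 0"
  obtains p1 r1 p2 r2 where "p1 * r2 - p2 * r1 \<noteq> 0"
    "\<And>s r. \<alpha> * s\<^sup>2 + 2 * \<beta> * s * r + \<gamma> * r\<^sup>2 = (p1 * s + r1 * r) * (p2 * s + r2 * r)"
proof (cases "\<alpha> = 0")
  case True
  then have "\<beta> \<noteq> 0" using disc by auto
  \<comment> \<open>Here the form is \<open>r * (2 * \<beta> * s + \<gamma> * r)\<close>.\<close>
  then show ?thesis
    using that[of 0 \<gamma> "2 * \<beta>" 1] two True by (simp add: power2_eq_square algebra_simps)
next
  case False
  obtain e where e: "e\<^sup>2 = \<beta>\<^sup>2 - \<alpha> * \<gamma>" using nth_root_exists[of 2 "\<beta>\<^sup>2 - \<alpha> * \<gamma>"] by auto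
  then have "e \<noteq> 0" using disc by auto
  define x where "x = (\<beta> - e) / \<alpha>"
  have x: "\<alpha> * x = \<beta> - e" using False by (simp add: x_def)
  have "\<alpha> * (x * (\<beta> + e)) = \<alpha> * \<gamma>" using e x by Groebner_Basis.algebra
  then have x2: "x * (\<beta> + e) = \<gamma>" using False by simp
  have 1: "1 * (\<beta> + e) - \<alpha> * x = 2 * e" unfolding x by simp
  show ?thesis
  proof (rule that[of 1 "\<beta> + e" \<alpha> x])
    show "1 * (\<beta> + e) - \<alpha> * x \<noteq> 0" unfolding 1 using two \<open>e \<noteq> 0\<close> by simp
    show "\<alpha> * s\<^sup>2 + 2 * \<beta> * s * r + \<gamma> * r\<^sup>2 = (1 * s + x * r) * (\<alpha> * s + (\<beta> + e) * r)" for s r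
      using x x2 by Groebner_Basis.algebra
  qed
qed

text \<open>The points of contact lie on the polar plane of \<open>v\<close>. As \<open>v\<close> is
  off the conic, the form restricted to this plane has nonzero discriminant, hence two zeros up to
  scaling.\<close>

lemma two_tangents:
  fixes M :: "'k::alg_closed_field ^ 3 ^ 3"
  assumes sym: "transpose M = M" and det: "det M \<noteq> 0" and two: "(2 :: 'k) \<noteq> 0" and v: "qf M v \<noteq> 0"
  obtains L L' where "L \<noteq> L'" "{L \<in> dual_conic M. lies_on (vec.span {v}) L} = {L, L'}"
proof -
  have "v \<noteq> 0" using v by auto
  then have u: "M *v v \<noteq> 0" using matrix_vector_mult_eq_0_iff[OF det] by simp
  obtain a b k where k: "k \<noteq> 0" "crs a b = k *s (M *v v)" using ex_plane_basis[OF u] .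
  have ab: "crs a b \<noteq> 0" using k u by simp
  have perp: "scalar_product v (M *v w) = 0 \<longleftrightarrow> scalar_product (crs a b) w = 0" for w
    unfolding scalar_product_matrix[of v] sym k(2) using k(1) by simp
  have "(scalar_product a (M *v b))\<^sup>2 - qf M a * qf M b \<noteq> 0"
    unfolding plane_discriminant[OF sym] k(2) adjugate_qf_scale adjugate_qf_image[OF sym]
    using k(1) det v by simp
  then obtain p1 r1 p2 r2 where pr: "p1 * r2 - p2 * r1 \<noteq> 0"
    and form: "\<And>s r. qf M a * s\<^sup>2 + 2 * scalar_product a (M *v b) * s * r + qf M b * r\<^sup>2
      = (p1 * s + r1 * r) * (p2 * s + r2 * r)"
    using binary_form_factors[OF two] by metis
  \<comment> \<open>The kernel of the linear factor with coefficients \<open>p\<close>,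
    \<open>r\<close> is spanned by the coordinates \<open>(r, - p)\<close>; \<open>w p r\<close> is
    the corresponding vector of the plane.\<close>
  define w where "w p r = r *s a + (- p) *s b" for p r
  define L where "L p r = vec.span {M *v w p r}" for p r
  have qfw: "qf M (s *s a + r *s b) = (p1 * s + r1 * r) * (p2 * s + r2 * r)" for s r
    unfolding qf_combination[OF sym] form ..
  have w0: "w p r \<noteq> 0" if "p \<noteq> 0 \<or> r \<noteq> 0" for p r
    using plane_coordinates_unique[OF ab, of r "- p" 0 0] that by (auto simp: w_def)
  have L_in: "L p r \<in> {L \<in> dual_conic M. lies_on (vec.span {v}) L}"
    if "p \<noteq> 0 \<or> r \<noteq> 0" "qf M (w p r) = 0" for p r
  proof -
    have "w p r \<in> zeros M" using w0[OF that(1)] that(2) by (simp add: zeros_def)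
    moreover have "scalar_product v (M *v w p r) = 0" unfolding perp w_def by simp
    ultimately show ?thesis by (auto simp: L_def dual_conic_eq tangents_def lies_on_span_iff)
  qed
  have nz: "p1 \<noteq> 0 \<or> r1 \<noteq> 0" "p2 \<noteq> 0 \<or> r2 \<noteq> 0" using pr by auto
  have 1: "L p1 r1 \<in> {L \<in> dual_conic M. lies_on (vec.span {v}) L}"
    by (rule L_in[OF nz(1)]) (simp only: w_def qfw, simp)
  have 2: "L p2 r2 \<in> {L \<in> dual_conic M. lies_on (vec.span {v}) L}"
    by (rule L_in[OF nz(2)]) (simp only: w_def qfw, simp)
  have line: "vec.span {M *v (s *s a + r *s b)} = L p' r'"
    if z: "p' * s + r' * r = 0" and n: "p' \<noteq> 0 \<or> r' \<noteq> 0" and sr: "s \<noteq> 0 \<or> r \<noteq> 0" for s r p' r'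
  proof -
    obtain c where c: "s = c * r'" "r = c * (- p')"
    proof (cases "r' = 0")
      case True
      then have "p' \<noteq> 0" "s = 0" using n z by auto
      then show ?thesis using that[of "- r / p'"] True by simp
    next
      case False
      have "r' * r = - (p' * s)" using z by (simp add: eq_neg_iff_add_eq_0 add.commute)
      then have "r' * r = r' * (s / r' * (- p'))" using False by (simp add: mult.commute)
      then have "r = s / r' * (- p')" using False by (simp only: mult_cancel_left simp_thms)
      then show ?thesis using that[of "s / r'"] False by simp
    qed
    then have "c \<noteq> 0" using sr by auto
    have "s *s a + r *s b = c *s w p' r'"
      by (simp add: c w_def vec_eq_iff algebra_simps)
    then have "M *v (s *s a + r *s b) = c *s (M *v w p' r')" by (simp only: vector_scalar_commute)
    then show ?thesis unfolding L_def by (simp only: span_singleton_scale[OF \<open>c \<noteq> 0\<close>])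
  qed
  have "{L \<in> dual_conic M. lies_on (vec.span {v}) L} \<subseteq> {L p1 r1, L p2 r2}"
  proof
    fix N assume "N \<in> {L \<in> dual_conic M. lies_on (vec.span {v}) L}"
    then obtain x where x: "N = vec.span {M *v x}" "x \<in> zeros M" "scalar_product v (M *v x) = 0"
      by (auto simp: dual_conic_eq tangents_def lies_on_span_iff)
    obtain s r where sr: "x = s *s a + r *s b" using in_plane[OF ab] x(3) unfolding perp by blast
    have "s \<noteq> 0 \<or> r \<noteq> 0" using x(2) unfolding sr zeros_def by auto
    moreover have "p1 * s + r1 * r = 0 \<or> p2 * s + r2 * r = 0"
      using x(2) unfolding sr zeros_def by (simp add: qfw)
    ultimately show "N \<in> {L p1 r1, L p2 r2}" using line nz unfolding x(1) sr by blast
  qed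
  moreover have "L p1 r1 \<noteq> L p2 r2"
  proof
    assume "L p1 r1 = L p2 r2"
    moreover have "M *v w p1 r1 \<noteq> 0" using w0[OF nz(1)] matrix_vector_mult_eq_0_iff[OF det] by simp
    ultimately obtain c where "M *v w p1 r1 = c *s (M *v w p2 r2)"
      unfolding L_def by (rule span_singleton_eqD)
    then have "M *v w p1 r1 = M *v (c *s w p2 r2)" by (simp only: vector_scalar_commute)
    then have "w p1 r1 = c *s w p2 r2" by (rule matrix_vector_mult_inj[OF det])
    then have "r1 *s a + (- p1) *s b = (c * r2) *s a + (- (c * p2)) *s b"
      by (simp add: w_def vec_eq_iff algebra_simps)
    from plane_coordinates_unique[OF ab this] have "r1 = c * r2" "p1 = c * p2" by simp_all
    then show False using pr by simp
  qed
  ultimately show ?thesis using that[of "L p1 r1" "L p2 r2"] 1 2 by blast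
qed

section \<open>The Frobenius action\<close>

definition frob :: "'a::finite_field alg_closure ^ 3 \<Rightarrow> 'a alg_closure ^ 3" where
  "frob v = (\<chi> i. (v $ i) ^ CARD('a))"

lemma frob_nth [simp]: "frob v $ i = (v $ i) ^ CARD('a)" for v :: "'a::finite_field alg_closure ^ 3"
  by (simp add: frob_def)

lemma frob_scale: "frob (c *s v) = c ^ CARD('a) *s frob v" for v :: "'a::finite_field alg_closure ^ 3"
  by (simp add: vec_eq_iff power_mult_distrib)

lemma to_ac_power_card [simp]: "to_ac x ^ CARD('a) = to_ac x" for x :: "'a::finite_field"
  by (simp only: to_ac_power[symmetric] finite_field_power_card_eq_same)

lemma power_card_eq_0_iff [simp]: "x ^ CARD('a::finite_field) = 0 \<longleftrightarrow> x = 0" for x :: "'b::field"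
  using finite_UNIV_card_ge_0[where 'a = 'a] by simp

lemma frob_matrix: "frob (map_matrix to_ac M *v w) = map_matrix to_ac M *v frob w"
  for M :: "'a::finite_field ^ 3 ^ 3"
  by (simp add: vec_eq_iff matrix_vector_mult_3 power_card_add power_mult_distrib map_matrix_def)

lemma frob_scalar_product: "scalar_product (frob v) (frob w) = scalar_product v w ^ CARD('a)"
  for v :: "'a::finite_field alg_closure ^ 3"
  by (simp add: scalar_product_3 power_card_add power_mult_distrib)

lemma frob_acv: "frob (acv v) = acv v" for v :: "'a::finite_field ^ 3"
  by (simp add: vec_eq_iff)

lemma frob_eq_0_iff [simp]: "frob v = 0 \<longleftrightarrow> v = 0" for v :: "'a::finite_field alg_closure ^ 3"
  by (simp add: vec_eq_iff)

text \<open>In the closure every scalar is a \<open>q\<close>-th power, so the multiples of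
  \<open>v\<close> are mapped onto all multiples of \<open>frob v\<close>.\<close>

lemma galois_conj_span: "galois_conj (vec.span {v}) = vec.span {frob v}"
  for v :: "'a::finite_field alg_closure ^ 3"
proof -
  have surj: "\<exists>c. d = c ^ CARD('a)" for d :: "'a alg_closure"
    using nth_root_exists[of "CARD('a)" d] finite_UNIV_card_ge_0[where 'a = 'a] by auto
  have "galois_conj (vec.span {v}) = frob ` range (\<lambda>c. c *s v)"
    unfolding galois_conj_def vec.span_singleton by (simp add: frob_def)
  also have "\<dots> = range (\<lambda>c. c ^ CARD('a) *s frob v)"
    by (simp add: image_image frob_scale)
  also have "\<dots> = range (\<lambda>d. d *s frob v)"
  proof (intro equalityI subsetI)
    fix x assume "x \<in> range (\<lambda>d. d *s frob v)"
    then obtain d where d: "x = d *s frob v" by auto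
    obtain c where "d = c ^ CARD('a)" using surj by blast
    then show "x \<in> range (\<lambda>c. c ^ CARD('a) *s frob v)" using d by auto
  qed auto
  finally show ?thesis by (simp add: vec.span_singleton)
qed

lemma normalized_coordinates:
  fixes v :: "'k::field ^ 3"
  assumes "v \<noteq> 0"
  obtains w i where "w \<noteq> 0" "w $ i = 1" "vec.span {v} = vec.span {w}"
proof -
  obtain i where i: "v $ i \<noteq> 0" using assms by (auto simp: vec_eq_iff)
  show ?thesis
  proof (rule that[of "(1 / v $ i) *s v" i])
    show "vec.span {v} = vec.span {(1 / v $ i) *s v}" using i by (simp add: span_singleton_scale)
  qed (use i assms in auto)
qed

text \<open>A representative with one coordinate equal to 1 is fixed by Frobenius exactly and not
  just up to a scalar, so its coordinates lie in the base field.\<close>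

lemma galois_conj_fixed_imp_rational:
  fixes v :: "'a::finite_field alg_closure ^ 3"
  assumes v: "v \<noteq> 0" and fixed: "galois_conj (vec.span {v}) = vec.span {v}"
  shows "defined_over base_field (vec.span {v})"
proof -
  obtain w i where w: "w \<noteq> 0" "w $ i = 1" "vec.span {v} = vec.span {w}" using normalized_coordinates[OF v] .
  have eq: "vec.span {frob w} = vec.span {w}" using fixed unfolding w(3) galois_conj_span .
  have "frob w \<noteq> 0" using w(1) by simp
  then obtain c where c: "frob w = c *s w" by (rule span_singleton_eqD[OF eq])
  have "c = 1" using arg_cong[OF c, of "\<lambda>x. x $ i"] w(2) by simp
  then have "(w $ j) ^ CARD('a) = w $ j" for j using arg_cong[OF c, of "\<lambda>x. x $ j"] by simp
  then show ?thesis unfolding defined_over_def w(3) power_card_eq_self_iff using w(1) by blast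
qed

lemma galois_conj_order_2_imp_quadratic:
  fixes v :: "'a::finite_field alg_closure ^ 3"
  assumes v: "v \<noteq> 0" and fixed: "galois_conj (galois_conj (vec.span {v})) = vec.span {v}"
  shows "defined_over quadratic_ext (vec.span {v})"
proof -
  obtain w i where w: "w \<noteq> 0" "w $ i = 1" "vec.span {v} = vec.span {w}" using normalized_coordinates[OF v] .
  have eq: "vec.span {frob (frob w)} = vec.span {w}" using fixed unfolding w(3) galois_conj_span .
  have "frob (frob w) \<noteq> 0" using w(1) by simp
  then obtain c where c: "frob (frob w) = c *s w" by (rule span_singleton_eqD[OF eq])
  have "c = 1" using arg_cong[OF c, of "\<lambda>x. x $ i"] w(2) by simp
  then have "((w $ j) ^ CARD('a)) ^ CARD('a) = w $ j" for j using arg_cong[OF c, of "\<lambda>x. x $ j"] by simp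
  then have "w $ j \<in> quadratic_ext" for j
    by (simp add: quadratic_ext_def power2_eq_square power_mult)
  then show ?thesis unfolding defined_over_def w(3) using w(1) by blast
qed

lemma galois_conj_tangents_through:
  fixes C :: "'a::finite_field ^ 3 ^ 3"
  assumes det: "det C \<noteq> 0" and L: "L \<in> tangents_through C (vec.span {acv v})"
  shows "galois_conj L \<in> tangents_through C (vec.span {acv v})"
proof -
  let ?C = "map_matrix to_ac C"
  obtain w where w: "w \<in> zeros ?C" "L = vec.span {?C *v w}" "scalar_product (acv v) (?C *v w) = 0"
    using L by (auto simp: tangents_through_def dual_conic_eq tangents_def lies_on_span_iff)
  have "galois_conj L = vec.span {?C *v frob w}" unfolding w(2) galois_conj_span frob_matrix ..
  moreover have "qf ?C (frob w) = qf ?C w ^ CARD('a)"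
    unfolding qf_def frob_matrix[symmetric] frob_scalar_product ..
  then have "frob w \<in> zeros ?C" using w(1) by (simp add: zeros_def)
  moreover have "scalar_product (acv v) (?C *v frob w) = scalar_product (acv v) (?C *v w) ^ CARD('a)"
    unfolding frob_scalar_product[symmetric] frob_matrix frob_acv ..
  then have "scalar_product (acv v) (?C *v frob w) = 0" using w(3) by simp
  ultimately show ?thesis by (auto simp: tangents_through_def dual_conic_eq tangents_def lies_on_span_iff)
qed

context
  assumes odd_card: "odd CARD('a::finite_field)"
begin

lemma two_neq_zero_closure: "(2 :: 'a alg_closure) \<noteq> 0"
proof -
  have "to_ac (2 :: 'a) \<noteq> 0" using two_neq_zero[OF odd_card] by (simp only: to_ac_eq_0_iff not_False_eq_True)
  then show ?thesis by simp
qed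

lemma card_rational_tangents_through:
  fixes C :: "'a ^ 3 ^ 3"
  assumes C: "transpose C = C" "det C \<noteq> 0" and v: "v \<noteq> 0"
  shows "int (card {L \<in> tangents_through C (vec.span {acv v}). defined_over base_field L}) = 1 + position C v"
proof -
  have *: "vec.span {acv l} \<in> tangents_through C (vec.span {acv v}) \<longleftrightarrow> l \<in> tangents C \<and> scalar_product v l = 0"
    if "l \<noteq> 0" for l :: "'a ^ 3"
    using that by (simp add: tangents_through_def span_in_dual_conic_iff tangents_acv_iff[OF C(2)] lies_on_span_iff scalar_product_acv)
  have "{l. l \<noteq> 0 \<and> vec.span {acv l} \<in> tangents_through C (vec.span {acv v})} = {l \<in> tangents C. scalar_product v l = 0}"
  proof (rule Collect_cong)
    show "l \<noteq> 0 \<and> vec.span {acv l} \<in> tangents_through C (vec.span {acv v}) \<longleftrightarrow> l \<in> tangents C \<and> scalar_product v l = 0" for l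
      using tangents_nonzero[OF C(2), of l] *[of l] by (cases "l = 0") auto
  qed
  then have "(int CARD('a) - 1) * int (card {L \<in> tangents_through C (vec.span {acv v}). defined_over base_field L})
      = (int CARD('a) - 1) * (1 + position C v)"
    unfolding card_rational card_tangents_through[OF odd_card C v, symmetric] by simp
  then show ?thesis using card_ge_3[OF odd_card] by simp
qed

text \<open>Off the conic there are two tangents over the closure, and
  \<open>1 + position C v\<close> of them are rational. Since \<open>position C v\<close> is then
  nonzero, either both or none are.\<close>

lemma external_internal_iff:
  fixes C :: "'a ^ 3 ^ 3"
  assumes C: "transpose C = C" "det C \<noteq> 0" and v: "v \<noteq> 0"
  shows "external C (vec.span {acv v}) \<longleftrightarrow> position C v = 1"
    and "internal C (vec.span {acv v}) \<longleftrightarrow> position C v = -1"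
proof -
  let ?P = "vec.span {acv v}"
  let ?T = "tangents_through C ?P"
  let ?R = "{L \<in> ?T. defined_over base_field L}"
  have P: "defined_over base_field ?P" using v by (auto simp: defined_over_base_iff)
  have P_iff: "?P \<notin> plane_conic (to_closure C) \<longleftrightarrow> qf C v \<noteq> 0"
    using v by (simp add: span_in_plane_conic_iff zeros_acv_iff) (simp add: zeros_def)
  have card: "int (card ?R) = 1 + position C v" by (rule card_rational_tangents_through[OF C v])
  have pair: "\<exists>L L'. L \<noteq> L' \<and> ?T = {L, L'}" if "qf C v \<noteq> 0"
  proof -
    have "qf (to_closure C) (acv v) \<noteq> 0" "det (to_closure C) \<noteq> 0"
      using that C(2) by (simp_all add: qf_acv det_to_closure)
    from two_tangents[OF transpose_to_closure[OF C(1)] this(2) two_neq_zero_closure this(1)]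
    obtain L L' where "L \<noteq> L'" "{L \<in> dual_conic (to_closure C). lies_on ?P L} = {L, L'}" .
    then show ?thesis by (intro exI conjI) (assumption, simp only: tangents_through_def)
  qed
  have position: "position C v \<noteq> 0 \<longleftrightarrow> qf C v \<noteq> 0" using C(2) by (simp add: position_def)
  show "external C ?P \<longleftrightarrow> position C v = 1"
  proof
    assume "external C ?P"
    then obtain L L' where L: "L \<noteq> L'" "?T = {L, L'}" "defined_over base_field L" "defined_over base_field L'"
      unfolding external_def by (elim conjE exE)
    then have "?R = {L, L'}" unfolding L(2) by auto
    moreover have "card {L, L'} = 2" using L(1) by simp
    ultimately have "card ?R = 2" by simp
    then show "position C v = 1" using card by simp
  next
    assume pos: "position C v = 1"
    then have qf: "qf C v \<noteq> 0" using position by simp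
    then obtain L L' where LL: "L \<noteq> L'" "?T = {L, L'}" using pair[OF qf] by (elim exE conjE)
    have "card ?R = card ?T" using card pos LL by simp
    moreover have "finite ?T" using LL by simp
    ultimately have "?R = ?T" by (intro card_subset_eq) auto
    moreover have LT: "L \<in> ?T" "L' \<in> ?T" using LL by simp_all
    ultimately have "L \<in> ?R" "L' \<in> ?R" by simp_all
    then have R: "defined_over base_field L" "defined_over base_field L'" by simp_all
    have "L \<noteq> L' \<and> ?T = {L, L'} \<and> defined_over base_field L \<and> defined_over base_field L'"
      by (intro conjI LL R)
    moreover have "?P \<notin> plane_conic (to_closure C)" unfolding P_iff by (rule qf)
    ultimately show "external C ?P" unfolding external_def by (intro conjI P) (assumption, intro exI)
  qed
  show "internal C ?P \<longleftrightarrow> position C v = -1"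
  proof
    assume "internal C ?P"
    then obtain L L' where L: "?T = {L, L'}" "\<not> defined_over base_field L" "\<not> defined_over base_field L'"
      unfolding internal_def by (elim conjE exE)
    then have R: "?R = {}" unfolding L(1) by auto
    show "position C v = -1" using card unfolding R by simp
  next
    assume pos: "position C v = -1"
    then have qf: "qf C v \<noteq> 0" using position by simp
    then obtain L L' where LL: "L \<noteq> L'" "?T = {L, L'}" using pair[OF qf] by (elim exE conjE)
    have "finite ?R" using LL by simp
    then have "?R = {}" using card pos by simp
    then have irrational: "\<not> defined_over base_field N" if "N \<in> ?T" for N using that \<open>?R = {}\<close> by simp
    have span: "\<exists>l. l \<noteq> 0 \<and> N = vec.span {l}" if "N \<in> ?T" for N
      using that tangents_nonzero[of "to_closure C"] C(2)
      by (auto simp: tangents_through_def dual_conic_eq det_to_closure)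
    have moved: "galois_conj N \<noteq> N" if NT: "N \<in> ?T" for N
    proof -
      obtain l where "l \<noteq> 0" "N = vec.span {l}" using span[OF NT] by blast
      then show ?thesis using galois_conj_fixed_imp_rational[of l] irrational[OF NT] by auto
    qed
    have conj: "galois_conj N \<in> ?T" if "N \<in> ?T" for N
      by (rule galois_conj_tangents_through[OF C(2) that])
    \<comment> \<open>Frobenius permutes the two tangents and fixes neither, as a fixed one would be
      rational; so it swaps them and its square fixes both.\<close>
    have swap: "galois_conj L = L'" "galois_conj L' = L"
      using conj[of L] conj[of L'] moved[of L] moved[of L'] LL by auto
    have quadratic: "defined_over quadratic_ext N" if NT: "N \<in> ?T" for N
    proof -
      have "galois_conj (galois_conj N) = N" using NT swap unfolding LL(2) by auto
      moreover obtain l where "l \<noteq> 0" "N = vec.span {l}" using span[OF NT] by blast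
      ultimately show ?thesis using galois_conj_order_2_imp_quadratic[of l] by simp
    qed
    have LT: "L \<in> ?T" "L' \<in> ?T" using LL by simp_all
    have "L \<noteq> L' \<and> ?T = {L, L'} \<and> L' = galois_conj L \<and> defined_over quadratic_ext L \<and> defined_over quadratic_ext L' \<and>
        \<not> defined_over base_field L \<and> \<not> defined_over base_field L'"
      by (intro conjI LL swap(1)[symmetric] quadratic LT irrational)
    moreover have "?P \<notin> plane_conic (to_closure C)" unfolding P_iff by (rule qf)
    ultimately show "internal C ?P" unfolding internal_def by (intro conjI P) (assumption, intro exI)
  qed
qed

lemma card_positions:
  fixes C D :: "'a ^ 3 ^ 3"
  assumes rational: "\<And>P. p P \<Longrightarrow> defined_over base_field P"
    and iff: "\<And>v :: 'a ^ 3. v \<noteq> 0 \<Longrightarrow> p (vec.span {acv v}) \<longleftrightarrow> position C v = i \<and> position D v = j"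
  shows "(int CARD('a) - 1) * int (card {P. p P}) = int (card {v \<in> UNIV - {0}. position C v = i \<and> position D v = j})"
proof -
  have "{P. p P} = {P \<in> {P. p P}. defined_over base_field P}" using rational by auto
  then have "int (card {P. p P}) = int (card {P \<in> {P. p P}. defined_over base_field P})" by simp
  moreover have "{v :: 'a ^ 3. v \<noteq> 0 \<and> vec.span {acv v} \<in> {P. p P}} = {v \<in> UNIV - {0}. position C v = i \<and> position D v = j}"
    using iff by auto
  ultimately show ?thesis using card_rational[of "{P. p P}"] by simp
qed

end

section \<open>Four common points\<close>

text \<open>In a linear relation both coefficients are nonzero, and the vanishing of the form at
  \<open>z\<close> would make \<open>x\<close> and \<open>y\<close> orthogonal for \<open>M\<close>,
  hence their span isotropic.\<close>

lemma three_points_independent: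
  fixes M :: "'k::field ^ 3 ^ 3"
  assumes sym: "transpose M = M" and det: "det M \<noteq> 0" and two: "(2 :: 'k) \<noteq> 0"
    and zero: "x \<in> zeros M" "y \<in> zeros M" "z \<in> zeros M"
    and distinct: "crs x y \<noteq> 0" "crs x z \<noteq> 0" "crs y z \<noteq> 0"
  shows "scalar_product (crs x y) z \<noteq> 0"
proof
  assume "scalar_product (crs x y) z = 0"
  then obtain s r where z: "z = s *s x + r *s y" using in_plane[OF distinct(1)] by blast
  have qf: "qf M x = 0" "qf M y = 0" "qf M z = 0" using zero by (simp_all add: zeros_def)
  have s: "s \<noteq> 0" using distinct(3) unfolding z by auto
  have r: "r \<noteq> 0" using distinct(2) unfolding z by auto
  have "2 * scalar_product x (M *v y) * s * r = 0"
    using qf(3) unfolding z qf_combination[OF sym] qf(1,2) by simp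
  then have "scalar_product x (M *v y) = 0" using s r two by simp
  then show False using no_isotropic_plane[OF sym det distinct(1) qf(1) _ qf(2)] by simp
qed

definition columns :: "'k::field ^ 3 \<Rightarrow> 'k ^ 3 \<Rightarrow> 'k ^ 3 \<Rightarrow> 'k ^ 3 ^ 3" where
  "columns p1 p2 p3 = (\<chi> i j. if j = 1 then p1 $ i else if j = 2 then p2 $ i else p3 $ i)"

lemma columns_mult: "columns p1 p2 p3 *v n = n $ 1 *s p1 + n $ 2 *s p2 + n $ 3 *s p3"
  by (simp add: vec_eq_iff matrix_vector_mult_3 columns_def mult.commute)

lemma det_columns: "det (columns p1 p2 p3) = scalar_product (crs p1 p2) p3"
  by (simp add: det_3 columns_def scalar_product_3 algebra_simps)

definition off_diagonal :: "'k::field ^ 3 ^ 3 \<Rightarrow> 'k ^ 3" where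
  "off_diagonal M = vector [M $ 2 $ 3, M $ 1 $ 3, M $ 1 $ 2]"

text \<open>The standard quadratic Cremona map. Under it conics through the three coordinate points
  become lines, with coefficients \<open>off_diagonal\<close> up to the factor 2.\<close>

definition pair_products :: "'k::field ^ 3 \<Rightarrow> 'k ^ 3" where
  "pair_products n = vector [n $ 2 * n $ 3, n $ 1 * n $ 3, n $ 1 * n $ 2]"

lemma off_diagonal_nth [simp]:
  "off_diagonal M $ 1 = M $ 2 $ 3" "off_diagonal M $ 2 = M $ 1 $ 3" "off_diagonal M $ 3 = M $ 1 $ 2"
  by (simp_all add: off_diagonal_def vector_3)

lemma pair_products_nth [simp]:
  "pair_products n $ 1 = n $ 2 * n $ 3" "pair_products n $ 2 = n $ 1 * n $ 3" "pair_products n $ 3 = n $ 1 * n $ 2"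
  by (simp_all add: pair_products_def vector_3)

lemma qf_zero_diagonal:
  assumes "transpose M = M" "M $ 1 $ 1 = 0" "M $ 2 $ 2 = 0" "M $ 3 $ 3 = 0"
  shows "qf M n = 2 * scalar_product (off_diagonal M) (pair_products n)"
  unfolding qf_3[OF assms(1)] assms(2-4) scalar_product_3 off_diagonal_nth pair_products_nth
  by Groebner_Basis.algebra

lemma det_zero_diagonal:
  assumes "transpose M = M" "M $ 1 $ 1 = 0" "M $ 2 $ 2 = 0" "M $ 3 $ 3 = 0"
  shows "det M = 2 * off_diagonal M $ 1 * off_diagonal M $ 2 * off_diagonal M $ 3"
  unfolding det_sym_3[OF assms(1)] assms(2-4) off_diagonal_nth by Groebner_Basis.algebra

text \<open>In coordinates in which three common points of two conics are the unit vectors, both matrices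
  have zero diagonal; \<open>m\<close> is the fourth common point.\<close>

locale four_points =
  fixes C D :: "'k::alg_closed_field ^ 3 ^ 3" and p1 p2 p3 p4 :: "'k ^ 3"
  assumes two: "(2 :: 'k) \<noteq> 0"
    and C: "transpose C = C" "det C \<noteq> 0" and D: "transpose D = D" "det D \<noteq> 0"
    and pC: "p1 \<in> zeros C" "p2 \<in> zeros C" "p3 \<in> zeros C" "p4 \<in> zeros C"
    and pD: "p1 \<in> zeros D" "p2 \<in> zeros D" "p3 \<in> zeros D" "p4 \<in> zeros D"
    and distinct: "crs p1 p2 \<noteq> 0" "crs p1 p3 \<noteq> 0" "crs p2 p3 \<noteq> 0"
      "crs p1 p4 \<noteq> 0" "crs p2 p4 \<noteq> 0" "crs p3 p4 \<noteq> 0"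
begin

definition "S = columns p1 p2 p3"
definition "C' = transpose S ** C ** S"
definition "D' = transpose S ** D ** S"
definition "m = (SOME n. S *v n = p4)"

lemma det_S: "det S \<noteq> 0"
  unfolding S_def det_columns by (rule three_points_independent[OF C two pC(1,2,3) distinct(1,2,3)])

lemma S_m: "S *v m = p4"
proof -
  obtain n where "S *v n = p4" using matrix_vector_mult_surj[OF det_S] .
  then show ?thesis unfolding m_def by (rule someI)
qed

lemma S_axis: "S *v axis 1 1 = p1" "S *v axis 2 1 = p2" "S *v axis 3 1 = p3"
  by (simp_all add: S_def columns_mult axis_def)

text \<open>Each coordinate of \<open>m\<close> is a ratio of determinants, the upper one formed
  from the fourth point and two of the others; three points of a smooth conic are never
  collinear.\<close>

lemma m_nonzero: "m $ 1 \<noteq> 0" "m $ 2 \<noteq> 0" "m $ 3 \<noteq> 0"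
proof -
  have S_eq: "S *v n = n $ 1 *s p1 + n $ 2 *s p2 + n $ 3 *s p3" for n
    unfolding S_def by (rule columns_mult)
  have "scalar_product (crs p2 p3) (S *v n) = n $ 1 * scalar_product (crs p2 p3) p1"
    "scalar_product (crs p1 p3) (S *v n) = n $ 2 * scalar_product (crs p1 p3) p2"
    "scalar_product (crs p1 p2) (S *v n) = n $ 3 * scalar_product (crs p1 p2) p3" for n
    unfolding S_eq by simp_all
  from this[of m] have "scalar_product (crs p2 p3) p4 = m $ 1 * scalar_product (crs p2 p3) p1"
    "scalar_product (crs p1 p3) p4 = m $ 2 * scalar_product (crs p1 p3) p2"
    "scalar_product (crs p1 p2) p4 = m $ 3 * scalar_product (crs p1 p2) p3"
    unfolding S_m by simp_all
  moreover have "scalar_product (crs p2 p3) p4 \<noteq> 0"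
    by (rule three_points_independent[OF C two pC(2,3,4) distinct(3,5,6)])
  moreover have "scalar_product (crs p1 p3) p4 \<noteq> 0"
    by (rule three_points_independent[OF C two pC(1,3,4) distinct(2,4,6)])
  moreover have "scalar_product (crs p1 p2) p4 \<noteq> 0"
    by (rule three_points_independent[OF C two pC(1,2,4) distinct(1,4,5)])
  ultimately show "m $ 1 \<noteq> 0" "m $ 2 \<noteq> 0" "m $ 3 \<noteq> 0" by auto
qed

lemma qf_C': "qf C' n = qf C (S *v n)" and qf_D': "qf D' n = qf D (S *v n)"
  unfolding C'_def D'_def by (rule qf_congruence)+

lemma sym': "transpose C' = C'" "transpose D' = D'"
  unfolding C'_def D'_def by (rule transpose_congruence, rule C D)+

lemma diagonal: "C' $ 1 $ 1 = 0" "C' $ 2 $ 2 = 0" "C' $ 3 $ 3 = 0" "D' $ 1 $ 1 = 0" "D' $ 2 $ 2 = 0" "D' $ 3 $ 3 = 0"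
  using pC pD unfolding qf_axis[symmetric] qf_C' qf_D' S_axis by (simp_all add: zeros_def)

lemma qf_off: "qf C (S *v n) = 2 * scalar_product (off_diagonal C') (pair_products n)"
  "qf D (S *v n) = 2 * scalar_product (off_diagonal D') (pair_products n)"
  unfolding qf_C'[symmetric] qf_D'[symmetric]
  by (rule qf_zero_diagonal sym' diagonal)+

lemma off_perp_iff:
  "qf C (S *v n) = 0 \<longleftrightarrow> scalar_product (off_diagonal C') (pair_products n) = 0"
  "qf D (S *v n) = 0 \<longleftrightarrow> scalar_product (off_diagonal D') (pair_products n) = 0"
  unfolding qf_off using two by simp_all

lemma off_perp_m: "scalar_product (off_diagonal C') (pair_products m) = 0"
  "scalar_product (off_diagonal D') (pair_products m) = 0"
  using pC(4) pD(4) unfolding off_perp_iff[symmetric] S_m zeros_def by simp_all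

lemma off_nonzero: "off_diagonal C' $ 1 \<noteq> 0" "off_diagonal C' $ 2 \<noteq> 0" "off_diagonal C' $ 3 \<noteq> 0"
proof -
  have "det C' \<noteq> 0" unfolding C'_def using C(2) det_S by (simp add: det_mul det_transpose)
  then show "off_diagonal C' $ 1 \<noteq> 0" "off_diagonal C' $ 2 \<noteq> 0" "off_diagonal C' $ 3 \<noteq> 0"
    unfolding det_zero_diagonal[OF sym'(1) diagonal(1,2,3)] by auto
qed

lemma proportional_if_off:
  assumes "off_diagonal D' = r *s off_diagonal C'"
  shows "qf D v = r * qf C v"
proof -
  obtain n where n: "S *v n = v" using matrix_vector_mult_surj[OF det_S] .
  show ?thesis using qf_off[of n] unfolding n assms by simp
qed

text \<open>Both coefficient vectors are orthogonal to \<open>pair_products m\<close>, which has no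
  zero coordinate. If one of their minors vanished, orthogonality would extend the proportionality
  to the remaining coordinate. These minors separate the three roots of the pencil
  determinant.\<close>

lemma off_independent:
  assumes np: "\<not> (\<exists>r. \<forall>v. qf D v = r * qf C v)"
  shows "off_diagonal C' $ 1 * off_diagonal D' $ 2 \<noteq> off_diagonal C' $ 2 * off_diagonal D' $ 1"
    "off_diagonal C' $ 1 * off_diagonal D' $ 3 \<noteq> off_diagonal C' $ 3 * off_diagonal D' $ 1"
    "off_diagonal C' $ 2 * off_diagonal D' $ 3 \<noteq> off_diagonal C' $ 3 * off_diagonal D' $ 2"
proof -
  define c d where "c = off_diagonal C'" and "d = off_diagonal D'"
  define u where "u = pair_products m"
  have c: "c $ 1 \<noteq> 0" "c $ 2 \<noteq> 0" "c $ 3 \<noteq> 0" unfolding c_def by (rule off_nonzero)+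
  have u: "u $ 1 \<noteq> 0" "u $ 2 \<noteq> 0" "u $ 3 \<noteq> 0" unfolding u_def using m_nonzero by simp_all
  have 1: "c $ 1 * u $ 1 + c $ 2 * u $ 2 + c $ 3 * u $ 3 = 0" "d $ 1 * u $ 1 + d $ 2 * u $ 2 + d $ 3 * u $ 3 = 0"
    using off_perp_m unfolding c_def d_def u_def scalar_product_3 by simp_all
  have 2: "c $ 1 * u $ 1 + c $ 3 * u $ 3 + c $ 2 * u $ 2 = 0" "d $ 1 * u $ 1 + d $ 3 * u $ 3 + d $ 2 * u $ 2 = 0"
    using 1 by (simp_all only: ac_simps)
  have 3: "c $ 2 * u $ 2 + c $ 3 * u $ 3 + c $ 1 * u $ 1 = 0" "d $ 2 * u $ 2 + d $ 3 * u $ 3 + d $ 1 * u $ 1 = 0"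
    using 1 by (simp_all only: ac_simps)
  have key: "di = di / ci * ci \<and> dj = di / ci * cj \<and> dk = di / ci * ck"
    if "ci * ui + cj * uj + ck * uk = 0" "di * ui + dj * uj + dk * uk = 0" "ci * dj = cj * di" "ci \<noteq> 0" "uk \<noteq> 0"
    for ci cj ck di dj dk ui uj uk :: 'k
  proof -
    define r where "r = di / ci"
    have i: "di = r * ci" using that(4) by (simp add: r_def)
    have "ci * dj = ci * (r * cj)" unfolding that(3) i by (simp only: ac_simps)
    then have j: "dj = r * cj" using that(4) by simp
    have "uk * dk = uk * (r * ck)" using that(1,2) i j by Groebner_Basis.algebra
    then have "dk = r * ck" using that(5) by simp
    with i j show ?thesis unfolding r_def[symmetric] by simp
  qed
  have no: "d \<noteq> r *s c" for r
  proof
    assume "d = r *s c"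
    then have "qf D v = r * qf C v" for v unfolding c_def d_def by (rule proportional_if_off)
    then show False using np by simp
  qed
  have "c $ 1 * d $ 2 \<noteq> c $ 2 * d $ 1"
  proof
    assume "c $ 1 * d $ 2 = c $ 2 * d $ 1"
    from key[OF 1 this c(1) u(3)] have "d = (d $ 1 / c $ 1) *s c"
      unfolding vec3_eq_iff vector_smult_component by (elim conjE, intro conjI)
    then show False using no by simp
  qed
  moreover have "c $ 1 * d $ 3 \<noteq> c $ 3 * d $ 1"
  proof
    assume "c $ 1 * d $ 3 = c $ 3 * d $ 1"
    from key[OF 2 this c(1) u(2)] have "d = (d $ 1 / c $ 1) *s c"
      unfolding vec3_eq_iff vector_smult_component by (elim conjE, intro conjI)
    then show False using no by simp
  qed
  moreover have "c $ 2 * d $ 3 \<noteq> c $ 3 * d $ 2"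
  proof
    assume "c $ 2 * d $ 3 = c $ 3 * d $ 2"
    from key[OF 3 this c(2) u(1)] have "d = (d $ 2 / c $ 2) *s c"
      unfolding vec3_eq_iff vector_smult_component by (elim conjE, intro conjI)
    then show False using no by simp
  qed
  ultimately show "off_diagonal C' $ 1 * off_diagonal D' $ 2 \<noteq> off_diagonal C' $ 2 * off_diagonal D' $ 1"
    "off_diagonal C' $ 1 * off_diagonal D' $ 3 \<noteq> off_diagonal C' $ 3 * off_diagonal D' $ 1"
    "off_diagonal C' $ 2 * off_diagonal D' $ 3 \<noteq> off_diagonal C' $ 3 * off_diagonal D' $ 2"
    unfolding c_def d_def by this+
qed

text \<open>After the Cremona map the fourth and fifth points impose independent linear conditions,
  which leave only one coefficient vector up to scale for both conics.\<close>

lemma five_points_proportional: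
  assumes p5: "p5 \<in> zeros C" "p5 \<in> zeros D"
    and distinct5: "crs p5 p1 \<noteq> 0" "crs p5 p2 \<noteq> 0" "crs p5 p3 \<noteq> 0" "crs p5 p4 \<noteq> 0"
  obtains r where "\<forall>v. qf D v = r * qf C v"
proof -
  obtain n where n: "S *v n = p5" using matrix_vector_mult_surj[OF det_S] .
  have p5_eq: "p5 = n $ 1 *s p1 + n $ 2 *s p2 + n $ 3 *s p3" unfolding n[symmetric] S_def columns_mult ..
  have perp: "scalar_product (off_diagonal C') (pair_products n) = 0" "scalar_product (off_diagonal D') (pair_products n) = 0"
    using p5 unfolding off_perp_iff[symmetric] n zeros_def by simp_all
  have "crs (pair_products n) (pair_products m) \<noteq> 0"
  proof
    assume 0: "crs (pair_products n) (pair_products m) = 0"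
    have "pair_products m $ 1 \<noteq> 0" using m_nonzero by simp
    then have "pair_products m \<noteq> 0" by (metis zero_index)
    then obtain c where "pair_products n = c *s pair_products m" by (rule proportional_if_crs_0[OF _ 0])
    then have c: "n $ 2 * n $ 3 = c * (m $ 2 * m $ 3)" "n $ 1 * n $ 3 = c * (m $ 1 * m $ 3)" "n $ 1 * n $ 2 = c * (m $ 1 * m $ 2)"
      by (simp_all add: vec3_eq_iff)
    show False
    proof (cases "c = 0")
      \<comment> \<open>All pair products of \<open>n\<close> vanish, so \<open>n\<close> has at
        most one nonzero coordinate and \<open>p5\<close> is a multiple of \<open>p1\<close>,
        \<open>p2\<close> or \<open>p3\<close>.\<close>
      case True
      then have "n $ 1 = 0 \<and> n $ 2 = 0 \<or> n $ 1 = 0 \<and> n $ 3 = 0 \<or> n $ 2 = 0 \<and> n $ 3 = 0" using c by auto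
      then have "p5 = n $ 3 *s p3 \<or> p5 = n $ 2 *s p2 \<or> p5 = n $ 1 *s p1"
        using p5_eq by (elim disjE conjE) simp_all
      then show False using distinct5(1-3) by (elim disjE) simp_all
    next
      case False
      then have "n $ 2 * n $ 3 \<noteq> 0" "n $ 1 * n $ 3 \<noteq> 0" unfolding c(1,2) using m_nonzero by simp_all
      then have nz: "n $ 1 \<noteq> 0" "n $ 2 \<noteq> 0" "n $ 3 \<noteq> 0" by simp_all
      \<comment> \<open>Away from the coordinate lines the pair products determine a vector up to
        scale, so \<open>p5\<close> would be a multiple of \<open>p4\<close>.\<close>
      have cross: "x * m2 = y * m1" if "x * z = c * (m1 * m3)" "y * z = c * (m2 * m3)" "z \<noteq> 0" for x y z m1 m2 m3
      proof -
        have "z * (x * m2) = (x * z) * m2" by (simp only: ac_simps)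
        also have "\<dots> = (y * z) * m1" unfolding that(1,2) by (simp only: ac_simps)
        also have "\<dots> = z * (y * m1)" by (simp only: ac_simps)
        finally show ?thesis using that(3) by simp
      qed
      have c': "n $ 3 * n $ 2 = c * (m $ 3 * m $ 2)" "n $ 3 * n $ 1 = c * (m $ 3 * m $ 1)" "n $ 2 * n $ 1 = c * (m $ 2 * m $ 1)"
        using c by (simp_all only: mult.commute)
      have "n $ 1 * m $ 2 = n $ 2 * m $ 1" "n $ 1 * m $ 3 = n $ 3 * m $ 1" "n $ 2 * m $ 3 = n $ 3 * m $ 2"
        by (rule cross[OF c(2) c(1) nz(3)] cross[OF c(3) c'(1) nz(2)] cross[OF c'(3) c'(2) nz(1)])+
      then have 0: "crs n m = 0" by (simp add: vec3_eq_iff mult.commute)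
      have "m \<noteq> 0" using m_nonzero(1) by (metis zero_index)
      then obtain e where "n = e *s m" by (rule proportional_if_crs_0[OF _ 0])
      then have "S *v n = e *s (S *v m)" by (simp only: vector_scalar_commute)
      then have "p5 = e *s p4" unfolding n S_m .
      then show False using distinct5(4) by simp
    qed
  qed
  note plane = perp_plane[OF this]
  obtain e where e: "off_diagonal C' = e *s crs (pair_products n) (pair_products m)"
    using plane[OF perp(1) off_perp_m(1)] .
  obtain f where f: "off_diagonal D' = f *s crs (pair_products n) (pair_products m)"
    using plane[OF perp(2) off_perp_m(2)] .
  have "e \<noteq> 0"
  proof
    assume "e = 0"
    then have "off_diagonal C' = 0" using e by simp
    then show False using off_nonzero(1) by simp
  qed
  then have "off_diagonal D' = (f / e) *s off_diagonal C'" unfolding e f by (simp add: vector_smult_assoc)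
  then have "\<forall>v. qf D v = f / e * qf C v" by (intro allI proportional_if_off)
  then show ?thesis by (rule that)
qed

text \<open>If the conics coincide, a further common point is found by solving for the last coordinate.\<close>

lemma fifth_point:
  assumes "zeros C \<subseteq> zeros D"
  obtains p5 where "p5 \<in> zeros C" "p5 \<in> zeros D"
    "crs p5 p1 \<noteq> 0" "crs p5 p2 \<noteq> 0" "crs p5 p3 \<noteq> 0" "crs p5 p4 \<noteq> 0"
proof -
  define c where "c = off_diagonal C'"
  define w where "w = m $ 2 / m $ 1"
  \<comment> \<open>This is \<open>y * (y - w) * (c $ 2 + c $ 1 * y) + 1\<close>. Any root avoids
    three values at once: \<open>y = 0\<close> would give \<open>p1\<close> or hide the last
    coordinate, \<open>y = w\<close> could give \<open>p4\<close>, and a vanishing third factor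
    would prevent solving for \<open>z\<close>.\<close>
  define bad where "bad = [: 1, - (w * c $ 2), c $ 2 - w * c $ 1, c $ 1 :]"
  have "c $ 1 \<noteq> 0" unfolding c_def by (rule off_nonzero)
  then have "pdeg bad > 0" by (simp add: bad_def)
  then obtain y where y: "poly bad y = 0" using alg_closed_imp_poly_has_root by blast
  have "y * (y - w) * (c $ 2 + c $ 1 * y) + 1 = poly bad y"
    unfolding bad_def by (simp add: algebra_simps)
  then have e: "y * (y - w) * (c $ 2 + c $ 1 * y) + 1 = 0" unfolding y .
  have y0: "y \<noteq> 0"
  proof
    assume "y = 0"
    then show False using e by simp
  qed
  have "y \<noteq> w"
  proof
    assume "y = w"
    then show False using e by simp
  qed
  have yc: "c $ 2 + c $ 1 * y \<noteq> 0"
  proof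
    assume "c $ 2 + c $ 1 * y = 0"
    then show False using e by simp
  qed
  have ym: "y \<noteq> m $ 2 / m $ 1" using \<open>y \<noteq> w\<close> unfolding w_def .
  define z where "z = - (c $ 3 * y) / (c $ 2 + c $ 1 * y)"
  have z: "z * (c $ 2 + c $ 1 * y) = - (c $ 3 * y)" using yc by (simp add: z_def)
  define n :: "'k ^ 3" where "n = vector [1, y, z]"
  have n: "n $ 1 = 1" "n $ 2 = y" "n $ 3 = z" by (simp_all add: n_def vector_3)
  have "scalar_product c (pair_products n) = 0"
    unfolding scalar_product_3 pair_products_nth n using z by Groebner_Basis.algebra
  then have qf: "qf C (S *v n) = 0" unfolding c_def off_perp_iff .
  have "n \<noteq> 0" using n(1) by auto
  then have "S *v n \<noteq> 0" using matrix_vector_mult_eq_0_iff[OF det_S] by simp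
  then have zeroC: "S *v n \<in> zeros C" using qf by (simp add: zeros_def)
  have not_prop: "crs (S *v n) (S *v x) \<noteq> 0" if "x \<noteq> 0" "\<And>e. n \<noteq> e *s x" for x
  proof
    assume 0: "crs (S *v n) (S *v x) = 0"
    have "S *v x \<noteq> 0" using that(1) matrix_vector_mult_eq_0_iff[OF det_S] by simp
    then obtain e where "S *v n = e *s (S *v x)" by (rule proportional_if_crs_0[OF _ 0])
    then have "S *v n = S *v (e *s x)" by (simp only: vector_scalar_commute)
    then have "n = e *s x" by (rule matrix_vector_mult_inj[OF det_S])
    then show False using that(2) by blast
  qed
  have axis: "crs (S *v n) (S *v axis i 1) \<noteq> 0" for i :: 3
  proof (rule not_prop)
    show "axis i 1 \<noteq> (0 :: 'k ^ 3)" by (simp add: axis_eq_0_iff)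
    show "n \<noteq> e *s axis i 1" for e
    proof
      assume ne: "n = e *s axis i 1"
      have "n $ 1 = (e *s axis i 1) $ 1" "n $ 2 = (e *s axis i 1) $ 2"
        by (rule arg_cong[OF ne])+
      then show False using y0 unfolding n vector_smult_component by (simp add: axis_def split: if_splits)
    qed
  qed
  have "crs (S *v n) p1 \<noteq> 0" "crs (S *v n) p2 \<noteq> 0" "crs (S *v n) p3 \<noteq> 0"
    using axis[of 1] axis[of 2] axis[of 3] unfolding S_axis by simp_all
  moreover have "crs (S *v n) (S *v m) \<noteq> 0"
  proof (rule not_prop)
    show "m \<noteq> 0" using m_nonzero by auto
    show "n \<noteq> e *s m" for e
    proof
      assume "n = e *s m"
      then have "1 = e * m $ 1" "y = e * m $ 2" using n by (simp_all add: vec3_eq_iff)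
      then show False using ym m_nonzero by (simp add: eq_divide_eq mult.commute mult.left_commute)
    qed
  qed
  then have "crs (S *v n) p4 \<noteq> 0" unfolding S_m .
  moreover have "S *v n \<in> zeros D" using zeroC assms by blast
  ultimately show ?thesis using that[of "S *v n"] zeroC by simp
qed

end

section \<open>Transversal conics and their common tangents\<close>

lemma span_neq_imp_crs_nonzero:
  assumes "x \<in> zeros M" "y \<in> zeros M" "vec.span {x} \<noteq> vec.span {y}"
  shows "crs x y \<noteq> 0"
proof
  assume 0: "crs x y = 0"
  have nz: "x \<noteq> 0" "y \<noteq> 0" using assms by (simp_all add: zeros_def)
  obtain c where c: "x = c *s y" using proportional_if_crs_0[OF nz(2) 0] .
  then have "c \<noteq> 0" using nz by auto
  then show False using assms(3) unfolding c by (simp add: span_singleton_scale)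
qed

lemma four_points_of_card_4:
  fixes C D :: "'k::alg_closed_field ^ 3 ^ 3"
  assumes two: "(2 :: 'k) \<noteq> 0" and C: "transpose C = C" "det C \<noteq> 0" and D: "transpose D = D" "det D \<noteq> 0"
    and card: "card (plane_conic C \<inter> plane_conic D) = 4"
  obtains p1 p2 p3 p4 where "four_points C D p1 p2 p3 p4"
    "plane_conic C \<inter> plane_conic D = (\<lambda>p. vec.span {p}) ` {p1, p2, p3, p4}"
proof -
  have "finite (plane_conic C \<inter> plane_conic D)" using card by (intro card_ge_0_finite) simp
  then obtain Ps where Ps: "set Ps = plane_conic C \<inter> plane_conic D" "distinct Ps"
    using finite_distinct_list by blast
  then have "length Ps = 4" using card distinct_card[of Ps] by simp
  then obtain P1 P2 P3 P4 where P: "Ps = [P1, P2, P3, P4]"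
    by (auto simp: numeral_eq_Suc length_Suc_conv)
  have point: "\<exists>p. p \<in> zeros C \<and> p \<in> zeros D \<and> Q = vec.span {p}" if Q: "Q \<in> set Ps" for Q
  proof -
    obtain p where p: "Q = vec.span {p}" "p \<in> zeros C" using Q unfolding Ps plane_conic_eq[of C] by blast
    moreover have "p \<in> zeros D"
      using Q p unfolding Ps by (simp add: span_in_plane_conic_iff zeros_def)
    ultimately show ?thesis by blast
  qed
  obtain p1 where p1: "p1 \<in> zeros C" "p1 \<in> zeros D" "P1 = vec.span {p1}" using point[of P1] P by auto
  obtain p2 where p2: "p2 \<in> zeros C" "p2 \<in> zeros D" "P2 = vec.span {p2}" using point[of P2] P by auto
  obtain p3 where p3: "p3 \<in> zeros C" "p3 \<in> zeros D" "P3 = vec.span {p3}" using point[of P3] P by auto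
  obtain p4 where p4: "p4 \<in> zeros C" "p4 \<in> zeros D" "P4 = vec.span {p4}" using point[of P4] P by auto
  have ne: "P1 \<noteq> P2" "P1 \<noteq> P3" "P2 \<noteq> P3" "P1 \<noteq> P4" "P2 \<noteq> P4" "P3 \<noteq> P4" using Ps(2) P by auto
  have ne': "crs p1 p2 \<noteq> 0" "crs p1 p3 \<noteq> 0" "crs p2 p3 \<noteq> 0" "crs p1 p4 \<noteq> 0" "crs p2 p4 \<noteq> 0" "crs p3 p4 \<noteq> 0"
    by (rule span_neq_imp_crs_nonzero; (fact p1 p2 p3 p4 | use ne[unfolded p1(3) p2(3) p3(3) p4(3)] in simp))+
  have "four_points C D p1 p2 p3 p4"
    by unfold_locales (fact two C D p1 p2 p3 p4 ne')+
  moreover have "plane_conic C \<inter> plane_conic D = (\<lambda>p. vec.span {p}) ` {p1, p2, p3, p4}"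
    unfolding Ps(1)[symmetric] P p1(3) p2(3) p3(3) p4(3) by simp
  ultimately show ?thesis by (rule that)
qed

text \<open>Otherwise every zero of \<open>C\<close> is one of \<open>D\<close>, and
  \<open>fifth_point\<close> produces an intersection point beyond the four.\<close>

lemma not_proportional:
  fixes C D :: "'k::alg_closed_field ^ 3 ^ 3"
  assumes two: "(2 :: 'k) \<noteq> 0" and C: "transpose C = C" "det C \<noteq> 0" and D: "transpose D = D" "det D \<noteq> 0"
    and card: "card (plane_conic C \<inter> plane_conic D) = 4"
  shows "\<not> (\<exists>r. \<forall>v. qf D v = r * qf C v)"
proof
  assume "\<exists>r. \<forall>v. qf D v = r * qf C v"
  then have sub: "zeros C \<subseteq> zeros D" by (auto simp: zeros_def)
  obtain p1 p2 p3 p4 where "four_points C D p1 p2 p3 p4"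
    and eq: "plane_conic C \<inter> plane_conic D = (\<lambda>p. vec.span {p}) ` {p1, p2, p3, p4}"
    using four_points_of_card_4[OF assms] .
  then interpret four_points C D p1 p2 p3 p4 by simp
  obtain p5 where p5: "p5 \<in> zeros C" "p5 \<in> zeros D" "crs p5 p1 \<noteq> 0" "crs p5 p2 \<noteq> 0" "crs p5 p3 \<noteq> 0" "crs p5 p4 \<noteq> 0"
    using fifth_point[OF sub] .
  have "vec.span {p5} \<in> plane_conic C \<inter> plane_conic D" using p5(1,2) by (auto simp: plane_conic_eq)
  then have "vec.span {p5} \<in> (\<lambda>p. vec.span {p}) ` {p1, p2, p3, p4}" unfolding eq .
  then obtain p where p: "vec.span {p5} = vec.span {p}" "p \<in> {p1, p2, p3, p4}" by (rule imageE)
  have "p5 \<noteq> 0" using p5(1) by (simp add: zeros_def)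
  then obtain c where "p5 = c *s p" by (rule span_singleton_eqD[OF p(1)])
  then have "crs p5 p = 0" by simp
  then show False using p(2) p5(3-6) by (elim insertE emptyE) simp_all
qed

lemma inverse_form:
  fixes M :: "'k::field ^ 3 ^ 3"
  assumes sym: "transpose M = M" and det: "det M \<noteq> 0"
  obtains N where "transpose N = N" "det N \<noteq> 0" "\<forall>v. N *v (M *v v) = v" "\<forall>v. M *v (N *v v) = v"
proof -
  obtain N where N: "M ** N = mat 1" "N ** M = mat 1"
    using det invertible_det_nz[of M] unfolding invertible_def by blast
  have "transpose N ** M = mat 1"
    using N(1) sym by (metis matrix_transpose_mul transpose_mat)
  then have "transpose N = N" using N(1) by (metis matrix_mul_assoc matrix_mul_lid matrix_mul_rid)
  moreover have "det M * det N = 1" using N(1) by (metis det_I det_mul)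
  then have "det N \<noteq> 0" by auto
  moreover have "\<forall>v. N *v (M *v v) = v" "\<forall>v. M *v (N *v v) = v"
    unfolding matrix_vector_mul_assoc N by simp_all
  ultimately show ?thesis by (rule that)
qed

text \<open>Tangents of a conic are zeros of the inverse matrix. Four common tangents form a
  \<open>four_points\<close> configuration in the dual plane, and a fifth one would make the
  inverses, hence \<open>C\<close> and \<open>D\<close> themselves, proportional.\<close>

lemma common_tangents_le_4:
  fixes C D :: "'k::alg_closed_field ^ 3 ^ 3"
  assumes two: "(2 :: 'k) \<noteq> 0" and C: "transpose C = C" "det C \<noteq> 0" and D: "transpose D = D" "det D \<noteq> 0"
    and np: "\<not> (\<exists>r. \<forall>v. qf C v = r * qf D v)"
    and T: "T \<subseteq> dual_conic C \<inter> dual_conic D"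
  shows "card T \<le> 4"
proof (rule ccontr)
  assume "\<not> card T \<le> 4"
  then obtain U where U: "U \<subseteq> T" "card U = 5" "finite U"
    using obtain_subset_with_card_n[of 5 T] by auto
  then obtain Ls where Ls: "set Ls = U" "distinct Ls" using finite_distinct_list by blast
  then have "length Ls = 5" using U distinct_card[of Ls] by simp
  then obtain L1 L2 L3 L4 L5 where L: "Ls = [L1, L2, L3, L4, L5]"
    by (auto simp: numeral_eq_Suc length_Suc_conv)
  obtain M where M: "transpose M = M" "det M \<noteq> 0" "\<forall>v. M *v (C *v v) = v" "\<forall>v. C *v (M *v v) = v"
    using inverse_form[OF C] .
  note M = M(1,2) M(3,4)[rule_format]
  obtain N where N: "transpose N = N" "det N \<noteq> 0" "\<forall>v. N *v (D *v v) = v" "\<forall>v. D *v (N *v v) = v"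
    using inverse_form[OF D] .
  note N = N(1,2) N(3,4)[rule_format]
  have tangents: "l \<in> zeros B" if l: "l \<in> tangents A" and A: "det A \<noteq> 0" "\<And>v. B *v (A *v v) = v"
    for l and A B :: "'k ^ 3 ^ 3"
  proof -
    obtain w where w: "w \<in> zeros A" "l = A *v w" using l by (auto simp: tangents_def)
    have "qf B l = qf A w" unfolding w(2) qf_def A(2) by (rule scalar_product_commute)
    then show ?thesis using w tangents_nonzero[OF A(1) l] by (simp add: zeros_def)
  qed
  have line: "\<exists>l. l \<in> zeros M \<and> l \<in> zeros N \<and> Q = vec.span {l}" if Q: "Q \<in> set Ls" for Q
  proof -
    have "Q \<in> dual_conic C" "Q \<in> dual_conic D" using Q Ls U T by auto
    then obtain l where l: "l \<in> tangents C" "Q = vec.span {l}" by (auto simp: dual_conic_eq)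
    have "l \<in> tangents D"
      using \<open>Q \<in> dual_conic D\<close> tangents_nonzero[OF C(2) l(1)] unfolding l(2) by (simp add: span_in_dual_conic_iff)
    then have "l \<in> zeros M" "l \<in> zeros N" using tangents[OF l(1) C(2) M(3)] tangents[OF _ D(2) N(3)] by simp_all
    then show ?thesis using l(2) by (intro exI[of _ l]) simp
  qed
  obtain l1 where l1: "l1 \<in> zeros M" "l1 \<in> zeros N" "L1 = vec.span {l1}" using line[of L1] L by auto
  obtain l2 where l2: "l2 \<in> zeros M" "l2 \<in> zeros N" "L2 = vec.span {l2}" using line[of L2] L by auto
  obtain l3 where l3: "l3 \<in> zeros M" "l3 \<in> zeros N" "L3 = vec.span {l3}" using line[of L3] L by auto
  obtain l4 where l4: "l4 \<in> zeros M" "l4 \<in> zeros N" "L4 = vec.span {l4}" using line[of L4] L by auto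
  obtain l5 where l5: "l5 \<in> zeros M" "l5 \<in> zeros N" "L5 = vec.span {l5}" using line[of L5] L by auto
  have ne: "L1 \<noteq> L2" "L1 \<noteq> L3" "L2 \<noteq> L3" "L1 \<noteq> L4" "L2 \<noteq> L4" "L3 \<noteq> L4" "L5 \<noteq> L1" "L5 \<noteq> L2" "L5 \<noteq> L3" "L5 \<noteq> L4"
    using Ls(2) L by auto
  have ne': "crs l1 l2 \<noteq> 0" "crs l1 l3 \<noteq> 0" "crs l2 l3 \<noteq> 0" "crs l1 l4 \<noteq> 0" "crs l2 l4 \<noteq> 0" "crs l3 l4 \<noteq> 0"
    "crs l5 l1 \<noteq> 0" "crs l5 l2 \<noteq> 0" "crs l5 l3 \<noteq> 0" "crs l5 l4 \<noteq> 0"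
    by (rule span_neq_imp_crs_nonzero; (fact l1 l2 l3 l4 l5 | use ne[unfolded l1(3) l2(3) l3(3) l4(3) l5(3)] in simp))+
  interpret dual: four_points M N l1 l2 l3 l4
    by unfold_locales (fact two M N l1 l2 l3 l4 ne')+
  obtain r where r: "\<forall>v. qf N v = r * qf M v"
    by (rule dual.five_points_proportional[OF l5(1,2) ne'(7-10)])
  \<comment> \<open>Polarising the difference turns proportional quadratic forms into proportional
    symmetric matrices.\<close>
  define R where "R = N - (\<chi> i j. r * M $ i $ j)"
  have entry: "R $ i $ j = N $ i $ j - r * M $ i $ j" for i j by (simp add: R_def)
  have "transpose R = R"
    unfolding vec_eq_iff transpose_def vec_lambda_beta entry
    using transpose_eqD[OF M(1)] transpose_eqD[OF N(1)] by metis
  moreover have "qf R v = 0" for v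
  proof -
    have "qf R v = qf N v - r * qf M v"
      unfolding qf_def scalar_product_3 matrix_vector_mult_3 entry by Groebner_Basis.algebra
    then show ?thesis using r by simp
  qed
  ultimately have "R = 0" by (intro qf_eq_0_imp_zero two)
  then have NM: "N $ i $ j = r * M $ i $ j" for i j using entry[of i j] by simp
  have NM': "N *v v = r *s (M *v v)" for v
    by (simp add: vec_eq_iff matrix_vector_mult_3 NM algebra_simps)
  have "C *v v = r *s (D *v v)" for v
  proof -
    have "v = r *s (M *v (D *v v))" using N(3)[of v] unfolding NM' by simp
    then have "C *v v = C *v (r *s (M *v (D *v v)))" by simp
    then show ?thesis unfolding vector_scalar_commute M(4) .
  qed
  then have "qf C v = r * qf D v" for v by (simp add: qf_def)
  then show False using np by blast
qed

section \<open>The cubics of the pencil\<close>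

lemma mat_mult_nth: "(mat x ** M) $ i $ j = x * M $ i $ j" for M :: "'k::field ^ 3 ^ 3"
  by (simp add: matrix_matrix_mult_def mat_def if_distrib if_distribR cong: if_cong)

lemma poly_det_pencil:
  "poly (det (\<chi> i j. [:D $ i $ j, C $ i $ j:])) x = det (D + mat x ** C)" for C D :: "'k::field ^ 3 ^ 3"
  by (simp only: det_3 vec_lambda_beta poly_add poly_diff poly_mult poly_pCons poly_0 vector_add_component mat_mult_nth)
    Groebner_Basis.algebra

lemma det_pencil_eq:
  fixes C D :: "'k::field ^ 3 ^ 3"
  obtains a b where "det (\<chi> i j. [:D $ i $ j, C $ i $ j:]) = [:det D, b, a, det C:]"
proof -
  define p where "p = det (\<chi> i j. [:D $ i $ j, C $ i $ j:])"
  have deg: "pdeg ([:a, b:] * [:c, d:] * [:e, f:]) \<le> 3" for a b c d e f :: 'k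
  proof -
    have "pdeg ([:a, b:] * [:c, d:] * [:e, f:]) \<le> (1 + 1) + 1"
      by (rule order_trans[OF degree_mult_le] add_mono order_refl)+ (simp_all add: degree_pCons_eq_if)
    then show ?thesis by simp
  qed
  have "pdeg p \<le> 3"
    unfolding p_def det_3 vec_lambda_beta by (intro degree_add_le degree_diff_le deg)
  moreover have "Polynomial.coeff p 3 = det C"
    unfolding p_def det_3 vec_lambda_beta by (simp add: coeff_pCons numeral_3_eq_3)
  moreover have "Polynomial.coeff p 0 = det D"
    unfolding p_def det_3 vec_lambda_beta by simp
  ultimately have "p = [:det D, Polynomial.coeff p 1, Polynomial.coeff p 2, det C:]"
    by (intro poly_eqI) (auto simp: coeff_pCons numeral_2_eq_2 numeral_3_eq_3 coeff_eq_0 split: nat.split)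
  then show ?thesis unfolding p_def by (rule that)
qed

text \<open>A double root \<open>x\<close> would leave the cubic \<open>h \<mapsto> f (x + h)\<close> with only one nonzero root.\<close>

lemma simple_roots_aux:
  fixes k a b e \<kappa> c1 c2 c3 d1 d2 d3 x :: "'k::field"
  assumes eq: "\<And>x. \<kappa> * cubic k a b e x = 2 * (d1 + x * c1) * (d2 + x * c2) * (d3 + x * c3)"
    and nz: "\<kappa> \<noteq> 0" "k \<noteq> 0" "c1 \<noteq> 0" "c2 \<noteq> 0" "c3 \<noteq> 0"
    and ind: "c1 * d2 \<noteq> c2 * d1" "c1 * d3 \<noteq> c3 * d1" "c2 * d3 \<noteq> c3 * d2"
    and root: "cubic k a b e x = 0" and x: "d1 + x * c1 = 0"
  shows "3 * k * x\<^sup>2 + 2 * a * x + b \<noteq> 0"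
proof
  assume double: "3 * k * x\<^sup>2 + 2 * a * x + b = 0"
  have taylor: "cubic k a b e (x + h) = h\<^sup>2 * (k * h + 3 * k * x + a)" for h
    using root double unfolding cubic_def by Groebner_Basis.algebra
  have d1: "d1 = - (x * c1)" using x by (simp add: eq_neg_iff_add_eq_0)
  have other: "k * (- (d / c) - x) + 3 * k * x + a = 0" if "cubic k a b e (- (d / c)) = 0" "d + x * c \<noteq> 0" "c \<noteq> 0" for c d
  proof -
    have "(- (d / c) - x) * c = - (d + x * c)" using that(3) by (simp add: algebra_simps)
    then have "- (d / c) - x \<noteq> 0" using that(2) by auto
    then show ?thesis using taylor[of "- (d / c) - x"] that(1) by simp
  qed
  have e2: "d2 + x * c2 \<noteq> 0"
  proof
    assume "d2 + x * c2 = 0"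
    then have "d2 = - (x * c2)" by (simp add: eq_neg_iff_add_eq_0)
    then show False using ind(1) d1 by (simp add: ac_simps)
  qed
  have e3: "d3 + x * c3 \<noteq> 0"
  proof
    assume "d3 + x * c3 = 0"
    then have "d3 = - (x * c3)" by (simp add: eq_neg_iff_add_eq_0)
    then show False using ind(2) d1 by (simp add: ac_simps)
  qed
  have "\<kappa> * cubic k a b e (- (d2 / c2)) = 0" unfolding eq using nz by simp
  then have 2: "k * (- (d2 / c2) - x) + 3 * k * x + a = 0" using nz by (intro other[OF _ e2]) simp_all
  have "\<kappa> * cubic k a b e (- (d3 / c3)) = 0" unfolding eq using nz by simp
  then have 3: "k * (- (d3 / c3) - x) + 3 * k * x + a = 0" using nz by (intro other[OF _ e3]) simp_all
  \<comment> \<open>The two remaining roots differ from \<open>x\<close>, so both solve the same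
    linear equation and coincide, against \<open>ind(3)\<close>.\<close>
  have "k * (- (d2 / c2) - x) + (3 * k * x + a) = k * (- (d3 / c3) - x) + (3 * k * x + a)"
    using 2 3 by (simp only: add.assoc)
  then have "k * (- (d2 / c2) - x) = k * (- (d3 / c3) - x)" by (simp only: add_right_cancel)
  then have "d2 / c2 = d3 / c3" using nz by simp
  then have "c2 * d3 = c3 * d2" using nz by (simp add: frac_eq_eq mult.commute)
  then show False using ind(3) by simp
qed

lemma simple_roots:
  fixes k a b e \<kappa> c1 c2 c3 d1 d2 d3 x :: "'k::field"
  assumes eq: "\<And>x. \<kappa> * cubic k a b e x = 2 * (d1 + x * c1) * (d2 + x * c2) * (d3 + x * c3)"
    and nz: "\<kappa> \<noteq> 0" "k \<noteq> 0" "(2 :: 'k) \<noteq> 0" "c1 \<noteq> 0" "c2 \<noteq> 0" "c3 \<noteq> 0"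
    and ind: "c1 * d2 \<noteq> c2 * d1" "c1 * d3 \<noteq> c3 * d1" "c2 * d3 \<noteq> c3 * d2"
    and root: "cubic k a b e x = 0"
  shows "3 * k * x\<^sup>2 + 2 * a * x + b \<noteq> 0"
proof -
  have "2 * (d1 + x * c1) * (d2 + x * c2) * (d3 + x * c3) = 0" unfolding eq[symmetric] root by simp
  then have "d1 + x * c1 = 0 \<or> d2 + x * c2 = 0 \<or> d3 + x * c3 = 0"
    using nz(3) by (simp only: mult_eq_0_iff simp_thms disj_assoc)
  then consider "d1 + x * c1 = 0" | "d2 + x * c2 = 0" | "d3 + x * c3 = 0" by blast
  then show ?thesis
  proof cases
    case 1
    then show ?thesis by (intro simple_roots_aux[OF eq nz(1,2,4,5,6) ind root])
  next
    case 2
    have eq': "\<kappa> * cubic k a b e x = 2 * (d2 + x * c2) * (d1 + x * c1) * (d3 + x * c3)" for x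
      unfolding eq by (simp only: ac_simps)
    show ?thesis by (rule simple_roots_aux[OF eq' nz(1,2,5,4,6) ind(1)[symmetric] ind(3) ind(2) root 2])
  next
    case 3
    have eq': "\<kappa> * cubic k a b e x = 2 * (d3 + x * c3) * (d1 + x * c1) * (d2 + x * c2)" for x
      unfolding eq by (simp only: ac_simps)
    show ?thesis by (rule simple_roots_aux[OF eq' nz(1,2,6,4,5) ind(2)[symmetric] ind(3)[symmetric] ind(1) root 3])
  qed
qed

text \<open>In the coordinates of \<open>S\<close> every member of the pencil has zero diagonal, and
  such a determinant is twice the product of the off-diagonal entries.\<close>

lemma (in four_points) pencil_factors:
  "(det S)\<^sup>2 * det (D + mat x ** C) = 2 * (off_diagonal D' $ 1 + x * off_diagonal C' $ 1)
    * (off_diagonal D' $ 2 + x * off_diagonal C' $ 2) * (off_diagonal D' $ 3 + x * off_diagonal C' $ 3)"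
proof -
  let ?N = "D' + mat x ** C'"
  have "?N = transpose S ** (D + mat x ** C) ** S"
  proof -
    have congruence: "(transpose S ** M ** S) $ i $ j =
        (S $ 1 $ i * M $ 1 $ 1 + S $ 2 $ i * M $ 2 $ 1 + S $ 3 $ i * M $ 3 $ 1) * S $ 1 $ j
        + (S $ 1 $ i * M $ 1 $ 2 + S $ 2 $ i * M $ 2 $ 2 + S $ 3 $ i * M $ 3 $ 2) * S $ 2 $ j
        + (S $ 1 $ i * M $ 1 $ 3 + S $ 2 $ i * M $ 2 $ 3 + S $ 3 $ i * M $ 3 $ 3) * S $ 3 $ j" for M :: "'k ^ 3 ^ 3" and i j
      unfolding matrix_matrix_mult_def transpose_def vec_lambda_beta sum_3 ..
    have entry: "?N $ i $ j = (transpose S ** (D + mat x ** C) ** S) $ i $ j" for i j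
      unfolding C'_def D'_def vector_add_component mat_mult_nth congruence by Groebner_Basis.algebra
    then show ?thesis by (simp add: vec_eq_iff)
  qed
  then have det: "det ?N = (det S)\<^sup>2 * det (D + mat x ** C)"
    by (simp add: det_mul det_transpose power2_eq_square)
  have sym: "transpose ?N = ?N"
    unfolding vec_eq_iff transpose_def vec_lambda_beta vector_add_component mat_mult_nth
    using transpose_eqD[OF sym'(1)] transpose_eqD[OF sym'(2)] by metis
  have diag: "?N $ 1 $ 1 = 0" "?N $ 2 $ 2 = 0" "?N $ 3 $ 3 = 0"
    unfolding vector_add_component mat_mult_nth diagonal by simp_all
  show ?thesis
    unfolding det[symmetric] det_zero_diagonal[OF sym diag] off_diagonal_nth vector_add_component mat_mult_nth ..
qed

lemma map_poly_to_ac_add: "map_poly to_ac (p + r) = map_poly to_ac p + map_poly to_ac r"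
  by (rule poly_eqI) (simp add: coeff_map_poly)

lemma map_poly_to_ac_diff: "map_poly to_ac (p - r) = map_poly to_ac p - map_poly to_ac r"
  by (rule poly_eqI) (simp add: coeff_map_poly)

lemma map_poly_to_ac_mult: "map_poly to_ac (p * r) = map_poly to_ac p * map_poly to_ac r"
  by (rule poly_eqI) (simp add: coeff_map_poly coeff_mult to_ac_sum)

lemma map_poly_det_pencil:
  fixes C D :: "'a::field ^ 3 ^ 3"
  shows "map_poly to_ac (det (\<chi> i j. [:D $ i $ j, C $ i $ j:])) =
    det (\<chi> i j. [:map_matrix to_ac D $ i $ j, map_matrix to_ac C $ i $ j:])"
  unfolding det_3 vec_lambda_beta map_poly_to_ac_add map_poly_to_ac_diff map_poly_to_ac_mult
  by (simp add: map_poly_pCons)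

lemma poly_eq_cubic: "poly [:e, b, a, k:] x = cubic k a b e x"
  by (simp add: cubic_def power2_eq_square power3_eq_cube algebra_simps)

text \<open>A nonconstant common divisor with the derivative would have a root in the closure, which
  is a double root of the cubic.\<close>

lemma manin_imp_separable_cubic:
  fixes k a b e :: "'a::finite_field"
  assumes "manin (to_ac k) (to_ac a) (to_ac b) (to_ac e)"
  shows "separable_cubic [:e, b, a, k:]"
proof -
  interpret manin "to_ac k" "to_ac a" "to_ac b" "to_ac e" by (rule assms)
  let ?g = "[:e, b, a, k:]"
  have k0: "k \<noteq> 0" using k by simp
  have "coprime ?g (pderiv ?g)"
  proof (rule coprimeI)
    fix d assume d: "d dvd ?g" "d dvd pderiv ?g"
    have d0: "d \<noteq> 0" using d(1) k0 by auto
    show "is_unit d"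
    proof (rule ccontr)
      assume "\<not> is_unit d"
      then have "pdeg d > 0" using d0 by (simp add: is_unit_iff_degree)
      then have "pdeg (map_poly to_ac d) > 0" by (simp add: degree_map_poly)
      then obtain x where x: "poly (map_poly to_ac d) x = 0" using alg_closed_imp_poly_has_root by blast
      have zero: "poly (map_poly to_ac p) x = 0" if dp: "d dvd p" for p
      proof -
        obtain r where "p = d * r" using dp by (rule dvdE)
        then show ?thesis using x by (simp add: map_poly_to_ac_mult)
      qed
      have "cubic (to_ac k) (to_ac a) (to_ac b) (to_ac e) x = 0"
        using zero[OF d(1)] by (simp add: map_poly_pCons poly_eq_cubic[symmetric])
      moreover have "3 * to_ac k * x\<^sup>2 + 2 * to_ac a * x + to_ac b = 0"
        using zero[OF d(2)] by (simp add: map_poly_pCons pderiv_pCons power2_eq_square algebra_simps)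
      ultimately show False using separable by blast
    qed
  qed
  then show ?thesis using k0 by (simp add: separable_cubic_def)
qed

section \<open>Traces of the pencil cubics and the counts of vectors\<close>

context
  assumes odd_card: "odd CARD('a::finite_field)"
begin

lemma frobenius_trace_eq: "frobenius_trace g = - (\<Sum>x\<in>UNIV. qchar (poly g x))" for g :: "'a poly"
proof -
  have "card (curve_points g) = Suc (card {(x, y). y\<^sup>2 = poly g x})"
    unfolding curve_points_def by (subst card_insert_disjoint) (auto simp: card_image)
  also have "{(x, y). y\<^sup>2 = poly g x} = (SIGMA x:UNIV. {y. y\<^sup>2 = poly g x})" by auto
  also have "card \<dots> = (\<Sum>x\<in>UNIV. card {y. y\<^sup>2 = poly g x})" by (rule card_SigmaI) auto
  finally have "int (card (curve_points g)) = 1 + (\<Sum>x\<in>UNIV. int (card {y. y\<^sup>2 = poly g x}))" by simp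
  then show ?thesis unfolding frobenius_trace_def card_roots_square[OF odd_card] by (simp add: sum.distrib)
qed

lemma pencil_cubic_facts:
  fixes C D :: "'a ^ 3 ^ 3"
  assumes C: "transpose C = C" "det C \<noteq> 0" and D: "transpose D = D" "det D \<noteq> 0"
    and transversal: "transversal_conics C D"
  shows "separable_cubic (pencil_cubic C D)"
    and "(frobenius_trace (pencil_cubic C D))\<^sup>2 \<le> 4 * int CARD('a)"
    and "frobenius_trace (pencil_cubic C D) = - (\<Sum>x\<in>UNIV. qchar (det D * det (D + mat x ** C)))"
proof -
  let ?C = "to_closure C" and ?D = "to_closure D"
  note two = two_neq_zero_closure[OF odd_card]
  have C': "transpose ?C = ?C" "det ?C \<noteq> 0" and D': "transpose ?D = ?D" "det ?D \<noteq> 0"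
    using C D by (simp_all add: transpose_to_closure det_to_closure)
  have card: "card (plane_conic ?C \<inter> plane_conic ?D) = 4" using transversal by (simp add: transversal_conics_def)
  obtain a b where ab: "det (\<chi> i j. [:D $ i $ j, C $ i $ j:]) = [:det D, b, a, det C:]"
    by (rule det_pencil_eq)
  let ?k = "det D * det C" and ?a = "det D * a" and ?b = "det D * b" and ?e = "det D * det D"
  have g: "pencil_cubic C D = [:?e, ?b, ?a, ?k:]" unfolding pencil_cubic_def ab by simp
  have closure: "cubic (to_ac (det C)) (to_ac a) (to_ac b) (to_ac (det D)) x = det (?D + mat x ** ?C)" for x
    using arg_cong[OF ab, of "\<lambda>p. poly (map_poly to_ac p) x"]
    unfolding map_poly_det_pencil poly_det_pencil by (simp add: map_poly_pCons poly_eq_cubic[symmetric])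
  have nonzero: "det C \<noteq> 0" "det D \<noteq> 0" by (rule C D)+
  obtain p1 p2 p3 p4 where "four_points ?C ?D p1 p2 p3 p4"
    using four_points_of_card_4[OF two C' D' card] .
  then interpret four_points ?C ?D p1 p2 p3 p4 .
  note np = not_proportional[OF two C' D' card]
  have manin: "manin (to_ac ?k) (to_ac ?a) (to_ac ?b) (to_ac ?e)"
  proof
    show "to_ac ?k \<noteq> 0" using nonzero by simp
    show "(2 :: 'a alg_closure) \<noteq> 0" by (rule two)
    fix x
    assume "cubic (to_ac ?k) (to_ac ?a) (to_ac ?b) (to_ac ?e) x = 0"
    moreover have "cubic (to_ac ?k) (to_ac ?a) (to_ac ?b) (to_ac ?e) x
        = to_ac (det D) * cubic (to_ac (det C)) (to_ac a) (to_ac b) (to_ac (det D)) x"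
      by (simp add: cubic_def algebra_simps)
    ultimately have root: "cubic (to_ac (det C)) (to_ac a) (to_ac b) (to_ac (det D)) x = 0" using nonzero by simp
    have S2: "(det S)\<^sup>2 \<noteq> 0" using det_S by simp
    have k0: "to_ac (det C) \<noteq> 0" using nonzero by simp
    have "3 * to_ac (det C) * x\<^sup>2 + 2 * to_ac a * x + to_ac b \<noteq> 0"
      by (rule simple_roots[OF _ S2 k0 two off_nonzero off_independent[OF np] root])
        (unfold closure, rule pencil_factors)
    moreover have "3 * to_ac ?k * x\<^sup>2 + 2 * to_ac ?a * x + to_ac ?b
        = to_ac (det D) * (3 * to_ac (det C) * x\<^sup>2 + 2 * to_ac a * x + to_ac b)"
      by (simp add: algebra_simps)
    ultimately show "3 * to_ac ?k * x\<^sup>2 + 2 * to_ac ?a * x + to_ac ?b \<noteq> 0" using nonzero by simp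
  qed
  show "separable_cubic (pencil_cubic C D)"
    unfolding g by (rule manin_imp_separable_cubic[OF manin])
  show "(frobenius_trace (pencil_cubic C D))\<^sup>2 \<le> 4 * int CARD('a)"
    unfolding frobenius_trace_eq g poly_eq_cubic power2_minus by (rule hasse_bound[OF odd_card manin])
  show "frobenius_trace (pencil_cubic C D) = - (\<Sum>x\<in>UNIV. qchar (det D * det (D + mat x ** C)))"
    unfolding frobenius_trace_eq pencil_cubic_def poly_smult poly_det_pencil ..
qed

text \<open>If a member of the pencil were a multiple of the square of a linear form, this multiple
  would vanish at the common points. Three of them span the space, so it vanishes identically and
  \<open>C\<close> is a multiple of \<open>D\<close> over the closure, which transversality
  excludes.\<close>

lemma pencil_not_rank_le_1:
  fixes C D :: "'a ^ 3 ^ 3"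
  assumes C: "transpose C = C" "det C \<noteq> 0" and D: "transpose D = D" "det D \<noteq> 0"
    and transversal: "transversal_conics C D"
  shows "\<not> rank_le_1 (C + mat x ** D)"
proof
  let ?C = "to_closure C" and ?D = "to_closure D" and ?N = "C + mat x ** D"
  note two = two_neq_zero_closure[OF odd_card]
  have C': "transpose ?C = ?C" "det ?C \<noteq> 0" and D': "transpose ?D = ?D" "det ?D \<noteq> 0"
    using C D by (simp_all add: transpose_to_closure det_to_closure)
  have card: "card (plane_conic ?C \<inter> plane_conic ?D) = 4" using transversal by (simp add: transversal_conics_def)
  assume "rank_le_1 ?N"
  then obtain u c where u: "\<And>v. qf ?N v = c * (scalar_product u v)\<^sup>2" unfolding rank_le_1_def by blast
  define R where "R = ?N - (\<chi> i j. c * u $ i * u $ j)"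
  have entry: "R $ i $ j = C $ i $ j + x * D $ i $ j - c * u $ i * u $ j" for i j
    by (simp add: R_def mat_mult_nth)
  have "transpose R = R"
  proof -
    have "R $ j $ i = R $ i $ j" for i j
      unfolding entry transpose_eqD[OF C(1), of j i] transpose_eqD[OF D(1), of j i] by simp
    then show ?thesis by (simp add: vec_eq_iff transpose_def)
  qed
  moreover have "qf R v = 0" for v
  proof -
    have "qf R v = qf ?N v - c * (scalar_product u v)\<^sup>2"
      unfolding qf_def scalar_product_3 matrix_vector_mult_3 entry vector_add_component mat_mult_nth
      by Groebner_Basis.algebra
    then show ?thesis using u by simp
  qed
  ultimately have "R = 0" by (intro qf_eq_0_imp_zero two_neq_zero[OF odd_card])
  then have ent: "C $ i $ j = c * u $ i * u $ j - x * D $ i $ j" for i j using entry[of i j] by (simp add: algebra_simps)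
  have entK: "?C $ i $ j = to_ac c * acv u $ i * acv u $ j - to_ac x * ?D $ i $ j" for i j
    unfolding nth_map_matrix acv_nth by (subst ent) simp
  have qfK: "qf ?C w = to_ac c * (scalar_product (acv u) w)\<^sup>2 - to_ac x * qf ?D w" for w
    unfolding qf_def[of ?C] qf_def[of ?D] scalar_product_3 matrix_vector_mult_3 entK by Groebner_Basis.algebra
  obtain p1 p2 p3 p4 where "four_points ?C ?D p1 p2 p3 p4"
    using four_points_of_card_4[OF two C' D' card] .
  then interpret four_points ?C ?D p1 p2 p3 p4 .
  have vanish: "to_ac c * (scalar_product (acv u) p)\<^sup>2 = 0" if "p \<in> zeros ?C" "p \<in> zeros ?D" for p
    using qfK[of p] that by (simp add: zeros_def)
  have "to_ac c * (scalar_product (acv u) w)\<^sup>2 = 0" for w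
  proof (cases "to_ac c = 0")
    case False
    have "scalar_product (acv u) p1 = 0" "scalar_product (acv u) p2 = 0" "scalar_product (acv u) p3 = 0"
      using vanish[OF pC(1) pD(1)] vanish[OF pC(2) pD(2)] vanish[OF pC(3) pD(3)] False by simp_all
    moreover obtain n where n: "S *v n = w" using matrix_vector_mult_surj[OF det_S] .
    ultimately have "scalar_product (acv u) w = 0" unfolding n[symmetric] S_def columns_mult by simp
    then show ?thesis by simp
  qed simp
  then have "\<forall>w. qf ?C w = (- to_ac x) * qf ?D w" unfolding qfK by simp
  moreover have "card (plane_conic ?D \<inter> plane_conic ?C) = 4" using card by (simp only: Int_commute)
  then have "\<not> (\<exists>r. \<forall>v. qf ?C v = r * qf ?D v)" by (rule not_proportional[OF two D' C'])
  ultimately show False by blast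
qed

text \<open>For signs \<open>i\<close> and \<open>j\<close>, four times the indicator of
  \<open>c = i\<close> and \<open>d = j\<close> is
  \<open>(c\<^sup>2 + i * c) * (d\<^sup>2 + j * d)\<close>. Writing \<open>c\<^sup>2\<close> as one
  minus the indicator of the conic turns every term of the expansion into a known sum, and the two
  signs cover all four counts.\<close>

lemma position_counts:
  fixes C D :: "'a ^ 3 ^ 3" and b1 b2 :: nat
  defines "q \<equiv> int CARD('a)"
  assumes C: "transpose C = C" "det C \<noteq> 0" and D: "transpose D = D" "det D \<noteq> 0"
    and transversal: "transversal_conics C D"
    and t1: "t1 = frobenius_trace (pencil_cubic C D)" and t2: "t2 = frobenius_trace (pencil_cubic D C)"
    and b1: "(q - 1) * int b1 = int (card (zeros C \<inter> zeros D))"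
    and b2: "(q - 1) * int b2 = int (card (tangents C \<inter> tangents D))"
    and i: "i\<^sup>2 = 1" and j: "j\<^sup>2 = 1"
  shows "4 * int (card {v \<in> UNIV - {0}. position C v = i \<and> position D v = j})
    = (q - 1) * (q\<^sup>2 - q - 1 + int b1 + i * (q + t2) + j * (q + t1) + i * j * (q * (int b2 - 1)))"
proof -
  let ?V = "UNIV - {0 :: 'a ^ 3}"
  have q: "q > 1" using card_ge_3[OF odd_card] by (simp add: q_def)
  have transversal': "transversal_conics D C" using transversal by (simp add: transversal_conics_def Int_commute)
  have trace: "(\<Sum>v\<in>zeros D. position C v) = - ((q - 1) * t2)" "(\<Sum>v\<in>zeros C. position D v) = - ((q - 1) * t1)"
    unfolding t1 t2 pencil_cubic_facts(3)[OF C D transversal] pencil_cubic_facts(3)[OF D C transversal'] q_def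
    using sum_position_on_conic[OF odd_card C(1) D(1) pencil_not_rank_le_1[OF C D transversal]]
      sum_position_on_conic[OF odd_card D(1) C(1) pencil_not_rank_le_1[OF D C transversal']] by simp_all
  have "(\<Sum>v\<in>?V. of_bool (qf C v = 0) * position D v) = (\<Sum>v\<in>zeros C. position D v)"
    "(\<Sum>v\<in>?V. position C v * of_bool (qf D v = 0)) = (\<Sum>v\<in>zeros D. position C v)"
    by (rule sum.mono_neutral_cong_right; auto simp: zeros_def)+
  note conic = this[unfolded trace]
  have total: "(\<Sum>v\<in>?V. position M v) = q * (q - 1)" if "transpose M = M" "det M \<noteq> 0" for M :: "'a ^ 3 ^ 3"
    unfolding q_def by (rule sum_position_nonzero[OF odd_card that])
  have product: "(\<Sum>v\<in>?V. position C v * position D v) = (q - 1) * (q * (int b2 - 1))"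
    unfolding q_def by (rule sum_position_product[OF odd_card C D]) (use b2 in \<open>simp add: q_def\<close>)
  have zeros: "(\<Sum>v\<in>?V. of_bool (qf M v = 0)) = q\<^sup>2 - 1" if "transpose M = M" "det M \<noteq> 0" for M :: "'a ^ 3 ^ 3"
  proof -
    have "?V \<inter> {v. qf M v = 0} = zeros M" by (auto simp: zeros_def)
    then show ?thesis using card_zeros[OF odd_card that] by (simp add: q_def sum_of_bool_eq)
  qed
  have both: "(\<Sum>v\<in>?V. of_bool (qf C v = 0 \<and> qf D v = 0)) = (q - 1) * int b1"
  proof -
    have "?V \<inter> {v. qf C v = 0 \<and> qf D v = 0} = zeros C \<inter> zeros D" by (auto simp: zeros_def)
    then show ?thesis unfolding b1 by (simp add: sum_of_bool_eq)
  qed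
  have pointwise: "4 * of_bool (position C v = i \<and> position D v = j)
      = 1 - of_bool (qf C v = 0) - of_bool (qf D v = 0) + of_bool (qf C v = 0 \<and> qf D v = 0)
        + i * (position C v - position C v * of_bool (qf D v = 0))
        + j * (position D v - of_bool (qf C v = 0) * position D v)
        + i * j * (position C v * position D v)" for v
  proof -
    have "i = 1 \<or> i = -1" "j = 1 \<or> j = -1" using i j by (simp_all add: power2_eq_1_iff)
    moreover have "position C v = 0 \<and> qf C v = 0 \<or> position C v = 1 \<and> qf C v \<noteq> 0 \<or> position C v = -1 \<and> qf C v \<noteq> 0"
      using qchar_cases[of "- det C * qf C v"] C(2) unfolding position_def by (auto simp: qchar_def split: if_splits)
    moreover have "position D v = 0 \<and> qf D v = 0 \<or> position D v = 1 \<and> qf D v \<noteq> 0 \<or> position D v = -1 \<and> qf D v \<noteq> 0"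
      using qchar_cases[of "- det D * qf D v"] D(2) unfolding position_def by (auto simp: qchar_def split: if_splits)
    ultimately show ?thesis by (elim disjE conjE) simp_all
  qed
  have "4 * int (card {v \<in> ?V. position C v = i \<and> position D v = j}) = (\<Sum>v\<in>?V. 4 * of_bool (position C v = i \<and> position D v = j))"
  proof -
    have "{v \<in> ?V. position C v = i \<and> position D v = j} = ?V \<inter> {v. position C v = i \<and> position D v = j}" by auto
    then show ?thesis by (simp add: sum_distrib_left[symmetric] sum_of_bool_eq)
  qed
  also have "\<dots> = int (card ?V) - (q\<^sup>2 - 1) - (q\<^sup>2 - 1) + (q - 1) * int b1
      + i * (q * (q - 1) - - ((q - 1) * t2)) + j * (q * (q - 1) - - ((q - 1) * t1))
      + i * j * ((q - 1) * (q * (int b2 - 1)))"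
    unfolding pointwise
    by (simp only: sum.distrib sum_subtractf sum_distrib_left[symmetric] zeros[OF C] zeros[OF D] both conic
        total[OF C] total[OF D] product sum_constant mult_1_right of_nat_id)
  also have "int (card ?V) = q ^ 3 - 1" unfolding q_def by (rule card_nonzero_vectors[OF odd_card])
  finally show ?thesis by Groebner_Basis.algebra
qed

end

section \<open>Numerical estimates and the final theorem\<close>

lemma quarter_bound:
  fixes x z B N :: real
  assumes "z \<le> 4 * B" "- z \<le> 4 * B" and "N = 1 / 4 * (x + z)"
  shows "\<bar>N - x / 4\<bar> \<le> B"
proof -
  have "N - x / 4 = z / 4" unfolding assms(3) by (simp add: field_simps)
  then show ?thesis using assms(1,2) by (simp add: abs_le_iff)
qed

text \<open>Here \<open>x\<close> is \<open>q\<close>, \<open>r\<close> its square root,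
  \<open>y\<close> is \<open>b2 * q\<close> and \<open>u1\<close> is \<open>b1\<close>. The main
  error \<open>y\<close> is at most \<open>4 * x\<close>; in the count of doubly internal points the
  term \<open>- 4 * x\<close> moves its range to between \<open>- 4 * x\<close> and 0.\<close>

lemma trace_bounds:
  fixes x y r u1 t1 t2 :: real
  assumes "\<bar>t1\<bar> \<le> 2 * r" "\<bar>t2\<bar> \<le> 2 * r" "0 \<le> y" "y \<le> 4 * x" "0 \<le> u1" "u1 \<le> 4" "3 \<le> x"
  shows "u1 + t2 - y - 1 - t1 \<le> 4 * (x + r + 1)" "- (u1 + t2 - y - 1 - t1) \<le> 4 * (x + r + 1)"
    "t1 + u1 - t2 - y - 1 \<le> 4 * (x + r + 1)" "- (t1 + u1 - t2 - y - 1) \<le> 4 * (x + r + 1)"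
    "y + t1 + u1 + t2 - 1 \<le> 4 * (x + r + 1)" "- (y + t1 + u1 + t2 - 1) \<le> 4 * (x + r + 1)"
    "y + u1 - 1 - t1 - t2 - 4 * x \<le> 4 * (x + r + 1)" "- (y + u1 - 1 - t1 - t2 - 4 * x) \<le> 4 * (x + r + 1)"
  using assms by (simp_all add: abs_le_iff)

theorem theorem2p2:
  fixes C D :: "'a::finite_field ^ 3 ^ 3"
    and q b1 b2 :: nat and t1 t2 :: int
  assumes q: "q = CARD('a)" and odd_q: "odd q"
    and symmetric: "transpose C = C" "transpose D = D"
    and smooth: "det C \<noteq> 0" "det D \<noteq> 0"
    and transversal: "transversal_conics C D"
    and t1: "t1 = frobenius_trace (pencil_cubic C D)"
    and t2: "t2 = frobenius_trace (pencil_cubic D C)"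
    and b1: "b1 = num_rational (plane_conic (to_closure C) \<inter> plane_conic (to_closure D))"
    and b2: "b2 = num_rational (dual_conic (to_closure C) \<inter> dual_conic (to_closure D))"
  shows "separable_cubic (pencil_cubic C D) \<and> separable_cubic (pencil_cubic D C) \<and>
    real (N_ext_int C D) = 1 / 4 * (real q ^ 2 - real b2 * real q - 1 - real_of_int t1 + real b1 + real_of_int t2) \<and>
    real (N_int_ext C D) = 1 / 4 * (real q ^ 2 - real b2 * real q - 1 + real_of_int t1 + real b1 - real_of_int t2) \<and>
    real (N_ext_ext C D) = 1 / 4 * (real q ^ 2 + real b2 * real q - 1 + real_of_int t1 + real b1 + real_of_int t2) \<and>
    real (N_int_int C D) = 1 / 4 * (real q ^ 2 + real b2 * real q - 1 - real_of_int t1 + real b1 - real_of_int t2 - 4 * real q) \<and>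
    (\<forall>N \<in> {N_ext_int C D, N_int_ext C D, N_ext_ext C D, N_int_int C D}.
       \<bar>real N - real q ^ 2 / 4\<bar> \<le> real q + sqrt (real q) + 1)"
proof -
  let ?C = "to_closure C" and ?D = "to_closure D"
  have odd_card: "odd CARD('a)" using odd_q q by simp
  note C = symmetric(1) smooth(1) and D = symmetric(2) smooth(2)
  note two = two_neq_zero_closure[OF odd_card]
  have C': "transpose ?C = ?C" "det ?C \<noteq> 0" and D': "transpose ?D = ?D" "det ?D \<noteq> 0"
    using C D by (simp_all add: transpose_to_closure det_to_closure)
  have card: "card (plane_conic ?C \<inter> plane_conic ?D) = 4" using transversal by (simp add: transversal_conics_def)
  have transversal': "transversal_conics D C" using transversal by (simp add: transversal_conics_def Int_commute)
  have q3: "int q \<ge> 3" using card_ge_3[OF odd_card] q by simp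
  note facts = pencil_cubic_facts[OF odd_card C D transversal] pencil_cubic_facts[OF odd_card D C transversal']

  have b1': "(int CARD('a) - 1) * int b1 = int (card (zeros C \<inter> zeros D))"
  proof -
    have "{v :: 'a ^ 3. v \<noteq> 0 \<and> vec.span {acv v} \<in> plane_conic ?C \<inter> plane_conic ?D} = zeros C \<inter> zeros D"
    proof (intro equalityI subsetI)
      fix v :: "'a ^ 3" assume "v \<in> {v. v \<noteq> 0 \<and> vec.span {acv v} \<in> plane_conic ?C \<inter> plane_conic ?D}"
      then have "v \<noteq> 0" "vec.span {acv v} \<in> plane_conic ?C" "vec.span {acv v} \<in> plane_conic ?D" by simp_all
      then show "v \<in> zeros C \<inter> zeros D" by (simp add: span_in_plane_conic_iff zeros_acv_iff)
    next
      fix v :: "'a ^ 3" assume v: "v \<in> zeros C \<inter> zeros D"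
      then have "v \<noteq> 0" by (simp add: zeros_def)
      then show "v \<in> {v. v \<noteq> 0 \<and> vec.span {acv v} \<in> plane_conic ?C \<inter> plane_conic ?D}"
        using v by (simp add: span_in_plane_conic_iff zeros_acv_iff)
    qed
    then show ?thesis unfolding b1 num_rational_def card_rational by simp
  qed
  have b2': "(int CARD('a) - 1) * int b2 = int (card (tangents C \<inter> tangents D))"
  proof -
    have "{v :: 'a ^ 3. v \<noteq> 0 \<and> vec.span {acv v} \<in> dual_conic ?C \<inter> dual_conic ?D} = tangents C \<inter> tangents D"
    proof (intro equalityI subsetI)
      fix v :: "'a ^ 3" assume "v \<in> {v. v \<noteq> 0 \<and> vec.span {acv v} \<in> dual_conic ?C \<inter> dual_conic ?D}"
      then have "v \<noteq> 0" "vec.span {acv v} \<in> dual_conic ?C" "vec.span {acv v} \<in> dual_conic ?D" by simp_all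
      then show "v \<in> tangents C \<inter> tangents D"
        by (simp add: span_in_dual_conic_iff tangents_acv_iff[OF C(2)] tangents_acv_iff[OF D(2)])
    next
      fix v :: "'a ^ 3" assume v: "v \<in> tangents C \<inter> tangents D"
      then have "v \<noteq> 0" using tangents_nonzero[OF C(2), of v] by simp
      then show "v \<in> {v. v \<noteq> 0 \<and> vec.span {acv v} \<in> dual_conic ?C \<inter> dual_conic ?D}"
        using v by (simp add: span_in_dual_conic_iff tangents_acv_iff[OF C(2)] tangents_acv_iff[OF D(2)])
    qed
    then show ?thesis unfolding b2 num_rational_def card_rational by simp
  qed
  have b1_le: "b1 \<le> 4"
  proof -
    have "b1 \<le> card (plane_conic ?C \<inter> plane_conic ?D)"
      unfolding b1 num_rational_def using card by (intro card_mono card_ge_0_finite) auto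
    then show ?thesis using card by simp
  qed
  have b2_le: "b2 \<le> 4"
  proof -
    have "card (plane_conic ?D \<inter> plane_conic ?C) = 4" using card by (simp only: Int_commute)
    note np = not_proportional[OF two D' C' this]
    show ?thesis
      unfolding b2 num_rational_def by (rule common_tangents_le_4[OF two C' D' np]) auto
  qed

  \<comment> \<open>Dividing by \<open>q - 1\<close> passes from vectors to points.\<close>
  have count: "4 * int N = (int q)\<^sup>2 - int q - 1 + int b1 + i * (int q + t2) + j * (int q + t1) + i * j * (int q * (int b2 - 1))"
    if N: "(int CARD('a) - 1) * int N = int (card {v \<in> UNIV - {0}. position C v = i \<and> position D v = j})"
      and i: "i\<^sup>2 = 1" and j: "j\<^sup>2 = 1" for N :: nat and i j
  proof -
    have "(int q - 1) * (4 * int N) = (int q - 1) * ((int q)\<^sup>2 - int q - 1 + int b1 + i * (int q + t2) + j * (int q + t1)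
        + i * j * (int q * (int b2 - 1)))"
      using position_counts[OF odd_card C D transversal t1 t2 b1' b2' i j] N unfolding q by (simp only: mult.left_commute)
    then show ?thesis using q3 by simp
  qed
  have ext: "external A P \<Longrightarrow> defined_over base_field P" and int: "internal A P \<Longrightarrow> defined_over base_field P"
    for A :: "'a ^ 3 ^ 3" and P by (simp_all add: external_def internal_def)
  note iffC = external_internal_iff[OF odd_card C] and iffD = external_internal_iff[OF odd_card D]
  have 1: "4 * int (N_ext_int C D) = (int q)\<^sup>2 - int b2 * int q - 1 - t1 + int b1 + t2"
  proof -
    have "(int CARD('a) - 1) * int (N_ext_int C D) = int (card {v \<in> UNIV - {0}. position C v = 1 \<and> position D v = -1})"
      unfolding N_ext_int_def by (rule card_positions[OF odd_card]) (auto simp: iffC iffD dest: ext int)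
    from count[OF this] show ?thesis by (simp add: algebra_simps)
  qed
  have 2: "4 * int (N_int_ext C D) = (int q)\<^sup>2 - int b2 * int q - 1 + t1 + int b1 - t2"
  proof -
    have "(int CARD('a) - 1) * int (N_int_ext C D) = int (card {v \<in> UNIV - {0}. position C v = -1 \<and> position D v = 1})"
      unfolding N_int_ext_def by (rule card_positions[OF odd_card]) (auto simp: iffC iffD dest: ext int)
    from count[OF this] show ?thesis by (simp add: algebra_simps)
  qed
  have 3: "4 * int (N_ext_ext C D) = (int q)\<^sup>2 + int b2 * int q - 1 + t1 + int b1 + t2"
  proof -
    have "(int CARD('a) - 1) * int (N_ext_ext C D) = int (card {v \<in> UNIV - {0}. position C v = 1 \<and> position D v = 1})"
      unfolding N_ext_ext_def by (rule card_positions[OF odd_card]) (auto simp: iffC iffD dest: ext int)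
    from count[OF this] show ?thesis by (simp add: algebra_simps)
  qed
  have 4: "4 * int (N_int_int C D) = (int q)\<^sup>2 + int b2 * int q - 1 - t1 + int b1 - t2 - 4 * int q"
  proof -
    have "(int CARD('a) - 1) * int (N_int_int C D) = int (card {v \<in> UNIV - {0}. position C v = -1 \<and> position D v = -1})"
      unfolding N_int_int_def by (rule card_positions[OF odd_card]) (auto simp: iffC iffD dest: ext int)
    from count[OF this] show ?thesis by (simp add: algebra_simps)
  qed
  have real_eq: "real N = 1 / 4 * real_of_int z" if "4 * int N = z" for N z
    unfolding that[symmetric] by simp
  have formulas:
    "real (N_ext_int C D) = 1 / 4 * (real q ^ 2 - real b2 * real q - 1 - real_of_int t1 + real b1 + real_of_int t2)"
    "real (N_int_ext C D) = 1 / 4 * (real q ^ 2 - real b2 * real q - 1 + real_of_int t1 + real b1 - real_of_int t2)"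
    "real (N_ext_ext C D) = 1 / 4 * (real q ^ 2 + real b2 * real q - 1 + real_of_int t1 + real b1 + real_of_int t2)"
    "real (N_int_int C D) = 1 / 4 * (real q ^ 2 + real b2 * real q - 1 - real_of_int t1 + real b1 - real_of_int t2 - 4 * real q)"
    using real_eq[OF 1] real_eq[OF 2] real_eq[OF 3] real_eq[OF 4] by simp_all

  have hasse: "\<bar>real_of_int t\<bar> \<le> 2 * sqrt (real q)" if "t\<^sup>2 \<le> 4 * int CARD('a)" for t
  proof -
    have "real_of_int (t\<^sup>2) \<le> real_of_int (4 * int CARD('a))" using that by (simp only: of_int_le_iff)
    then have "(real_of_int t)\<^sup>2 \<le> (2 * sqrt (real q))\<^sup>2" by (simp add: q power_mult_distrib)
    then have "\<bar>real_of_int t\<bar> \<le> \<bar>2 * sqrt (real q)\<bar>" by (simp only: abs_le_square_iff)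
    then show ?thesis by simp
  qed
  have t: "\<bar>real_of_int t1\<bar> \<le> 2 * sqrt (real q)" "\<bar>real_of_int t2\<bar> \<le> 2 * sqrt (real q)"
    unfolding t1 t2 by (rule hasse; rule facts)+
  have bq: "0 \<le> real b2 * real q" "real b2 * real q \<le> 4 * real q"
    using b2_le by (simp_all add: mult_right_mono)
  have b: "0 \<le> real b1" "real b1 \<le> 4" using b1_le by simp_all
  have q3': "real q \<ge> 3" using q3 by linarith
  have shape: "x - y - 1 - t + u + v = x + (u + v - y - 1 - t)" "x - y - 1 + t + u - v = x + (t + u - v - y - 1)"
    "x + y - 1 + t + u + v = x + (y + t + u + v - 1)" "x + y - 1 - t + u - v - w = x + (y + u - 1 - t - v - w)"
    for x y t u v w :: real by simp_all
  have bound1: "\<bar>real (N_ext_int C D) - real q ^ 2 / 4\<bar> \<le> real q + sqrt (real q) + 1"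
    by (rule quarter_bound[OF _ _ formulas(1)[unfolded shape(1)]]) (rule trace_bounds[OF t bq b q3'])+
  have bound2: "\<bar>real (N_int_ext C D) - real q ^ 2 / 4\<bar> \<le> real q + sqrt (real q) + 1"
    by (rule quarter_bound[OF _ _ formulas(2)[unfolded shape(2)]]) (rule trace_bounds[OF t bq b q3'])+
  have bound3: "\<bar>real (N_ext_ext C D) - real q ^ 2 / 4\<bar> \<le> real q + sqrt (real q) + 1"
    by (rule quarter_bound[OF _ _ formulas(3)[unfolded shape(3)]]) (rule trace_bounds[OF t bq b q3'])+
  have bound4: "\<bar>real (N_int_int C D) - real q ^ 2 / 4\<bar> \<le> real q + sqrt (real q) + 1"
    by (rule quarter_bound[OF _ _ formulas(4)[unfolded shape(4)]]) (rule trace_bounds[OF t bq b q3'])+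
  from bound1 bound2 bound3 bound4 have bounds: "\<forall>N \<in> {N_ext_int C D, N_int_ext C D, N_ext_ext C D, N_int_int C D}.
      \<bar>real N - real q ^ 2 / 4\<bar> \<le> real q + sqrt (real q) + 1" by simp
  show ?thesis using facts(1,4) formulas bounds by (intro conjI)
qed

end
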